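(* Let $n\ge1$, $a\in\mathbb C$ and $\nu\in\mathbb C^{n+1}$ with $\nu\notin\mathbb Z^{n+1}$ and $a-|\nu|\in\mathbb Z$, where $|\nu|=\sum_{i=0}^n\nu_i$. Then the categories $(\mathcal D,\mathcal H)_{\nu}$-mod and $(\mathcal D^E,\mathcal H)^a_{\nu}$-mod are equivalent.
   Context: Ground field $\mathbb C$. $\mathcal D=\mathcal D(n+1)$ is the Weyl algebra of differential operators on $\mathbb C[t_0,\dots,t_n]$, $\mathcal H=\mathbb C[t_0\partial_0,\dots,t_n\partial_n]$, $E=\sum_i t_i\partial_i$, and $\mathcal D^E$ is the centralizer of $E$ in $\mathcal D$. For $\mathcal U=\mathcal D$ or $\mathcal D^E$, a generalized weight $(\mathcal U,\mathcal H)$-module is a $\mathcal U$-module $M=\bigoplus_{\lambda\in\mathbb C^{n+1}}M^{(\lambda)}$, $M^{(\lambda)}=\{m:(t_i\partial_i-\lambda_i)^Nm=0\text{ for some }N>0\text{ and all }i\}$; its support is $\{\lambda : M^{(\lambda)}\ne0\}$. $(\mathcal D,\mathcal H)_\nu$-mod is the category of generalized weight $(\mathcal D,\mathcal H)$-modules with support in $\nu+\mathbb Z^{n+1}$. $(\mathcal D^E,\mathcal H)^a_\nu$-mod is the category of generalized weight $(\mathcal D^E,\mathcal H)$-modules on which $E-a$ acts locally nilpotently and whose support lies in $\nu+\mathbb Z^{n+1}$. *)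

theory Defs
  imports
    "HOL-Analysis.Finite_Cartesian_Product"
    "HOL-Library.FuncSet"
    "HOL-Library.Poly_Mapping"
    "HOL-Algebra.Module"
begin

section \<open>The Weyl algebra and the centralizer of the Euler operator\<close>

text \<open>Polynomials over \<open>\<complex>\<close> in variables \<open>t\<^sub>i\<close> indexed by a finite type \<open>'n\<close>:
  finitely supported functions from monomials (exponent vectors) to coefficients.\<close>

type_synonym 'n cpoly = "('n \<Rightarrow>\<^sub>0 nat) \<Rightarrow>\<^sub>0 complex"
type_synonym 'n oper = "'n cpoly \<Rightarrow> 'n cpoly"

definition scal :: "complex \<Rightarrow> 'n oper" where
  "scal c = (\<lambda>p. Poly_Mapping.single 0 c * p)"

definition mult_var :: "'n \<Rightarrow> 'n oper" where
  "mult_var i = (\<lambda>p. Poly_Mapping.single (Poly_Mapping.single i 1) 1 * p)"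

text \<open>The exponent subtraction below is truncated, but this only happens where the coefficient
  \<open>m\<^sub>i\<close> vanishes.\<close>

definition partial_deriv :: "'n \<Rightarrow> 'n oper" where
  "partial_deriv i = (\<lambda>p. \<Sum>m\<in>Poly_Mapping.keys p.
     Poly_Mapping.single (m - Poly_Mapping.single i 1)
       (of_nat (Poly_Mapping.lookup m i) * Poly_Mapping.lookup p m))"

inductive_set weyl_set :: "'n oper set" where
  scal: "scal c \<in> weyl_set"
| var: "mult_var i \<in> weyl_set"
| deriv: "partial_deriv i \<in> weyl_set"
| add: "X \<in> weyl_set \<Longrightarrow> Y \<in> weyl_set \<Longrightarrow> (\<lambda>p. X p + Y p) \<in> weyl_set"
| comp: "X \<in> weyl_set \<Longrightarrow> Y \<in> weyl_set \<Longrightarrow> X \<circ> Y \<in> weyl_set"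

definition weyl :: "'n oper ring" where
  "weyl = \<lparr>carrier = weyl_set, mult = (\<circ>), one = id,
           zero = (\<lambda>p. 0), add = (\<lambda>X Y p. X p + Y p)\<rparr>"

definition theta :: "'n \<Rightarrow> 'n oper" where
  "theta i = mult_var i \<circ> partial_deriv i"

definition euler :: "'n::finite oper" where
  "euler = (\<lambda>p. \<Sum>i\<in>UNIV. theta i p)"

definition weylE :: "'n::finite oper ring" where
  "weylE = weyl\<lparr>carrier := {X \<in> carrier weyl. X \<circ> euler = euler \<circ> X}\<rparr>"

section \<open>Left modules over a not necessarily commutative ring\<close>

text \<open>We reuse the record of \<open>HOL-Algebra.Module\<close>, whose locale of modules is restricted to
  commutative base rings.  As there, the fields \<open>mult\<close> and \<open>one\<close> of the module are ignored.\<close>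

locale left_module = R: ring R + M: abelian_group M
  for R :: "('a, 'b) ring_scheme" (structure) and M :: "('a, 'c, 'd) module_scheme" (structure) +
  assumes smult_closed: "\<lbrakk>a \<in> carrier R; x \<in> carrier M\<rbrakk> \<Longrightarrow> a \<odot>\<^bsub>M\<^esub> x \<in> carrier M"
    and smult_l_distr: "\<lbrakk>a \<in> carrier R; b \<in> carrier R; x \<in> carrier M\<rbrakk> \<Longrightarrow>
      (a \<oplus>\<^bsub>R\<^esub> b) \<odot>\<^bsub>M\<^esub> x = (a \<odot>\<^bsub>M\<^esub> x) \<oplus>\<^bsub>M\<^esub> (b \<odot>\<^bsub>M\<^esub> x)"
    and smult_r_distr: "\<lbrakk>a \<in> carrier R; x \<in> carrier M; y \<in> carrier M\<rbrakk> \<Longrightarrow>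
      a \<odot>\<^bsub>M\<^esub> (x \<oplus>\<^bsub>M\<^esub> y) = (a \<odot>\<^bsub>M\<^esub> x) \<oplus>\<^bsub>M\<^esub> (a \<odot>\<^bsub>M\<^esub> y)"
    and smult_assoc: "\<lbrakk>a \<in> carrier R; b \<in> carrier R; x \<in> carrier M\<rbrakk> \<Longrightarrow>
      (a \<otimes>\<^bsub>R\<^esub> b) \<odot>\<^bsub>M\<^esub> x = a \<odot>\<^bsub>M\<^esub> (b \<odot>\<^bsub>M\<^esub> x)"
    and smult_one: "x \<in> carrier M \<Longrightarrow> \<one>\<^bsub>R\<^esub> \<odot>\<^bsub>M\<^esub> x = x"

text \<open>Homomorphisms are extensional (undefined off the carrier), so that equality of
  homomorphisms is equality as maps on the carrier.\<close>

definition left_module_hom ::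
  "('a, 'b) ring_scheme \<Rightarrow> ('a, 'c, 'd) module_scheme \<Rightarrow> ('a, 'e, 'f) module_scheme \<Rightarrow> ('c \<Rightarrow> 'e) set"
  where
  "left_module_hom R M N = {f \<in> carrier M \<rightarrow>\<^sub>E carrier N.
     (\<forall>x\<in>carrier M. \<forall>y\<in>carrier M. f (x \<oplus>\<^bsub>M\<^esub> y) = f x \<oplus>\<^bsub>N\<^esub> f y) \<and>
     (\<forall>a\<in>carrier R. \<forall>x\<in>carrier M. f (a \<odot>\<^bsub>M\<^esub> x) = a \<odot>\<^bsub>N\<^esub> f x)}"

text \<open>Every element is uniquely a finite sum of elements of the \<open>A l\<close>.\<close>

definition internal_direct_sum :: "('c, 'd) ring_scheme \<Rightarrow> ('l \<Rightarrow> 'c set) \<Rightarrow> bool" where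
  "internal_direct_sum M A \<longleftrightarrow> (\<forall>l. A l \<subseteq> carrier M) \<and>
     (\<forall>m\<in>carrier M. \<exists>!f. (\<forall>l. f l \<in> A l) \<and> finite {l. f l \<noteq> \<zero>\<^bsub>M\<^esub>} \<and>
        m = finsum M f {l. f l \<noteq> \<zero>\<^bsub>M\<^esub>})"

section \<open>Generalized weight modules\<close>

definition weight_space ::
  "'n::finite oper ring \<Rightarrow> ('n oper, 'u) module \<Rightarrow> complex ^ 'n \<Rightarrow> 'u set" where
  "weight_space U M l = {m \<in> carrier M. \<exists>N>0. \<forall>i.
     ((\<lambda>p. theta i p - scal (l $ i) p) [^]\<^bsub>U\<^esub> (N::nat)) \<odot>\<^bsub>M\<^esub> m = \<zero>\<^bsub>M\<^esub>}"

definition generalized_weight_module :: "'n::finite oper ring \<Rightarrow> ('n oper, 'u) module \<Rightarrow> bool" where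
  "generalized_weight_module U M \<longleftrightarrow>
     left_module U M \<and> internal_direct_sum M (weight_space U M)"

definition weight_support ::
  "'n::finite oper ring \<Rightarrow> ('n oper, 'u) module \<Rightarrow> (complex ^ 'n) set" where
  "weight_support U M = {l. weight_space U M l \<noteq> {\<zero>\<^bsub>M\<^esub>}}"

definition int_lattice :: "(complex ^ 'n) set" where
  "int_lattice = {z. \<forall>i. z $ i \<in> \<int>}"

definition euler_locally_nilpotent ::
  "'n::finite oper ring \<Rightarrow> ('n oper, 'u) module \<Rightarrow> complex \<Rightarrow> bool" where
  "euler_locally_nilpotent U M a \<longleftrightarrow> (\<forall>m\<in>carrier M. \<exists>N>0.
     ((\<lambda>p. euler p - scal a p) [^]\<^bsub>U\<^esub> (N::nat)) \<odot>\<^bsub>M\<^esub> m = \<zero>\<^bsub>M\<^esub>)"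

section \<open>Categories and equivalences\<close>

text \<open>Hom-sets of distinct pairs of objects may overlap, so composition takes the three objects
  as arguments: \<open>Comp C X Y Z g f\<close> is the composite of \<open>f: X \<rightarrow> Y\<close> and \<open>g: Y \<rightarrow> Z\<close>.\<close>

record ('o, 'm) cat =
  Obj :: "'o set"
  Hom :: "'o \<Rightarrow> 'o \<Rightarrow> 'm set"
  Ident :: "'o \<Rightarrow> 'm"
  Comp :: "'o \<Rightarrow> 'o \<Rightarrow> 'o \<Rightarrow> 'm \<Rightarrow> 'm \<Rightarrow> 'm"

definition is_category :: "('o, 'm) cat \<Rightarrow> bool" where
  "is_category C \<longleftrightarrow>
     (\<forall>X\<in>Obj C. Ident C X \<in> Hom C X X) \<and>
     (\<forall>X\<in>Obj C. \<forall>Y\<in>Obj C. \<forall>Z\<in>Obj C. \<forall>f\<in>Hom C X Y. \<forall>g\<in>Hom C Y Z.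
        Comp C X Y Z g f \<in> Hom C X Z) \<and>
     (\<forall>X\<in>Obj C. \<forall>Y\<in>Obj C. \<forall>f\<in>Hom C X Y.
        Comp C X X Y f (Ident C X) = f \<and> Comp C X Y Y (Ident C Y) f = f) \<and>
     (\<forall>W\<in>Obj C. \<forall>X\<in>Obj C. \<forall>Y\<in>Obj C. \<forall>Z\<in>Obj C.
        \<forall>f\<in>Hom C W X. \<forall>g\<in>Hom C X Y. \<forall>h\<in>Hom C Y Z.
        Comp C W X Z (Comp C X Y Z h g) f = Comp C W Y Z h (Comp C W X Y g f))"

text \<open>A functor is given by its action \<open>F0\<close> on objects and its action \<open>F1 X Y\<close> on \<open>Hom C X Y\<close>.\<close>

definition is_functor ::
  "('o, 'm) cat \<Rightarrow> ('p, 'q) cat \<Rightarrow> ('o \<Rightarrow> 'p) \<Rightarrow> ('o \<Rightarrow> 'o \<Rightarrow> 'm \<Rightarrow> 'q) \<Rightarrow> bool" where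
  "is_functor C D F0 F1 \<longleftrightarrow>
     is_category C \<and> is_category D \<and>
     (\<forall>X\<in>Obj C. F0 X \<in> Obj D) \<and>
     (\<forall>X\<in>Obj C. \<forall>Y\<in>Obj C. \<forall>f\<in>Hom C X Y. F1 X Y f \<in> Hom D (F0 X) (F0 Y)) \<and>
     (\<forall>X\<in>Obj C. F1 X X (Ident C X) = Ident D (F0 X)) \<and>
     (\<forall>X\<in>Obj C. \<forall>Y\<in>Obj C. \<forall>Z\<in>Obj C. \<forall>f\<in>Hom C X Y. \<forall>g\<in>Hom C Y Z.
        F1 X Z (Comp C X Y Z g f) = Comp D (F0 X) (F0 Y) (F0 Z) (F1 Y Z g) (F1 X Y f))"

definition is_iso :: "('o, 'm) cat \<Rightarrow> 'o \<Rightarrow> 'o \<Rightarrow> 'm \<Rightarrow> bool" where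
  "is_iso C X Y f \<longleftrightarrow> f \<in> Hom C X Y \<and>
     (\<exists>g\<in>Hom C Y X. Comp C X Y X g f = Ident C X \<and> Comp C Y X Y f g = Ident C Y)"

definition naturally_isomorphic ::
  "('o, 'm) cat \<Rightarrow> ('p, 'q) cat \<Rightarrow> ('o \<Rightarrow> 'p) \<Rightarrow> ('o \<Rightarrow> 'o \<Rightarrow> 'm \<Rightarrow> 'q) \<Rightarrow>
   ('o \<Rightarrow> 'p) \<Rightarrow> ('o \<Rightarrow> 'o \<Rightarrow> 'm \<Rightarrow> 'q) \<Rightarrow> bool" where
  "naturally_isomorphic C D F0 F1 G0 G1 \<longleftrightarrow>
     is_functor C D F0 F1 \<and> is_functor C D G0 G1 \<and>
     (\<exists>\<eta>. (\<forall>X\<in>Obj C. is_iso D (F0 X) (G0 X) (\<eta> X)) \<and>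
          (\<forall>X\<in>Obj C. \<forall>Y\<in>Obj C. \<forall>f\<in>Hom C X Y.
             Comp D (F0 X) (F0 Y) (G0 Y) (\<eta> Y) (F1 X Y f) =
             Comp D (F0 X) (G0 X) (G0 Y) (G1 X Y f) (\<eta> X)))"

definition equivalent_categories :: "('o, 'm) cat \<Rightarrow> ('p, 'q) cat \<Rightarrow> bool" where
  "equivalent_categories C D \<longleftrightarrow>
     (\<exists>F0 F1 G0 G1. is_functor C D F0 F1 \<and> is_functor D C G0 G1 \<and>
        naturally_isomorphic C C
          (\<lambda>X. G0 (F0 X)) (\<lambda>X Y f. G1 (F0 X) (F0 Y) (F1 X Y f)) (\<lambda>X. X) (\<lambda>X Y f. f) \<and>
        naturally_isomorphic D D
          (\<lambda>X. F0 (G0 X)) (\<lambda>X Y f. F1 (G0 X) (G0 Y) (G1 X Y f)) (\<lambda>X. X) (\<lambda>X Y f. f))"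

section \<open>The module categories\<close>

text \<open>The category of left \<open>R\<close>-modules satisfying \<open>P\<close>, with all homomorphisms between them.  The type \<open>'u\<close> plays the role of the
  universe: the objects are the modules whose underlying set is an arbitrary subset of \<open>'u\<close>.\<close>

definition module_cat ::
  "('a, 'b) ring_scheme \<Rightarrow> (('a, 'u) module \<Rightarrow> bool) \<Rightarrow> (('a, 'u) module, 'u \<Rightarrow> 'u) cat" where
  "module_cat R P = \<lparr>Obj = {M. left_module R M \<and> P M},
     Hom = left_module_hom R,
     Ident = (\<lambda>M. \<lambda>x\<in>carrier M. x),
     Comp = (\<lambda>L M N g f. compose (carrier L) g f)\<rparr>"

definition DH_mod :: "complex ^ 'n::finite \<Rightarrow> (('n oper, 'u) module, 'u \<Rightarrow> 'u) cat" where
  "DH_mod \<nu> = module_cat weyl (\<lambda>M. generalized_weight_module weyl M \<and>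
     weight_support weyl M \<subseteq> {\<nu> + z | z. z \<in> int_lattice})"

definition DEH_mod :: "complex \<Rightarrow> complex ^ 'n::finite \<Rightarrow> (('n oper, 'u) module, 'u \<Rightarrow> 'u) cat" where
  "DEH_mod a \<nu> = module_cat weylE (\<lambda>M. generalized_weight_module weylE M \<and>
     euler_locally_nilpotent weylE M a \<and>
     weight_support weylE M \<subseteq> {\<nu> + z | z. z \<in> int_lattice})"

section \<open>Basic consistency facts\<close>

lemma left_module_homI_compose:
  assumes M: "left_module R M" and f: "f \<in> left_module_hom R M N" and g: "g \<in> left_module_hom R N L"
  shows "compose (carrier M) g f \<in> left_module_hom R M L"
proof -
  interpret left_module R M by (fact M)
  have "f x \<in> carrier N" if "x \<in> carrier M" for x
    using f that by (auto simp: left_module_hom_def)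
  then show ?thesis
    using f g by (auto simp: left_module_hom_def compose_def smult_closed PiE_mem)
qed

lemma left_module_hom_id:
  assumes "left_module R M"
  shows "(\<lambda>x\<in>carrier M. x) \<in> left_module_hom R M M"
proof -
  interpret left_module R M by (fact assms)
  show ?thesis by (auto simp: left_module_hom_def smult_closed)
qed

lemma left_module_hom_extensional_funcset:
  "f \<in> left_module_hom R M N \<Longrightarrow> f \<in> extensional (carrier M) \<inter> (carrier M \<rightarrow> carrier N)"
  by (auto simp: left_module_hom_def PiE_def)

lemma is_category_module_cat: "is_category (module_cat R P)"
  unfolding is_category_def module_cat_def
  by (auto simp: left_module_hom_id left_module_homI_compose compose_assoc
      dest!: left_module_hom_extensional_funcset intro: Id_compose compose_Id)

lemma lookup_partial_deriv:
  "Poly_Mapping.lookup (partial_deriv i p) m =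
     of_nat (Poly_Mapping.lookup m i + 1) * Poly_Mapping.lookup p (m + Poly_Mapping.single i 1)"
  (is "?L = ?R")
proof -
  let ?e = "Poly_Mapping.single i (1::nat)"
  let ?c = "\<lambda>k. of_nat (Poly_Mapping.lookup k i) * Poly_Mapping.lookup p k"
  have *: "Poly_Mapping.lookup (Poly_Mapping.single (k - ?e) (?c k)) m =
      (if k = m + ?e then ?c k else 0)" for k
  proof (cases "Poly_Mapping.lookup k i = 0")
    case True
    then have "k \<noteq> m + ?e" by (auto simp: lookup_add)
    with True show ?thesis by simp
  next
    case False
    then have "k - ?e + ?e = k"
      by (intro poly_mapping_eqI) (auto simp: lookup_add lookup_minus lookup_single when_def)
    then have "k - ?e = m \<longleftrightarrow> k = m + ?e" by (metis add_diff_cancel_right')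
    then show ?thesis by (simp add: lookup_single when_def)
  qed
  have "?L = (\<Sum>k\<in>Poly_Mapping.keys p. if k = m + ?e then ?c k else 0)"
    unfolding partial_deriv_def lookup_sum * ..
  also have "\<dots> = ?R"
    by (simp add: sum.delta in_keys_iff lookup_add)
  finally show ?thesis .
qed

lemma partial_deriv_add: "partial_deriv i (p + q) = partial_deriv i p + partial_deriv i q"
  by (rule poly_mapping_eqI) (simp add: lookup_partial_deriv lookup_add algebra_simps)

lemma weyl_set_additive: "X \<in> weyl_set \<Longrightarrow> X (p + q) = X p + X q"
  by (induction X arbitrary: p q rule: weyl_set.induct)
     (auto simp: scal_def mult_var_def partial_deriv_add algebra_simps)

lemma id_in_weyl: "id \<in> (weyl_set :: 'n oper set)"
proof -
  have "id = (scal 1 :: 'n oper)" by (simp add: scal_def id_def)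
  then show ?thesis by (metis weyl_set.scal)
qed

lemma zero_in_weyl: "(\<lambda>p. 0) \<in> (weyl_set :: 'n oper set)"
proof -
  have "(\<lambda>p. 0) = (scal 0 :: 'n oper)" by (simp add: scal_def)
  then show ?thesis by (simp add: weyl_set.scal)
qed

lemma uminus_in_weyl: "X \<in> weyl_set \<Longrightarrow> (\<lambda>p. - X p) \<in> weyl_set"
proof -
  assume X: "X \<in> weyl_set"
  have "(\<lambda>p. - X p) = scal (-1) \<circ> X"
    by (auto simp: scal_def fun_eq_iff single_uminus single_one)
  then show ?thesis using X by (simp add: weyl_set.scal weyl_set.comp)
qed

lemma ring_weyl: "ring weyl"
proof (rule ringI)
  show "abelian_group (weyl :: 'n oper ring)"
    by (rule abelian_groupI)
       (auto simp: weyl_def weyl_set.add zero_in_weyl fun_eq_iff algebra_simps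
         intro!: bexI[OF _ uminus_in_weyl])
  show "Group.monoid (weyl :: 'n oper ring)"
    by (rule monoidI) (auto simp: weyl_def weyl_set.comp id_in_weyl)
qed (auto simp: weyl_def fun_eq_iff weyl_set_additive)

lemma theta_in_weyl: "theta i \<in> weyl_set"
  by (simp add: theta_def weyl_set.intros)

lemma euler_in_weyl: "euler \<in> weyl_set"
proof -
  have "(\<lambda>p. \<Sum>i\<in>A. theta i p) \<in> weyl_set" if "finite A" for A :: "'n::finite set"
    using that by induction (simp_all add: zero_in_weyl weyl_set.add theta_in_weyl)
  then show ?thesis by (simp add: euler_def)
qed

lemma ring_weylE: "ring (weylE :: 'n::finite oper ring)"
proof -
  have add: "euler (p + q) = euler p + euler q" for p q :: "'n cpoly"
    by (rule weyl_set_additive[OF euler_in_weyl])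
  have zero: "euler (0 :: 'n cpoly) = 0" using add[of 0 0] by simp
  have neg: "euler (- p) = - euler p" for p :: "'n cpoly"
    using add[of p "- p"] zero by (simp add: eq_neg_iff_add_eq_0 add.commute)
  show ?thesis
  proof (rule ringI)
    show "abelian_group (weylE :: 'n oper ring)"
    proof (rule abelian_groupI)
      fix X :: "'n oper"
      assume "X \<in> carrier weylE"
      then have "(\<lambda>p. - X p) \<in> carrier weylE"
        by (simp add: weylE_def weyl_def uminus_in_weyl fun_eq_iff neg)
      then show "\<exists>Y\<in>carrier weylE. Y \<oplus>\<^bsub>weylE\<^esub> X = \<zero>\<^bsub>weylE\<^esub>"
        by (rule bexI[rotated]) (simp add: weylE_def weyl_def)
    qed (auto simp: weylE_def weyl_def weyl_set.add zero_in_weyl fun_eq_iff algebra_simps add zero)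
    show "Group.monoid (weylE :: 'n oper ring)"
      by (rule monoidI) (auto simp: weylE_def weyl_def weyl_set.comp id_in_weyl fun_eq_iff)
  qed (auto simp: weylE_def weyl_def fun_eq_iff weyl_set_additive)
qed

end

(* The functor from left to right sends M to its generalized eigenspace M^a for the eigenvalue a of
   the Euler operator E.  Choose i with nu_i not an integer.  On every object M of the left-hand
   category t_i d_i and d_i t_i = t_i d_i + 1 act bijectively, so t_i and d_i do; as a - |nu| is an
   integer, E has only eigenvalues in a + Z on M.  Hence M^a generates M, every nonzero submodule of M
   meets M^a, and each eigenspace of E on M is the image of M^a under a single operator.  The first two
   facts make the functor fully faithful: the submodule of M x M' generated by the graph of a map
   g: M^a -> M'^a is again the graph of a map.  For essential surjectivity, let N be an object on the
   right.  The generalized weight part with weights in nu + Z^(n+1) of the coinduced module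
   Hom_{D^E}(D, N) has degree a part N, by evaluation at 1.  It lives on a larger type, but it is
   spanned by countably many images of N, and N is zero or infinite, so it has at most as many elements
   as N (or is zero) and can be transported back. *)

theory Submission
  imports
    Defs
    "HOL-Computational_Algebra.Field_as_Ring"
    "HOL-Computational_Algebra.Fundamental_Theorem_Algebra"
    "HOL-Computational_Algebra.Polynomial_Factorial"
begin

text \<open>Weight conditions are handled through annihilating polynomials with prescribed roots, so
  that Bezout identities do the linear algebra: they separate eigenvalues, and they invert t_i d_i
  and d_i t_i because the coset nu_i + Z avoids 0 and -1. An operator of degree d merely translates
  the roots by d. Weight lambda has Euler eigenvalue |lambda|, which is where a - |nu| enters. The
  submodule generated by the graph of g might fail to be single-valued; the values over 0 form a
  submodule of M' without degree a part, hence vanish. Coinduction is used instead of a tensor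
  product because its elements are plain functions and no quotient has to be formed. Evaluation at 1
  is inverted with the projection of D onto its degree zero part D^E, which is D^E-linear on both
  sides: on the left so that the inverse lands in the coinduced module, on the right so that it
  preserves weights. The weight part has to be taken since a function on D may be nonzero in
  infinitely many degrees. The transport at the end is forced because all objects of both categories
  have carriers in one fixed type.\<close>

lemma lookup_scal: "Poly_Mapping.lookup (scal c p) m = c * Poly_Mapping.lookup p m"
proof -
  have "scal c p = Poly_Mapping.map ((*) c) p"
    by (simp add: scal_def mult_map_scale_conv_mult)
  then show ?thesis
    by (simp add: Poly_Mapping.map.rep_eq when_def)
qed

lemma scal_add: "scal c (p + q) = scal c p + scal c q"
  by (simp add: scal_def algebra_simps)

lemma scal_zero [simp]: "scal c 0 = 0"
  by (simp add: scal_def)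

lemma scal_0 [simp]: "scal 0 p = 0"
  by (simp add: scal_def)

lemma scal_1 [simp]: "scal 1 p = p"
  by (simp add: scal_def)

lemma scal_plus: "scal (c + d) p = scal c p + scal d p"
  by (simp add: scal_def single_add algebra_simps)

lemma scal_scal: "scal c (scal d p) = scal (c * d) p"
  by (rule poly_mapping_eqI) (simp add: lookup_scal)

lemma scal_minus: "scal (- c) p = - scal c p"
  by (simp add: scal_def single_uminus)

lemma lookup_mult_var:
  "Poly_Mapping.lookup (mult_var i p) m =
     (if Poly_Mapping.lookup m i = 0 then 0
      else Poly_Mapping.lookup p (m - Poly_Mapping.single i 1))"
proof (induction p rule: update_induct)
  case const
  then show ?case by (simp add: mult_var_def)
next
  case (update p k c)
  have upd: "Poly_Mapping.update k c p = Poly_Mapping.single k c + p"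
    using update by (intro poly_mapping_eqI)
      (auto simp: lookup_update lookup_add lookup_single when_def in_keys_iff)
  have "(Poly_Mapping.single i 1 + k = m) \<longleftrightarrow>
      Poly_Mapping.lookup m i \<noteq> 0 \<and> k = m - Poly_Mapping.single i (1::nat)"
  proof safe
    assume "Poly_Mapping.lookup m i > 0"
    then show "Poly_Mapping.single i 1 + (m - Poly_Mapping.single i 1) = m"
      by (intro poly_mapping_eqI) (auto simp: lookup_add lookup_minus lookup_single when_def)
  qed (auto simp: lookup_add)
  then show ?case
    using update unfolding upd mult_var_def
    by (auto simp: distrib_left mult_single lookup_add lookup_single when_def)
qed

lemma weyl_set_linear: "X \<in> weyl_set \<Longrightarrow> X (scal c p) = scal c (X p)"
proof (induction X arbitrary: p rule: weyl_set.induct)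
  case (deriv i)
  then show ?case
    by (intro poly_mapping_eqI) (simp add: lookup_partial_deriv lookup_scal)
next
  case (var i)
  then show ?case
    by (intro poly_mapping_eqI) (simp add: lookup_mult_var lookup_scal)
qed (simp_all add: scal_scal mult.commute scal_add)

lemma weyl_set_0: "X \<in> weyl_set \<Longrightarrow> X 0 = 0"
  using weyl_set_linear[of X 0 0] by simp

text \<open>Monomials are eigenvectors of \<open>theta i\<close>, the eigenvalue being the exponent.
  All \<open>theta i\<close> and \<open>euler\<close> are thus diagonal in one basis, and their
  commutation relations below reduce to comparing coefficients.\<close>

lemma lookup_theta:
  "Poly_Mapping.lookup (theta i p) m = of_nat (Poly_Mapping.lookup m i) * Poly_Mapping.lookup p m"
proof (cases "Poly_Mapping.lookup m i = 0")
  case False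
  then have "m - Poly_Mapping.single i 1 + Poly_Mapping.single i 1 = m"
    by (intro poly_mapping_eqI) (auto simp: lookup_add lookup_minus lookup_single when_def)
  with False show ?thesis
    by (simp add: theta_def lookup_mult_var lookup_partial_deriv lookup_minus)
qed (simp add: theta_def lookup_mult_var)

lemma lookup_euler:
  "Poly_Mapping.lookup (euler p) m =
     (\<Sum>i\<in>UNIV. of_nat (Poly_Mapping.lookup m i)) * Poly_Mapping.lookup p m"
  by (simp add: euler_def lookup_sum lookup_theta sum_distrib_right)

section \<open>Homogeneous operators\<close>

text \<open>The commutator relation [A, X] = d X. For \<open>A = euler\<close> the number
  \<open>d\<close> is the degree of \<open>X\<close>, for \<open>A = theta i\<close> its degree in
  the variable \<open>i\<close>; it is complex because it gets added to eigenvalues.\<close>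

definition homog :: "'n oper \<Rightarrow> complex \<Rightarrow> 'n oper \<Rightarrow> bool" where
  "homog A d X \<longleftrightarrow> (\<forall>p. A (X p) = X (A p) + scal d (X p))"

lemma homogD: "homog A d X \<Longrightarrow> A (X p) = X (A p) + scal d (X p)"
  by (simp add: homog_def)

lemma homog_0_iff: "homog A 0 X \<longleftrightarrow> X \<circ> A = A \<circ> X"
  by (auto simp: homog_def fun_eq_iff)

text \<open>The commutator with \<open>A\<close> is a derivation, so degrees add. Linearity of
  \<open>X\<close> lets the scalar \<open>e\<close> pass through it.\<close>

lemma homog_comp:
  assumes "homog A d X" "homog A e Y" "X \<in> weyl_set"
  shows "homog A (d + e) (X \<circ> Y)"
  using assms
  by (simp add: homog_def weyl_set_additive weyl_set_linear scal_plus add.assoc add.left_commute add.commute)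

lemma homog_scal: "A \<in> weyl_set \<Longrightarrow> homog A 0 (scal c)"
  by (simp add: homog_def weyl_set_linear)

lemma homog_theta_mult_var: "homog (theta i) (if i = j then 1 else 0) (mult_var j)"
  unfolding homog_def
  by (auto intro!: poly_mapping_eqI simp: lookup_add lookup_theta lookup_scal lookup_mult_var lookup_minus
      lookup_single when_def algebra_simps of_nat_diff Suc_le_eq)

lemma homog_theta_partial_deriv: "homog (theta i) (if i = j then - 1 else 0) (partial_deriv j)"
  unfolding homog_def
  by (auto intro!: poly_mapping_eqI simp: lookup_add lookup_theta lookup_scal lookup_partial_deriv
      lookup_single when_def algebra_simps)

lemma homog_sum:
  assumes "finite I" "\<And>i. i \<in> I \<Longrightarrow> homog (A i) (d i) X" "X \<in> weyl_set"
  shows "homog (\<lambda>p. \<Sum>i\<in>I. A i p) (\<Sum>i\<in>I. d i) X"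
  using assms
proof (induction I rule: finite_induct)
  case empty
  then show ?case by (simp add: homog_def weyl_set_0)
next
  case (insert i I)
  from insert(4)[of i] insert(3)[OF insert(4,5)] show ?case
    using insert.hyps insert.prems(2)
    by (simp add: homog_def weyl_set_additive scal_plus algebra_simps)
qed

lemma homog_euler_mult_var: "homog euler 1 (mult_var j)"
  using homog_sum[where I = UNIV and A = theta, OF finite homog_theta_mult_var weyl_set.var[of j]]
  by (simp add: euler_def[abs_def])

lemma homog_euler_partial_deriv: "homog euler (- 1) (partial_deriv j)"
  using homog_sum[where I = UNIV and A = theta, OF finite homog_theta_partial_deriv weyl_set.deriv[of j]]
  by (simp add: euler_def[abs_def])

lemma theta_commute: "homog (theta i) 0 (theta j)"
  by (auto simp: homog_def lookup_theta intro!: poly_mapping_eqI)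

lemma euler_theta_commute: "homog euler 0 (theta i)"
  by (auto simp: homog_def lookup_theta lookup_euler intro!: poly_mapping_eqI)

lemma euler_euler_commute: "homog euler 0 euler"
  by (auto simp: homog_def)

lemma partial_deriv_mult_var: "partial_deriv i (mult_var i p) = theta i p + p"
  by (intro poly_mapping_eqI)
     (simp add: lookup_partial_deriv lookup_mult_var lookup_theta lookup_add algebra_simps)

section \<open>Polynomials in an operator\<close>

text \<open>The operator q(A), by Horner's scheme. Through it the polynomial ring in one variable
  acts on modules, bringing along divisibility and Bezout identities.\<close>

definition opoly :: "'n oper \<Rightarrow> complex poly \<Rightarrow> 'n oper" where
  "opoly A q = fold_coeffs (\<lambda>c X p. scal c p + A (X p)) q (\<lambda>p. 0)"

context
  fixes A :: "'n oper"
  assumes A: "A \<in> weyl_set"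
begin

lemma opoly_0: "opoly A 0 p = 0"
  by (simp add: opoly_def)

lemma opoly_pCons: "opoly A (pCons c q) p = scal c p + A (opoly A q p)"
proof (cases "c = 0 \<and> q = 0")
  \<comment> \<open>\<open>pCons 0 0\<close> is the zero polynomial, on which
    \<open>fold_coeffs\<close> does not unfold; the recursion survives because
    \<open>A 0 = 0\<close>.\<close>
  case True
  then show ?thesis by (simp add: opoly_0 weyl_set_0[OF A])
next
  case False
  then show ?thesis by (auto simp: opoly_def)
qed

lemma opoly_in_weyl: "opoly A q \<in> weyl_set"
proof (induction q)
  case 0
  have "opoly A 0 = (\<lambda>p. 0)" by (simp add: fun_eq_iff opoly_0)
  then show ?case by (simp add: zero_in_weyl)
next
  case (pCons c q)
  have "opoly A (pCons c q) = (\<lambda>p. scal c p + (A \<circ> opoly A q) p)"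
    by (simp add: fun_eq_iff opoly_pCons)
  then show ?case using weyl_set.add[OF weyl_set.scal weyl_set.comp[OF A pCons(2)]] by simp
qed

lemma opoly_1 [simp]: "opoly A 1 = id"
  by (simp add: fun_eq_iff one_pCons opoly_pCons opoly_0 weyl_set_0[OF A])

lemma opoly_add: "opoly A (q + r) p = opoly A q p + opoly A r p"
proof (induction q r rule: poly_induct2)
  case 0
  then show ?case by (simp add: opoly_0)
next
  case (pCons a p b q)
  then show ?case
    by (simp add: opoly_pCons scal_plus weyl_set_additive[OF A] algebra_simps)
qed

lemma opoly_smult: "opoly A (smult c q) p = scal c (opoly A q p)"
  by (induction q)
     (simp_all add: opoly_pCons opoly_0 scal_scal scal_add weyl_set_linear[OF A])

lemma opoly_mult: "opoly A (q * r) p = opoly A q (opoly A r p)"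
  by (induction q)
     (simp_all add: opoly_0 opoly_pCons opoly_add opoly_smult weyl_set_0[OF A])

lemma opoly_shift: "opoly A [:-c, 1:] = (\<lambda>p. A p - scal c p)"
  by (simp add: fun_eq_iff opoly_pCons opoly_0 weyl_set_0[OF A] scal_minus)

lemma opoly_power: "opoly A (q ^ k) = opoly A q ^^ k"
  by (induction k) (simp_all add: fun_eq_iff opoly_mult)

text \<open>From X A = (A - d) X, Horner's recursion gives X q(A) = q(A - d) X. This is why
  homogeneous operators translate the roots of annihilating polynomials by \<open>d\<close>.\<close>

lemma homog_opoly:
  assumes X: "X \<in> weyl_set" and h: "homog A d X"
  shows "X (opoly A q p) = opoly A (pcompose q [:-d, 1:]) (X p)"
proof (induction q)
  case 0
  then show ?case by (simp add: opoly_0 weyl_set_0[OF X])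
next
  case (pCons c q)
  have *: "X (A y) = opoly A [:-d, 1:] (X y)" for y
    by (simp add: opoly_shift homogD[OF h])
  show ?case
    by (simp add: pcompose_pCons opoly_pCons weyl_set_additive[OF X] weyl_set_linear[OF X] * pCons
        opoly_add opoly_mult opoly_0 weyl_set_0[OF A] flip: opoly_mult del: mult_pCons_left mult_pCons_right)
qed

end

section \<open>Fully faithful and essentially surjective functors\<close>

lemma is_functor_comp:
  assumes "is_functor C D F0 F1" "is_functor D E G0 G1"
  shows "is_functor C E (\<lambda>X. G0 (F0 X)) (\<lambda>X Y f. G1 (F0 X) (F0 Y) (F1 X Y f))"
  using assms unfolding is_functor_def by simp

lemma is_functor_id: "is_category C \<Longrightarrow> is_functor C C (\<lambda>X. X) (\<lambda>X Y f. f)"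
  by (simp add: is_functor_def)

text \<open>As \<open>F1\<close> is injective on Hom-sets, every equation in \<open>C\<close> can be
  checked after applying it. The inverse functor picks for each \<open>N\<close> an object
  \<open>G0 N\<close> with an isomorphism \<open>e N\<close> from its image to \<open>N\<close>, and
  lifts conjugates of morphisms.\<close>

lemma equivalent_categoriesI:
  assumes F: "is_functor C D F0 F1"
    and ff: "\<And>X Y. X \<in> Obj C \<Longrightarrow> Y \<in> Obj C \<Longrightarrow>
      bij_betw (F1 X Y) (Hom C X Y) (Hom D (F0 X) (F0 Y))"
    and es: "\<And>N. N \<in> Obj D \<Longrightarrow> \<exists>M\<in>Obj C. \<exists>f. is_iso D (F0 M) N f"
  shows "equivalent_categories C D"
proof -
  have C: "is_category C" and D: "is_category D"
    using F by (auto simp: is_functor_def)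
  have C_id: "Ident C X \<in> Hom C X X" if "X \<in> Obj C" for X
    using C that unfolding is_category_def by blast
  have C_comp: "Comp C X Y Z g f \<in> Hom C X Z"
    if "f \<in> Hom C X Y" "g \<in> Hom C Y Z" "X \<in> Obj C" "Y \<in> Obj C" "Z \<in> Obj C" for X Y Z f g
    using C that unfolding is_category_def by blast
  have D_id: "Ident D X \<in> Hom D X X" if "X \<in> Obj D" for X
    using D that unfolding is_category_def by blast
  have D_comp: "Comp D X Y Z g f \<in> Hom D X Z"
    if "f \<in> Hom D X Y" "g \<in> Hom D Y Z" "X \<in> Obj D" "Y \<in> Obj D" "Z \<in> Obj D" for X Y Z f g
    using D that unfolding is_category_def by blast
  have D_idr: "Comp D X X Y f (Ident D X) = f"
    if "f \<in> Hom D X Y" "X \<in> Obj D" "Y \<in> Obj D" for X Y f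
    using D that unfolding is_category_def by blast
  have D_idl: "Comp D X Y Y (Ident D Y) f = f"
    if "f \<in> Hom D X Y" "X \<in> Obj D" "Y \<in> Obj D" for X Y f
    using D that unfolding is_category_def by blast
  have D_assoc: "Comp D W X Z (Comp D X Y Z h g) f = Comp D W Y Z h (Comp D W X Y g f)"
    if "f \<in> Hom D W X" "g \<in> Hom D X Y" "h \<in> Hom D Y Z"
      "W \<in> Obj D" "X \<in> Obj D" "Y \<in> Obj D" "Z \<in> Obj D" for W X Y Z f g h
    using D that unfolding is_category_def by blast
  have F0: "F0 X \<in> Obj D" if "X \<in> Obj C" for X
    using F that unfolding is_functor_def by blast
  have F1: "F1 X Y f \<in> Hom D (F0 X) (F0 Y)" if "f \<in> Hom C X Y" "X \<in> Obj C" "Y \<in> Obj C" for X Y f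
    using F that unfolding is_functor_def by blast
  have F_id: "F1 X X (Ident C X) = Ident D (F0 X)" if "X \<in> Obj C" for X
    using F that unfolding is_functor_def by blast
  have F_comp: "F1 X Z (Comp C X Y Z g f) = Comp D (F0 X) (F0 Y) (F0 Z) (F1 Y Z g) (F1 X Y f)"
    if "f \<in> Hom C X Y" "g \<in> Hom C Y Z" "X \<in> Obj C" "Y \<in> Obj C" "Z \<in> Obj C" for X Y Z f g
    using F that unfolding is_functor_def by blast
  have F_inj: "f = g"
    if "F1 X Y f = F1 X Y g" "f \<in> Hom C X Y" "g \<in> Hom C X Y" "X \<in> Obj C" "Y \<in> Obj C" for X Y f g
    using ff[of X Y] that by (auto simp: bij_betw_def dest: inj_onD)
  \<comment> \<open>\<open>L\<close> lifts a morphism through the bijection of Hom-sets; it yields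
    both the inverse functor on morphisms and the unit isomorphisms.\<close>
  define L where "L X Y = the_inv_into (Hom C X Y) (F1 X Y)" for X Y
  have L: "L X Y h \<in> Hom C X Y" and FL: "F1 X Y (L X Y h) = h"
    if "h \<in> Hom D (F0 X) (F0 Y)" "X \<in> Obj C" "Y \<in> Obj C" for X Y h
    using ff[of X Y] that unfolding L_def
    by (auto simp: bij_betw_def f_the_inv_into_f intro: the_inv_into_into)

  have "\<forall>N\<in>Obj D. \<exists>M e e'. M \<in> Obj C \<and> e \<in> Hom D (F0 M) N \<and> e' \<in> Hom D N (F0 M) \<and>
      Comp D (F0 M) N (F0 M) e' e = Ident D (F0 M) \<and> Comp D N (F0 M) N e e' = Ident D N"
    using es unfolding is_iso_def by metis
  then obtain G0 e e' where G: "\<forall>N\<in>Obj D. G0 N \<in> Obj C \<and> e N \<in> Hom D (F0 (G0 N)) N \<and>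
      e' N \<in> Hom D N (F0 (G0 N)) \<and>
      Comp D (F0 (G0 N)) N (F0 (G0 N)) (e' N) (e N) = Ident D (F0 (G0 N)) \<and>
      Comp D N (F0 (G0 N)) N (e N) (e' N) = Ident D N"
    by metis
  then have G0: "\<And>N. N \<in> Obj D \<Longrightarrow> G0 N \<in> Obj C"
    and e: "\<And>N. N \<in> Obj D \<Longrightarrow> e N \<in> Hom D (F0 (G0 N)) N"
    and e': "\<And>N. N \<in> Obj D \<Longrightarrow> e' N \<in> Hom D N (F0 (G0 N))"
    and e'e: "\<And>N. N \<in> Obj D \<Longrightarrow> Comp D (F0 (G0 N)) N (F0 (G0 N)) (e' N) (e N) = Ident D (F0 (G0 N))"
    and ee': "\<And>N. N \<in> Obj D \<Longrightarrow> Comp D N (F0 (G0 N)) N (e N) (e' N) = Ident D N"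
    by blast+
  note obj = F0 G0
  \<comment> \<open>\<open>h\<close> conjugated by the chosen isomorphisms, \<open>e' N'\<close>
    being inverse to \<open>e N'\<close>. The fact \<open>eK\<close> is then the naturality square
    of \<open>e\<close>.\<close>
  define K where "K N N' h = Comp D (F0 (G0 N)) N' (F0 (G0 N')) (e' N') (Comp D (F0 (G0 N)) N N' h (e N))"
    for N N' h
  have K: "K N N' h \<in> Hom D (F0 (G0 N)) (F0 (G0 N'))"
    if "h \<in> Hom D N N'" "N \<in> Obj D" "N' \<in> Obj D" for N N' h
    unfolding K_def using that by (intro D_comp e e' obj)
  have e_cancel: "Comp D A (F0 (G0 N)) N (e N) (Comp D A N (F0 (G0 N)) (e' N) h) = h"
    if "h \<in> Hom D A N" "A \<in> Obj D" "N \<in> Obj D" for A N h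
    using that by (subst D_assoc[symmetric]) (simp_all add: ee' D_idl e e' obj)
  have eK: "Comp D (F0 (G0 N)) (F0 (G0 N')) N' (e N') (K N N' h) = Comp D (F0 (G0 N)) N N' h (e N)"
    if "h \<in> Hom D N N'" "N \<in> Obj D" "N' \<in> Obj D" for N N' h
    unfolding K_def using that by (intro e_cancel D_comp e obj)
  define G1 where "G1 N N' h = L (G0 N) (G0 N') (K N N' h)" for N N' h
  have G1: "G1 N N' h \<in> Hom C (G0 N) (G0 N')" and FG1: "F1 (G0 N) (G0 N') (G1 N N' h) = K N N' h"
    if "h \<in> Hom D N N'" "N \<in> Obj D" "N' \<in> Obj D" for N N' h
    unfolding G1_def using L FL K obj that by blast+
  have "is_functor D C G0 G1"
    unfolding is_functor_def
  proof (intro conjI ballI)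
    fix N assume N: "N \<in> Obj D"
    show "G1 N N (Ident D N) = Ident C (G0 N)"
    proof (rule F_inj)
      show "F1 (G0 N) (G0 N) (G1 N N (Ident D N)) = F1 (G0 N) (G0 N) (Ident C (G0 N))"
        using N by (simp add: FG1 D_id F_id obj K_def D_idl e e'e)
    qed (use N in \<open>simp_all add: G1 D_id C_id obj\<close>)
  next
    fix N1 N2 N3 f g
    assume N: "N1 \<in> Obj D" "N2 \<in> Obj D" "N3 \<in> Obj D" and f: "f \<in> Hom D N1 N2" and g: "g \<in> Hom D N2 N3"
    show "G1 N1 N3 (Comp D N1 N2 N3 g f) = Comp C (G0 N1) (G0 N2) (G0 N3) (G1 N2 N3 g) (G1 N1 N2 f)"
    proof (rule F_inj)
      have "Comp D (F0 (G0 N1)) (F0 (G0 N2)) (F0 (G0 N3)) (K N2 N3 g) (K N1 N2 f) =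
        Comp D (F0 (G0 N1)) N3 (F0 (G0 N3)) (e' N3)
          (Comp D (F0 (G0 N1)) (F0 (G0 N2)) N3 (Comp D (F0 (G0 N2)) N2 N3 g (e N2)) (K N1 N2 f))"
        unfolding K_def[of N2 N3]
        using N f g by (intro D_assoc K D_comp e e' obj)
      also have "Comp D (F0 (G0 N1)) (F0 (G0 N2)) N3 (Comp D (F0 (G0 N2)) N2 N3 g (e N2)) (K N1 N2 f) =
          Comp D (F0 (G0 N1)) N2 N3 g (Comp D (F0 (G0 N1)) (F0 (G0 N2)) N2 (e N2) (K N1 N2 f))"
        using N f g by (intro D_assoc K D_comp e e' obj)
      also have "\<dots> = Comp D (F0 (G0 N1)) N1 N3 (Comp D N1 N2 N3 g f) (e N1)"
        using N f g by (simp add: eK D_assoc e obj)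
      finally show "F1 (G0 N1) (G0 N3) (G1 N1 N3 (Comp D N1 N2 N3 g f)) =
        F1 (G0 N1) (G0 N3) (Comp C (G0 N1) (G0 N2) (G0 N3) (G1 N2 N3 g) (G1 N1 N2 f))"
        using N f g by (simp add: F_comp G1 obj FG1 D_comp[of f N1 N2 g N3] K_def[of N1 N3])
    qed (use N f g D_comp[of f N1 N2 g N3] in \<open>auto intro!: C_comp G1 obj\<close>)
  qed (use C D G0 G1 in auto)
  note G_functor = this

  have "naturally_isomorphic D D
     (\<lambda>X. F0 (G0 X)) (\<lambda>X Y f. F1 (G0 X) (G0 Y) (G1 X Y f)) (\<lambda>X. X) (\<lambda>X Y f. f)"
    unfolding naturally_isomorphic_def
  proof (intro conjI exI[of _ e] ballI)
    show "is_iso D (F0 (G0 N)) N (e N)" if "N \<in> Obj D" for N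
      using that e e' ee' e'e unfolding is_iso_def by blast
  qed (simp_all add: is_functor_comp[OF G_functor F] is_functor_id D FG1 eK)
  moreover have "naturally_isomorphic C C
     (\<lambda>X. G0 (F0 X)) (\<lambda>X Y f. G1 (F0 X) (F0 Y) (F1 X Y f)) (\<lambda>X. X) (\<lambda>X Y f. f)"
    unfolding naturally_isomorphic_def
  \<comment> \<open>The component at \<open>X\<close> is the lift of \<open>e (F0 X)\<close>, and
    its inverse is the lift of \<open>e' (F0 X)\<close>.\<close>
  proof (intro conjI exI[of _ "\<lambda>X. L (G0 (F0 X)) X (e (F0 X))"] ballI)
    fix X assume X: "X \<in> Obj C"
    define u where "u = L (G0 (F0 X)) X (e (F0 X))"
    define v where "v = L X (G0 (F0 X)) (e' (F0 X))"
    have u: "u \<in> Hom C (G0 (F0 X)) X" "F1 (G0 (F0 X)) X u = e (F0 X)"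
      and v: "v \<in> Hom C X (G0 (F0 X))" "F1 X (G0 (F0 X)) v = e' (F0 X)"
      using X by (auto simp: u_def v_def L FL e e' obj)
    have "Comp C (G0 (F0 X)) X (G0 (F0 X)) v u = Ident C (G0 (F0 X))"
      by (rule F_inj[where X = "G0 (F0 X)" and Y = "G0 (F0 X)"])
         (use X u v in \<open>simp_all add: F_comp obj e'e F_id C_comp C_id\<close>)
    moreover have "Comp C X (G0 (F0 X)) X u v = Ident C X"
      by (rule F_inj[where X = X and Y = X])
         (use X u v in \<open>simp_all add: F_comp obj ee' F_id C_comp C_id\<close>)
    ultimately show "is_iso C (G0 (F0 X)) X u"
      using u v by (auto simp: is_iso_def)
  next
    fix X Y f assume X: "X \<in> Obj C" and Y: "Y \<in> Obj C" and f: "f \<in> Hom C X Y"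
    have Ff: "F1 X Y f \<in> Hom D (F0 X) (F0 Y)" using X Y f by (intro F1)
    show "Comp C (G0 (F0 X)) (G0 (F0 Y)) Y (L (G0 (F0 Y)) Y (e (F0 Y))) (G1 (F0 X) (F0 Y) (F1 X Y f)) =
          Comp C (G0 (F0 X)) X Y f (L (G0 (F0 X)) X (e (F0 X)))"
      by (rule F_inj[where X = "G0 (F0 X)" and Y = Y])
         (use X Y f Ff in \<open>simp_all add: F_comp obj e FL L G1 FG1 C_comp eK\<close>)
  qed (simp_all add: is_functor_comp[OF F G_functor] is_functor_id C)
  ultimately show ?thesis
    using F G_functor unfolding equivalent_categories_def by blast
qed

section \<open>Generalized eigenspaces\<close>

text \<open>The gcd divides both polynomials, so it has no root and is constant by the fundamental
  theorem of algebra. A nonzero \<open>p\<close> keeps the gcd nonzero, even for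
  \<open>q = 0\<close>.\<close>

lemma complex_poly_bezout:
  fixes p q :: "complex poly"
  assumes "p \<noteq> 0" and no_root: "\<And>z. poly p z = 0 \<Longrightarrow> poly q z \<noteq> 0"
  obtains r s where "r * p + s * q = 1"
proof -
  define g where "g = gcd p q"
  have "g \<noteq> 0" using assms(1) by (simp add: g_def)
  have "poly g z \<noteq> 0" for z
  proof
    assume "poly g z = 0"
    moreover have "g dvd p" "g dvd q" by (simp_all add: g_def)
    ultimately show False using no_root[of z] by (auto elim!: dvdE)
  qed
  then have "constant (poly g)"
    using fundamental_theorem_of_algebra by blast
  then obtain c where c: "g = [:c:]"
    using constant_degree degree_eq_zeroE by metis
  with \<open>g \<noteq> 0\<close> have "c \<noteq> 0" by auto
  define x y where "x = fst (bezout_coefficients p q)" and "y = snd (bezout_coefficients p q)"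
  have "x * p + y * q = [:c:]"
    using bezout_coefficients_fst_snd[of p q] c by (simp add: x_def y_def g_def)
  then have "smult (1 / c) x * p + smult (1 / c) y * q = smult (1 / c) [:c:]"
    by (simp flip: smult_add_right)
  then show ?thesis
    using \<open>c \<noteq> 0\<close> that[of "smult (1 / c) x" "smult (1 / c) y"] by (simp add: one_pCons)
qed

text \<open>Linear factors with root in \<open>T\<close> are peeled off one at a time, by induction
  on the degree.\<close>

lemma poly_split_roots:
  fixes p :: "complex poly"
  assumes "p \<noteq> 0"
  obtains q r where "p = q * r" "\<And>z. poly q z = 0 \<Longrightarrow> z \<in> T" "\<And>z. poly r z = 0 \<Longrightarrow> z \<notin> T"
proof -
  have "\<exists>q r. p = q * r \<and> (\<forall>z. poly q z = 0 \<longrightarrow> z \<in> T) \<and> (\<forall>z. poly r z = 0 \<longrightarrow> z \<notin> T)"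
    using assms
  proof (induction "degree p" arbitrary: p)
    case 0
    then have "poly p z \<noteq> 0" for z by (metis degree_eq_zeroE pCons_0_0 poly_pCons mult_zero_right add.right_neutral poly_0)
    then show ?case by (intro exI[of _ p] exI[of _ 1]) auto
  next
    case (Suc n)
    show ?case
    proof (cases "\<exists>z\<in>T. poly p z = 0")
      case True
      then obtain c p' where c: "c \<in> T" and p: "p = [:-c, 1:] * p'"
        by (auto simp: poly_eq_0_iff_dvd)
      with Suc(3) have "p' \<noteq> 0" by auto
      then have "degree p = Suc (degree p')"
        unfolding p by (subst degree_mult_eq) auto
      with Suc(1)[of p'] Suc(2) \<open>p' \<noteq> 0\<close> obtain q r where
        "p' = q * r" "\<forall>z. poly q z = 0 \<longrightarrow> z \<in> T" "\<forall>z. poly r z = 0 \<longrightarrow> z \<notin> T"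
        by auto
      then show ?thesis
        using c by (intro exI[of _ "[:-c, 1:] * q"] exI[of _ r]) (auto simp: p algebra_simps)
    next
      case False
      then show ?thesis by (intro exI[of _ 1] exI[of _ p]) auto
    qed
  qed
  then show ?thesis using that by blast
qed

text \<open>Working with root sets of annihilating polynomials instead of single eigenvalues describes the
  objects of both categories without direct sums.\<close>

definition gen_eig :: "('n oper, 'u) module \<Rightarrow> 'n oper \<Rightarrow> complex set \<Rightarrow> 'u set" where
  "gen_eig M A S = {m \<in> carrier M. \<exists>p. p \<noteq> 0 \<and> (\<forall>z. poly p z = 0 \<longrightarrow> z \<in> S) \<and>
     opoly A p \<odot>\<^bsub>M\<^esub> m = \<zero>\<^bsub>M\<^esub>}"

text \<open>Only sums are formed: the generating sets that describe modules below are already closed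
  under scalars. Adding one generator at a time gives a simple induction and a simple cardinality
  bound.\<close>

inductive_set addspan :: "('a, 'u) module \<Rightarrow> 'u set \<Rightarrow> 'u set" for M B where
  zero: "\<zero>\<^bsub>M\<^esub> \<in> addspan M B"
| add: "b \<in> B \<Longrightarrow> s \<in> addspan M B \<Longrightarrow> b \<oplus>\<^bsub>M\<^esub> s \<in> addspan M B"

lemma weylE_carrier: "carrier weylE = {X \<in> weyl_set. homog euler 0 X}"
  by (simp add: weylE_def weyl_def homog_0_iff)

lemma weyl_carrier: "carrier weyl = weyl_set"
  by (simp add: weyl_def)

text \<open>One locale serves both rings: scalars, all \<open>theta i\<close> and
  \<open>euler\<close> lie in both, and eigenvalue arguments mostly use polynomials in
  these.\<close>

locale oper_module = left_module U M
  for U :: "'n::finite oper ring" and M :: "('n oper, 'u) module" +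
  assumes U_cases: "U = weyl \<or> U = weylE"
begin

lemma U_simps: "X \<otimes>\<^bsub>U\<^esub> Y = X \<circ> Y" "\<one>\<^bsub>U\<^esub> = id" "\<zero>\<^bsub>U\<^esub> = (\<lambda>p. 0)" "X \<oplus>\<^bsub>U\<^esub> Y = (\<lambda>p. X p + Y p)"
  using U_cases by (auto simp: weyl_def weylE_def)

lemma U_weyl: "X \<in> carrier U \<Longrightarrow> X \<in> weyl_set"
  using U_cases by (auto simp: weyl_carrier weylE_carrier)

lemma U_comp: "X \<in> carrier U \<Longrightarrow> Y \<in> carrier U \<Longrightarrow> X \<circ> Y \<in> carrier U"
  using R.m_closed[of X Y] by (simp add: U_simps)

lemma U_add: "X \<in> carrier U \<Longrightarrow> Y \<in> carrier U \<Longrightarrow> (\<lambda>p. X p + Y p) \<in> carrier U"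
  using R.a_closed[of X Y] by (simp add: U_simps)

lemma U_zero: "(\<lambda>p. 0) \<in> carrier U"
  using R.zero_closed by (simp add: U_simps)

lemma U_id: "id \<in> carrier U"
  using R.one_closed by (simp add: U_simps)

lemma U_scal: "scal c \<in> carrier U"
  using U_cases homog_scal[OF euler_in_weyl] by (auto simp: weyl_carrier weylE_carrier weyl_set.scal)

lemma U_theta: "theta i \<in> carrier U"
  using U_cases by (auto simp: weyl_carrier weylE_carrier theta_in_weyl euler_theta_commute)

lemma U_euler: "euler \<in> carrier U"
  using U_cases by (auto simp: weyl_carrier weylE_carrier euler_in_weyl euler_euler_commute)

lemma U_opoly:
  assumes A: "A \<in> carrier U"
  shows "opoly A q \<in> carrier U"
proof (induction q)
  case 0
  have "opoly A 0 = (\<lambda>p. 0)" by (simp add: fun_eq_iff opoly_0[OF U_weyl[OF A]])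
  then show ?case by (simp add: U_zero)
next
  case (pCons c q)
  have "opoly A (pCons c q) = (\<lambda>p. scal c p + (A \<circ> opoly A q) p)"
    by (simp add: fun_eq_iff opoly_pCons[OF U_weyl[OF A]])
  then show ?case
    using U_add[OF U_scal U_comp[OF A pCons(2)]] by simp
qed

lemma act_closed [simp]: "X \<in> carrier U \<Longrightarrow> m \<in> carrier M \<Longrightarrow> X \<odot>\<^bsub>M\<^esub> m \<in> carrier M"
  by (rule smult_closed)

lemma act_comp:
  "X \<in> carrier U \<Longrightarrow> Y \<in> carrier U \<Longrightarrow> m \<in> carrier M \<Longrightarrow> (X \<circ> Y) \<odot>\<^bsub>M\<^esub> m = X \<odot>\<^bsub>M\<^esub> (Y \<odot>\<^bsub>M\<^esub> m)"
  using smult_assoc[of X Y m] by (simp add: U_simps)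

lemma act_id: "m \<in> carrier M \<Longrightarrow> id \<odot>\<^bsub>M\<^esub> m = m"
  using smult_one[of m] by (simp add: U_simps)

lemma act_add:
  "X \<in> carrier U \<Longrightarrow> Y \<in> carrier U \<Longrightarrow> m \<in> carrier M \<Longrightarrow>
    (\<lambda>p. X p + Y p) \<odot>\<^bsub>M\<^esub> m = X \<odot>\<^bsub>M\<^esub> m \<oplus>\<^bsub>M\<^esub> Y \<odot>\<^bsub>M\<^esub> m"
  using smult_l_distr[of X Y m] by (simp add: U_simps)

lemma act_0 [simp]: "X \<in> carrier U \<Longrightarrow> X \<odot>\<^bsub>M\<^esub> \<zero>\<^bsub>M\<^esub> = \<zero>\<^bsub>M\<^esub>"
  using smult_r_distr[of X "\<zero>\<^bsub>M\<^esub>" "\<zero>\<^bsub>M\<^esub>"] by simp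

lemma zero_act: "m \<in> carrier M \<Longrightarrow> (\<lambda>p. 0) \<odot>\<^bsub>M\<^esub> m = \<zero>\<^bsub>M\<^esub>"
  using act_add[OF U_zero U_zero, of m] U_zero by simp

text \<open>Negatives are written with \<open>scal (- 1)\<close>, so that sets closed under the
  action are automatically closed under negation.\<close>

lemma act_neg: "m \<in> carrier M \<Longrightarrow> m \<oplus>\<^bsub>M\<^esub> scal (- 1) \<odot>\<^bsub>M\<^esub> m = \<zero>\<^bsub>M\<^esub>"
  using act_add[OF U_id U_scal, of m "-1"] by (simp add: act_id scal_minus zero_act)

lemma eq_of_add_neg:
  assumes "x \<in> carrier M" "y \<in> carrier M" "x \<oplus>\<^bsub>M\<^esub> scal (- 1) \<odot>\<^bsub>M\<^esub> y = \<zero>\<^bsub>M\<^esub>"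
  shows "x = y"
proof -
  have "scal (- 1) \<odot>\<^bsub>M\<^esub> y \<in> carrier M" using assms U_scal by simp
  then show ?thesis
    using act_neg[OF assms(2)] assms M.minus_equality by metis
qed

lemma act_finsum:
  assumes X: "X \<in> carrier U" and "finite A" "f \<in> A \<rightarrow> carrier M"
  shows "X \<odot>\<^bsub>M\<^esub> finsum M f A = finsum M (\<lambda>l. X \<odot>\<^bsub>M\<^esub> f l) A"
  using assms(2,3)
proof (induction A rule: finite_induct)
  case empty
  then show ?case using X by simp
next
  case (insert a A)
  then have "f a \<in> carrier M" "f \<in> A \<rightarrow> carrier M" by auto
  moreover from this have "(\<lambda>l. X \<odot>\<^bsub>M\<^esub> f l) \<in> A \<rightarrow> carrier M"
    using act_closed[OF X] by (simp add: Pi_iff)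
  ultimately show ?case
    using insert.hyps insert.IH X by (simp add: smult_r_distr M.finsum_closed)
qed

lemma act_opoly_mult:
  "A \<in> carrier U \<Longrightarrow> m \<in> carrier M \<Longrightarrow> opoly A (p * q) \<odot>\<^bsub>M\<^esub> m = opoly A p \<odot>\<^bsub>M\<^esub> (opoly A q \<odot>\<^bsub>M\<^esub> m)"
  using act_comp[OF U_opoly U_opoly, of A A m p q]
  by (simp add: comp_def opoly_mult[OF U_weyl, symmetric] eta_contract_eq)

lemma act_opoly_add:
  "A \<in> carrier U \<Longrightarrow> m \<in> carrier M \<Longrightarrow>
    opoly A (p + q) \<odot>\<^bsub>M\<^esub> m = opoly A p \<odot>\<^bsub>M\<^esub> m \<oplus>\<^bsub>M\<^esub> opoly A q \<odot>\<^bsub>M\<^esub> m"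
  using act_add[OF U_opoly U_opoly, of A A m p q]
  by (simp add: opoly_add[OF U_weyl, symmetric] eta_contract_eq)

lemma act_opoly_1: "A \<in> carrier U \<Longrightarrow> m \<in> carrier M \<Longrightarrow> opoly A 1 \<odot>\<^bsub>M\<^esub> m = m"
  by (simp add: opoly_1[OF U_weyl] act_id)

lemma gen_eigI:
  "m \<in> carrier M \<Longrightarrow> p \<noteq> 0 \<Longrightarrow> (\<And>z. poly p z = 0 \<Longrightarrow> z \<in> S) \<Longrightarrow> opoly A p \<odot>\<^bsub>M\<^esub> m = \<zero>\<^bsub>M\<^esub> \<Longrightarrow>
    m \<in> gen_eig M A S"
  by (auto simp: gen_eig_def)

lemma gen_eigE:
  assumes "m \<in> gen_eig M A S"
  obtains p where "m \<in> carrier M" "p \<noteq> 0" "\<And>z. poly p z = 0 \<Longrightarrow> z \<in> S"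
    "opoly A p \<odot>\<^bsub>M\<^esub> m = \<zero>\<^bsub>M\<^esub>"
  using assms by (auto simp: gen_eig_def)

lemma gen_eig_carrier: "m \<in> gen_eig M A S \<Longrightarrow> m \<in> carrier M"
  by (simp add: gen_eig_def)

lemma gen_eig_mono: "m \<in> gen_eig M A S \<Longrightarrow> S \<subseteq> T \<Longrightarrow> m \<in> gen_eig M A T"
  by (auto simp: gen_eig_def)

lemma gen_eig_zero: "A \<in> carrier U \<Longrightarrow> \<zero>\<^bsub>M\<^esub> \<in> gen_eig M A S"
  by (rule gen_eigI[of _ 1]) (simp_all add: U_opoly)

lemma gen_eig_add:
  assumes A: "A \<in> carrier U" and x: "x \<in> gen_eig M A S" and y: "y \<in> gen_eig M A S"
  shows "x \<oplus>\<^bsub>M\<^esub> y \<in> gen_eig M A S"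
proof -
  obtain p where p: "x \<in> carrier M" "p \<noteq> 0" "\<And>z. poly p z = 0 \<Longrightarrow> z \<in> S" "opoly A p \<odot>\<^bsub>M\<^esub> x = \<zero>\<^bsub>M\<^esub>"
    using gen_eigE[OF x] by metis
  obtain q where q: "y \<in> carrier M" "q \<noteq> 0" "\<And>z. poly q z = 0 \<Longrightarrow> z \<in> S" "opoly A q \<odot>\<^bsub>M\<^esub> y = \<zero>\<^bsub>M\<^esub>"
    using gen_eigE[OF y] by metis
  have "opoly A (q * p) \<odot>\<^bsub>M\<^esub> x = \<zero>\<^bsub>M\<^esub>" "opoly A (p * q) \<odot>\<^bsub>M\<^esub> y = \<zero>\<^bsub>M\<^esub>"
    using A p q by (simp_all add: act_opoly_mult U_opoly)
  then have "opoly A (p * q) \<odot>\<^bsub>M\<^esub> (x \<oplus>\<^bsub>M\<^esub> y) = \<zero>\<^bsub>M\<^esub>"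
    using p q A by (simp add: smult_r_distr U_opoly mult.commute[of q p])
  then show ?thesis
    using p q by (intro gen_eigI[of _ "p * q"]) auto
qed

text \<open>By \<open>homog_opoly\<close>, if p(x) annihilates \<open>m\<close>, then p(x - d)
  annihilates \<open>X\<close> applied to \<open>m\<close>; its roots are those of p translated by
  \<open>d\<close>.\<close>

lemma gen_eig_act:
  assumes A: "A \<in> carrier U" and X: "X \<in> carrier U" and h: "homog A d X"
    and m: "m \<in> gen_eig M A S"
  shows "X \<odot>\<^bsub>M\<^esub> m \<in> gen_eig M A ((+) d ` S)"
proof -
  obtain p where p: "m \<in> carrier M" "p \<noteq> 0" "\<And>z. poly p z = 0 \<Longrightarrow> z \<in> S" "opoly A p \<odot>\<^bsub>M\<^esub> m = \<zero>\<^bsub>M\<^esub>"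
    using gen_eigE[OF m] by metis
  let ?p = "pcompose p [:-d, 1:]"
  have "opoly A ?p \<circ> X = X \<circ> opoly A p"
    by (simp add: fun_eq_iff homog_opoly[OF U_weyl[OF A] U_weyl[OF X] h])
  then have "opoly A ?p \<odot>\<^bsub>M\<^esub> (X \<odot>\<^bsub>M\<^esub> m) = X \<odot>\<^bsub>M\<^esub> (opoly A p \<odot>\<^bsub>M\<^esub> m)"
    using A X p(1) by (simp add: act_comp[symmetric] U_opoly)
  moreover have "?p \<noteq> 0" using p(2) by (simp add: pcompose_eq_0_iff)
  moreover have "z \<in> (+) d ` S" if "poly ?p z = 0" for z
    using p(3)[of "z - d"] that by (auto simp: poly_pcompose intro!: image_eqI[of z _ "z - d"])
  ultimately show ?thesis
    using p X by (intro gen_eigI[of _ ?p]) simp_all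
qed

lemma gen_eig_act_0:
  "A \<in> carrier U \<Longrightarrow> X \<in> carrier U \<Longrightarrow> homog A 0 X \<Longrightarrow> m \<in> gen_eig M A S \<Longrightarrow>
    X \<odot>\<^bsub>M\<^esub> m \<in> gen_eig M A S"
  using gen_eig_act[of A X 0 m S] by simp

lemma homog_0_opoly: "A \<in> carrier U \<Longrightarrow> X \<in> carrier U \<Longrightarrow> homog X 0 A \<Longrightarrow> homog X 0 (opoly A q)"
  using homog_opoly[of A X 0 q] U_weyl by (auto simp: homog_def pcompose_idR)

text \<open>If p and q kill \<open>m\<close> and have no common root, then 1 = r p + s q kills
  \<open>m\<close> as well.\<close>

lemma gen_eig_disjoint:
  assumes A: "A \<in> carrier U" and "m \<in> gen_eig M A S" "m \<in> gen_eig M A T" "S \<inter> T = {}"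
  shows "m = \<zero>\<^bsub>M\<^esub>"
proof -
  obtain p where p: "m \<in> carrier M" "p \<noteq> 0" "\<And>z. poly p z = 0 \<Longrightarrow> z \<in> S" "opoly A p \<odot>\<^bsub>M\<^esub> m = \<zero>\<^bsub>M\<^esub>"
    using gen_eigE[OF assms(2)] by metis
  obtain q where q: "q \<noteq> 0" "\<And>z. poly q z = 0 \<Longrightarrow> z \<in> T" "opoly A q \<odot>\<^bsub>M\<^esub> m = \<zero>\<^bsub>M\<^esub>"
    using gen_eigE[OF assms(3)] by metis
  obtain r s where "r * p + s * q = 1"
    using complex_poly_bezout[of p q] p q assms(4) by blast
  then have "opoly A (r * p + s * q) \<odot>\<^bsub>M\<^esub> m = m"
    using A p by (simp add: act_opoly_1)
  then show ?thesis
    using A p q by (simp add: act_opoly_add act_opoly_mult U_opoly)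
qed

text \<open>Write p = p1 p2 with roots inside and outside \<open>T\<close>, and 1 = r p1 + s p2.
  Then s p2 m is killed by p1, and r p1 m by p2. Both pieces are polynomials in \<open>A\<close>
  applied to \<open>m\<close>, hence stay in every set stable under such polynomials.\<close>

lemma gen_eig_split:
  assumes A: "A \<in> carrier U" and m: "m \<in> gen_eig M A S"
  obtains r s where "m = opoly A r \<odot>\<^bsub>M\<^esub> m \<oplus>\<^bsub>M\<^esub> opoly A s \<odot>\<^bsub>M\<^esub> m"
    "opoly A r \<odot>\<^bsub>M\<^esub> m \<in> gen_eig M A (S \<inter> T)" "opoly A s \<odot>\<^bsub>M\<^esub> m \<in> gen_eig M A (S - T)"
proof -
  obtain p where p: "m \<in> carrier M" "p \<noteq> 0" "\<And>z. poly p z = 0 \<Longrightarrow> z \<in> S" "opoly A p \<odot>\<^bsub>M\<^esub> m = \<zero>\<^bsub>M\<^esub>"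
    using gen_eigE[OF m] by metis
  obtain p1 p2 where p12: "p = p1 * p2" "\<And>z. poly p1 z = 0 \<Longrightarrow> z \<in> T" "\<And>z. poly p2 z = 0 \<Longrightarrow> z \<notin> T"
    using poly_split_roots[OF p(2), of T] by metis
  obtain r s where rs: "r * p1 + s * p2 = 1"
    using complex_poly_bezout[of p1 p2] p(2) p12 by (metis mult_zero_left)
  have "m = opoly A (s * p2) \<odot>\<^bsub>M\<^esub> m \<oplus>\<^bsub>M\<^esub> opoly A (r * p1) \<odot>\<^bsub>M\<^esub> m"
    using A p rs by (simp add: act_opoly_add[symmetric] act_opoly_1 add.commute)
  moreover have "opoly A (s * p2) \<odot>\<^bsub>M\<^esub> m \<in> gen_eig M A (S \<inter> T)"
  proof (rule gen_eigI[of _ p1])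
    have "opoly A p1 \<odot>\<^bsub>M\<^esub> (opoly A (s * p2) \<odot>\<^bsub>M\<^esub> m) = opoly A (s * p) \<odot>\<^bsub>M\<^esub> m"
      using A p(1) by (simp add: act_opoly_mult[symmetric] p12(1) algebra_simps)
    then show "opoly A p1 \<odot>\<^bsub>M\<^esub> (opoly A (s * p2) \<odot>\<^bsub>M\<^esub> m) = \<zero>\<^bsub>M\<^esub>"
      using A p by (simp add: act_opoly_mult U_opoly)
  qed (use p p12 A U_opoly in auto)
  moreover have "opoly A (r * p1) \<odot>\<^bsub>M\<^esub> m \<in> gen_eig M A (S - T)"
  proof (rule gen_eigI[of _ p2])
    have "opoly A p2 \<odot>\<^bsub>M\<^esub> (opoly A (r * p1) \<odot>\<^bsub>M\<^esub> m) = opoly A (r * p) \<odot>\<^bsub>M\<^esub> m"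
      using A p(1) by (simp add: act_opoly_mult[symmetric] p12(1) algebra_simps)
    then show "opoly A p2 \<odot>\<^bsub>M\<^esub> (opoly A (r * p1) \<odot>\<^bsub>M\<^esub> m) = \<zero>\<^bsub>M\<^esub>"
      using A p by (simp add: act_opoly_mult U_opoly)
  qed (use p p12 A U_opoly in auto)
  ultimately show ?thesis using that by blast
qed

text \<open>Since \<open>z\<close> is not a root of the annihilator p of \<open>m\<close>, the
  polynomial x - z is invertible modulo p; \<open>q\<close> is such an inverse.\<close>

lemma gen_eig_shift_inverse:
  assumes A: "A \<in> carrier U" and m: "m \<in> gen_eig M A S" and z: "z \<notin> S"
  obtains q where "m = opoly A [:-z, 1:] \<odot>\<^bsub>M\<^esub> (opoly A q \<odot>\<^bsub>M\<^esub> m)"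
proof -
  obtain p where p: "m \<in> carrier M" "p \<noteq> 0" "\<And>z. poly p z = 0 \<Longrightarrow> z \<in> S" "opoly A p \<odot>\<^bsub>M\<^esub> m = \<zero>\<^bsub>M\<^esub>"
    using gen_eigE[OF m] by metis
  have "poly [:-z, 1:] w \<noteq> 0" if "poly p w = 0" for w
    using p(3)[OF that] z by auto
  then obtain r s where rs: "r * p + s * [:-z, 1:] = 1"
    using complex_poly_bezout[of p "[:-z, 1:]"] p(2) by metis
  have "m = opoly A (r * p) \<odot>\<^bsub>M\<^esub> m \<oplus>\<^bsub>M\<^esub> opoly A ([:-z, 1:] * s) \<odot>\<^bsub>M\<^esub> m"
    using A p(1) rs by (simp only: act_opoly_add[symmetric] act_opoly_1 mult.commute[of "[:-z, 1:]"])
  then show ?thesis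
    using A p that[of s] by (simp only: act_opoly_mult U_opoly act_0 M.l_zero act_closed)
qed

section \<open>Additive spans and primary decomposition\<close>

lemma addspan_carrier: "B \<subseteq> carrier M \<Longrightarrow> x \<in> addspan M B \<Longrightarrow> x \<in> carrier M"
  by (rotate_tac, induction rule: addspan.induct) auto

lemma addspan_base: "B \<subseteq> carrier M \<Longrightarrow> x \<in> B \<Longrightarrow> x \<in> addspan M B"
  using addspan.add[OF _ addspan.zero, of x B M] by auto

lemma addspan_add:
  assumes B: "B \<subseteq> carrier M" and x: "x \<in> addspan M B" and y: "y \<in> addspan M B"
  shows "x \<oplus>\<^bsub>M\<^esub> y \<in> addspan M B"
  using x
proof (induction rule: addspan.induct)
  case zero
  then show ?case using addspan_carrier[OF B y] y by simp
next
  case (add b s)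
  then have "(b \<oplus>\<^bsub>M\<^esub> s) \<oplus>\<^bsub>M\<^esub> y = b \<oplus>\<^bsub>M\<^esub> (s \<oplus>\<^bsub>M\<^esub> y)"
    using B addspan_carrier[OF B] y by (intro M.a_assoc) auto
  then show ?case using add by (simp add: addspan.add)
qed

lemma addspan_trans:
  assumes "B' \<subseteq> carrier M" "B \<subseteq> addspan M B'" "x \<in> addspan M B"
  shows "x \<in> addspan M B'"
  using assms(3)
  by (induction rule: addspan.induct) (use assms in \<open>auto intro: addspan.zero addspan_add\<close>)

text \<open>One annihilating polynomial has finitely many roots, which are split off one by one. The
  set \<open>H\<close> carries further conditions along: the components stay in \<open>H\<close>
  because they are polynomials in \<open>A\<close> applied to \<open>m\<close>.\<close>

lemma primary_decomposition:
  assumes A: "A \<in> carrier U" and H: "\<And>q x. x \<in> H \<Longrightarrow> opoly A q \<odot>\<^bsub>M\<^esub> x \<in> H"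
    and m: "m \<in> H" "m \<in> gen_eig M A S"
  shows "m \<in> addspan M (\<Union>c\<in>S. H \<inter> gen_eig M A {c})"
proof -
  let ?B = "\<lambda>S. \<Union>c\<in>S. H \<inter> gen_eig M A {c}"
  have B: "?B S \<subseteq> carrier M" for S
    using gen_eig_carrier by blast
  have "m \<in> addspan M (?B S)" if "finite R" "R \<subseteq> S" "m \<in> H" "m \<in> gen_eig M A R" for R m
    using that
  proof (induction R arbitrary: m rule: finite_induct)
    case empty
    then have "m = \<zero>\<^bsub>M\<^esub>" using gen_eig_disjoint[OF A, of m "{}" "{}"] by simp
    then show ?case by (simp add: addspan.zero)
  next
    case (insert c R)
    obtain r s where rs: "m = opoly A r \<odot>\<^bsub>M\<^esub> m \<oplus>\<^bsub>M\<^esub> opoly A s \<odot>\<^bsub>M\<^esub> m"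
      "opoly A r \<odot>\<^bsub>M\<^esub> m \<in> gen_eig M A (insert c R \<inter> {c})"
      "opoly A s \<odot>\<^bsub>M\<^esub> m \<in> gen_eig M A (insert c R - {c})"
      using gen_eig_split[OF A, of m "insert c R" "{c}"] insert.prems by metis
    have "opoly A s \<odot>\<^bsub>M\<^esub> m \<in> gen_eig M A R"
      using rs(3) by (rule gen_eig_mono) auto
    then have "opoly A s \<odot>\<^bsub>M\<^esub> m \<in> addspan M (?B S)"
      using insert H by auto
    moreover have "opoly A r \<odot>\<^bsub>M\<^esub> m \<in> ?B S"
      using rs(2) H insert.prems by auto
    ultimately show ?case
      using addspan.add rs(1) by metis
  qed
  moreover obtain p where "p \<noteq> 0" "\<And>z. poly p z = 0 \<Longrightarrow> z \<in> S" "opoly A p \<odot>\<^bsub>M\<^esub> m = \<zero>\<^bsub>M\<^esub>" "m \<in> carrier M"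
    using gen_eigE[OF m(2)] by metis
  ultimately show ?thesis
    using m(1) poly_roots_finite[of p] gen_eigI[of m p "{z. poly p z = 0}" A] by blast
qed

end

section \<open>Generalized weight modules through annihilating polynomials\<close>

context oper_module
begin

lemma nat_pow_shift:
  assumes A: "A \<in> carrier U"
  shows "(\<lambda>p. A p - scal c p) [^]\<^bsub>U\<^esub> (N::nat) = opoly A ([:-c, 1:] ^ N)"
proof -
  have "X [^]\<^bsub>U\<^esub> (N::nat) = X ^^ N" for X
    by (induction N) (simp_all add: U_simps nat_pow_def funpow_swap1 fun_eq_iff)
  then show ?thesis
    by (simp add: opoly_power[OF U_weyl[OF A]] opoly_shift[OF U_weyl[OF A]])
qed

lemma opoly_dvd_zero:
  assumes "A \<in> carrier U" "m \<in> carrier M" "opoly A p \<odot>\<^bsub>M\<^esub> m = \<zero>\<^bsub>M\<^esub>" "p dvd q"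
  shows "opoly A q \<odot>\<^bsub>M\<^esub> m = \<zero>\<^bsub>M\<^esub>"
proof -
  obtain r where "q = r * p" using assms(4) by (metis dvdE mult.commute)
  with assms show ?thesis by (simp add: act_opoly_mult U_opoly)
qed

lemma gen_eig_singletonI:
  assumes "m \<in> carrier M" "opoly A ([:-c, 1:] ^ N) \<odot>\<^bsub>M\<^esub> m = \<zero>\<^bsub>M\<^esub>"
  shows "m \<in> gen_eig M A {c}"
  using assms by (intro gen_eigI[of m "[:-c, 1:] ^ N"]) auto

text \<open>A nonzero polynomial whose only possible root is \<open>c\<close> divides a power of x -
  c, and \<open>degree p\<close> is a sufficient exponent. Providing all larger exponents too allows
  several bounds to be merged.\<close>

lemma gen_eig_singletonE:
  assumes A: "A \<in> carrier U" and "m \<in> gen_eig M A {c}"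
  obtains N where "\<And>N'. N' \<ge> N \<Longrightarrow> opoly A ([:-c, 1:] ^ N') \<odot>\<^bsub>M\<^esub> m = \<zero>\<^bsub>M\<^esub>"
proof -
  obtain p where p: "m \<in> carrier M" "p \<noteq> 0" "\<And>z. poly p z = 0 \<Longrightarrow> z = c" "opoly A p \<odot>\<^bsub>M\<^esub> m = \<zero>\<^bsub>M\<^esub>"
    using gen_eigE[OF assms(2)] by (metis singletonD)
  have "\<forall>x. poly p x = 0 \<longrightarrow> poly [:-c, 1:] x = 0"
    using p(3) by auto
  then have "p dvd [:-c, 1:] ^ degree p"
    using p(2) nullstellensatz_univariate[of p "[:-c, 1:]"] by blast
  then have "opoly A ([:-c, 1:] ^ N') \<odot>\<^bsub>M\<^esub> m = \<zero>\<^bsub>M\<^esub>" if "N' \<ge> degree p" for N'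
    by (intro opoly_dvd_zero[OF A p(1) p(4)] dvd_trans[OF _ le_imp_power_dvd[OF that]])
  then show ?thesis by (rule that)
qed

lemma weight_space_iff: "m \<in> weight_space U M l \<longleftrightarrow> (\<forall>i. m \<in> gen_eig M (theta i) {l $ i})"
proof
  assume "m \<in> weight_space U M l"
  then show "\<forall>i. m \<in> gen_eig M (theta i) {l $ i}"
    by (auto simp: weight_space_def nat_pow_shift U_theta intro: gen_eig_singletonI)
next
  assume *: "\<forall>i. m \<in> gen_eig M (theta i) {l $ i}"
  have "\<exists>N. \<forall>N'\<ge>N. opoly (theta i) ([:- (l $ i), 1:] ^ N') \<odot>\<^bsub>M\<^esub> m = \<zero>\<^bsub>M\<^esub>" for i
    using gen_eig_singletonE[OF U_theta, of m i "l $ i"] * by metis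
  then obtain N where N: "\<And>i N'. N' \<ge> N i \<Longrightarrow> opoly (theta i) ([:- (l $ i), 1:] ^ N') \<odot>\<^bsub>M\<^esub> m = \<zero>\<^bsub>M\<^esub>"
    by metis
  \<comment> \<open>Weight spaces ask for one positive exponent valid in all coordinates: the
    maximum exists as the index type is finite, and \<open>Suc\<close> secures positivity.\<close>
  define K where "K = Suc (Max (range N))"
  have "N i \<le> K" for i
    unfolding K_def by (simp add: le_SucI)
  then show "m \<in> weight_space U M l"
    using N gen_eig_carrier[OF *[rule_format]] unfolding weight_space_def mem_Collect_eq
    by (intro conjI exI[of _ K] allI) (auto simp only: nat_pow_shift U_theta K_def zero_less_Suc)
qed

lemma euler_locally_nilpotent_iff:
  "euler_locally_nilpotent U M a \<longleftrightarrow> (\<forall>m\<in>carrier M. m \<in> gen_eig M euler {a})"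
proof
  assume "euler_locally_nilpotent U M a"
  then show "\<forall>m\<in>carrier M. m \<in> gen_eig M euler {a}"
    by (auto simp: euler_locally_nilpotent_def nat_pow_shift U_euler intro: gen_eig_singletonI)
next
  assume *: "\<forall>m\<in>carrier M. m \<in> gen_eig M euler {a}"
  have "\<exists>N>0. opoly euler ([:-a, 1:] ^ N) \<odot>\<^bsub>M\<^esub> m = \<zero>\<^bsub>M\<^esub>" if "m \<in> carrier M" for m
    using gen_eig_singletonE[OF U_euler, of m a] * that by (metis le_SucI le_refl zero_less_Suc)
  then show "euler_locally_nilpotent U M a"
    by (auto simp: euler_locally_nilpotent_def nat_pow_shift U_euler)
qed

section \<open>Independence and existence of weight decompositions\<close>

lemma weight_space_carrier: "weight_space U M l \<subseteq> carrier M"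
  by (auto simp: weight_space_def)

lemma weight_space_zero: "\<zero>\<^bsub>M\<^esub> \<in> weight_space U M l"
  by (simp add: weight_space_iff gen_eig_zero U_theta)

lemma weight_space_add:
  "x \<in> weight_space U M l \<Longrightarrow> y \<in> weight_space U M l \<Longrightarrow> x \<oplus>\<^bsub>M\<^esub> y \<in> weight_space U M l"
  by (simp add: weight_space_iff gen_eig_add U_theta)

lemma weight_space_act:
  "X \<in> carrier U \<Longrightarrow> (\<And>i. homog (theta i) 0 X) \<Longrightarrow> x \<in> weight_space U M l \<Longrightarrow> X \<odot>\<^bsub>M\<^esub> x \<in> weight_space U M l"
  by (simp add: weight_space_iff gen_eig_act_0 U_theta)

lemma homog_theta_scal: "homog (theta i) 0 (scal c)"
  by (rule homog_scal[OF theta_in_weyl])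

text \<open>For a weight \<open>s\<close> different from \<open>l\<close>, choose a coordinate
  \<open>j\<close> where they differ. A power \<open>X\<close> of \<open>theta j\<close> minus
  \<open>s $ j\<close> kills the summand at \<open>s\<close> and preserves all weight spaces, so the
  induction hypothesis gives that \<open>X\<close> kills \<open>m\<close>. Then \<open>m\<close> has
  both eigenvalues \<open>s $ j\<close> and \<open>l $ j\<close> under
  \<open>theta j\<close>.\<close>

lemma weight_spaces_independent:
  assumes "finite A" "l \<notin> A" "m \<in> weight_space U M l" "\<And>s. s \<in> A \<Longrightarrow> f s \<in> weight_space U M s"
    and "m \<oplus>\<^bsub>M\<^esub> finsum M f A = \<zero>\<^bsub>M\<^esub>"
  shows "m = \<zero>\<^bsub>M\<^esub>"
  using assms
proof (induction A arbitrary: m f rule: finite_induct)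
  case empty
  then show ?case using weight_space_carrier[of l] by auto
next
  case (insert s A)
  have f: "f \<in> A \<rightarrow> carrier M" "f s \<in> carrier M" "m \<in> carrier M"
    using insert.prems weight_space_carrier by blast+
  obtain j where j: "s $ j \<noteq> l $ j"
    using insert.prems(1) by (metis insertCI vec_eq_iff)
  obtain N where N: "opoly (theta j) ([:- (s $ j), 1:] ^ N) \<odot>\<^bsub>M\<^esub> f s = \<zero>\<^bsub>M\<^esub>"
    using gen_eig_singletonE[OF U_theta, of "f s" j "s $ j"] insert.prems(3)[of s]
    by (metis insertI1 le_refl weight_space_iff)
  define X where "X = opoly (theta j) ([:- (s $ j), 1:] ^ N)"
  have X: "X \<in> carrier U" by (simp add: X_def U_opoly U_theta)
  have hX: "homog (theta i) 0 X" for i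
    unfolding X_def by (intro homog_0_opoly U_theta theta_commute)
  have "X \<odot>\<^bsub>M\<^esub> (m \<oplus>\<^bsub>M\<^esub> finsum M f (insert s A)) = \<zero>\<^bsub>M\<^esub>"
    using X insert.prems by simp
  then have "X \<odot>\<^bsub>M\<^esub> m \<oplus>\<^bsub>M\<^esub> finsum M (\<lambda>l. X \<odot>\<^bsub>M\<^esub> f l) A = \<zero>\<^bsub>M\<^esub>"
    using f X insert.hyps N
    by (simp add: smult_r_distr M.finsum_closed act_finsum X_def[symmetric])
       (simp add: M.finsum_closed act_finsum[symmetric])
  moreover have "l \<notin> A" "X \<odot>\<^bsub>M\<^esub> m \<in> weight_space U M l"
    using insert.prems by (auto intro!: weight_space_act X hX)
  moreover have "X \<odot>\<^bsub>M\<^esub> f s \<in> weight_space U M s" if "s \<in> A" for s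
    using insert.prems(3)[of s] that by (intro weight_space_act X hX) auto
  ultimately have "X \<odot>\<^bsub>M\<^esub> m = \<zero>\<^bsub>M\<^esub>"
    using insert.IH[of "X \<odot>\<^bsub>M\<^esub> m" "\<lambda>l. X \<odot>\<^bsub>M\<^esub> f l"] by blast
  then have "m \<in> gen_eig M (theta j) {s $ j}"
    using f(3) by (auto simp: X_def intro: gen_eig_singletonI)
  moreover have "m \<in> gen_eig M (theta j) {l $ j}"
    using insert.prems by (simp add: weight_space_iff)
  ultimately show ?case
    using gen_eig_disjoint[OF U_theta] j by blast
qed

lemma finsum_support:
  assumes "finite A" "{l. f l \<noteq> \<zero>\<^bsub>M\<^esub>} \<subseteq> A" "\<And>l. f l \<in> carrier M"
  shows "finsum M f {l. f l \<noteq> \<zero>\<^bsub>M\<^esub>} = finsum M f A"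
  using assms by (intro M.add.finprod_mono_neutral_cong_left) auto

lemma weight_decomposition_unique:
  assumes f: "\<And>l. f l \<in> weight_space U M l" "finite {l. f l \<noteq> \<zero>\<^bsub>M\<^esub>}"
    and g: "\<And>l. g l \<in> weight_space U M l" "finite {l. g l \<noteq> \<zero>\<^bsub>M\<^esub>}"
    and eq: "finsum M f {l. f l \<noteq> \<zero>\<^bsub>M\<^esub>} = finsum M g {l. g l \<noteq> \<zero>\<^bsub>M\<^esub>}"
  shows "f = g"
proof
  fix l
  define A where "A = {l. f l \<noteq> \<zero>\<^bsub>M\<^esub>} \<union> {l. g l \<noteq> \<zero>\<^bsub>M\<^esub>} \<union> {l}"
  define h where "h s = f s \<oplus>\<^bsub>M\<^esub> scal (- 1) \<odot>\<^bsub>M\<^esub> g s" for s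
  have A: "finite A" "l \<in> A" using f g by (auto simp: A_def)
  have car: "f s \<in> carrier M" "g s \<in> carrier M" for s
    using f g weight_space_carrier by blast+
  have neg: "scal (- 1) \<odot>\<^bsub>M\<^esub> x \<in> carrier M" if "x \<in> carrier M" for x
    using that U_scal by simp
  have h: "h s \<in> weight_space U M s" for s
    unfolding h_def by (intro weight_space_add weight_space_act f g U_scal homog_theta_scal)
  have hcar: "h s \<in> carrier M" for s using h weight_space_carrier by blast
  have "finsum M h A = finsum M f A \<oplus>\<^bsub>M\<^esub> scal (- 1) \<odot>\<^bsub>M\<^esub> finsum M g A"
    unfolding h_def using car neg A by (simp add: M.finsum_addf act_finsum U_scal)
  also have "finsum M f A = finsum M g A"
    using eq finsum_support[OF A(1), of f] finsum_support[OF A(1), of g] car by (simp add: A_def Un_assoc subset_iff)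
  finally have "finsum M h A = \<zero>\<^bsub>M\<^esub>"
    using A car by (simp add: act_neg M.finsum_closed)
  moreover have "finsum M h A = h l \<oplus>\<^bsub>M\<^esub> finsum M h (A - {l})"
    using M.finsum_insert[of "A - {l}" l h] A hcar by (simp add: insert_absorb)
  ultimately have "h l = \<zero>\<^bsub>M\<^esub>"
    using A(1) h weight_spaces_independent[of "A - {l}" l "h l" h] by simp
  then show "f l = g l"
    using eq_of_add_neg[OF car(1) car(2)] by (simp add: h_def)
qed

lemma addspan_weight_decomposition:
  assumes "m \<in> addspan M (\<Union>l\<in>L. weight_space U M l)"
  shows "\<exists>f. (\<forall>l. f l \<in> weight_space U M l) \<and> finite {l. f l \<noteq> \<zero>\<^bsub>M\<^esub>} \<and> {l. f l \<noteq> \<zero>\<^bsub>M\<^esub>} \<subseteq> L \<and>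
    m = finsum M f {l. f l \<noteq> \<zero>\<^bsub>M\<^esub>}"
  using assms
proof (induction rule: addspan.induct)
  case zero
  then show ?case by (intro exI[of _ "\<lambda>_. \<zero>\<^bsub>M\<^esub>"]) (simp add: weight_space_zero)
next
  case (add b s)
  then obtain l f where l: "l \<in> L" "b \<in> weight_space U M l" and f: "\<And>l. f l \<in> weight_space U M l"
    "finite {l. f l \<noteq> \<zero>\<^bsub>M\<^esub>}" "{l. f l \<noteq> \<zero>\<^bsub>M\<^esub>} \<subseteq> L" "s = finsum M f {l. f l \<noteq> \<zero>\<^bsub>M\<^esub>}"
    by auto
  \<comment> \<open>The new summand joins the component of weight \<open>l\<close> that
    \<open>s\<close> may already have.\<close>
  define g where "g = f(l := b \<oplus>\<^bsub>M\<^esub> f l)"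
  define A where "A = insert l {l. f l \<noteq> \<zero>\<^bsub>M\<^esub>}"
  have A: "finite A" "l \<in> A" "{l. g l \<noteq> \<zero>\<^bsub>M\<^esub>} \<subseteq> A" "{l. f l \<noteq> \<zero>\<^bsub>M\<^esub>} \<subseteq> A" "A \<subseteq> L"
    using f l by (auto simp: A_def g_def)
  have g: "g s \<in> weight_space U M s" for s
    using l f by (auto simp: g_def intro: weight_space_add)
  have car: "f s \<in> carrier M" "g s \<in> carrier M" "b \<in> carrier M" for s
    using f g l weight_space_carrier by blast+
  have "finsum M g {l. g l \<noteq> \<zero>\<^bsub>M\<^esub>} = finsum M g A"
    using A car by (intro finsum_support)
  also have "\<dots> = g l \<oplus>\<^bsub>M\<^esub> finsum M g (A - {l})"
    using M.finsum_insert[of "A - {l}" l g] A car by (simp add: insert_absorb)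
  also have "finsum M g (A - {l}) = finsum M f (A - {l})"
    using car by (intro M.finsum_cong') (auto simp: g_def)
  also have "g l \<oplus>\<^bsub>M\<^esub> \<dots> = b \<oplus>\<^bsub>M\<^esub> (f l \<oplus>\<^bsub>M\<^esub> finsum M f (A - {l}))"
    using car by (simp add: g_def M.a_assoc M.finsum_closed)
  also have "f l \<oplus>\<^bsub>M\<^esub> finsum M f (A - {l}) = finsum M f A"
    using M.finsum_insert[of "A - {l}" l f] A car by (simp add: insert_absorb)
  also have "\<dots> = s"
    using f(4) A car by (simp add: finsum_support[of A])
  finally show ?case
    using A g by (intro exI[of _ g]) (auto intro: finite_subset)
qed

text \<open>The coordinates are split one after the other; the polynomials that split off the pieces for one
  coordinate commute with the operators of the others.\<close>

lemma addspan_weight_spaces: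
  assumes m: "\<And>i. m \<in> gen_eig M (theta i) (S i)"
  shows "m \<in> addspan M (\<Union>l\<in>{l. \<forall>i. l $ i \<in> S i}. weight_space U M l)"
proof -
  \<comment> \<open>In \<open>B I\<close> the coordinates in \<open>I\<close> are down to a single
    eigenvalue, while each other coordinate keeps some set \<open>T\<close> inside
    \<open>S i\<close>. The induction enlarges \<open>I\<close> to \<open>UNIV\<close>.\<close>
  define B where "B I = {m. \<forall>i. \<exists>T. m \<in> gen_eig M (theta i) T \<and> T \<subseteq> S i \<and> (i \<in> I \<longrightarrow> (\<exists>c. T = {c}))}" for I
  have B: "B I \<subseteq> carrier M" for I
    by (auto simp: B_def dest: gen_eig_carrier)
  have "m \<in> addspan M (B I)" if "finite I" for I
    using that
  proof (induction I rule: finite_induct)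
    case empty
    then show ?case using m by (intro addspan_base[OF B]) (auto simp: B_def)
  next
    case (insert i I)
    have "B I \<subseteq> addspan M (B (insert i I))"
    proof
      fix x assume "x \<in> B I"
      then obtain T where T: "\<And>j. x \<in> gen_eig M (theta j) (T j)" "\<And>j. T j \<subseteq> S j"
        "\<And>j. j \<in> I \<Longrightarrow> \<exists>c. T j = {c}"
        unfolding B_def by simp metis
      \<comment> \<open>\<open>H\<close> remembers the conditions on all coordinates while
        coordinate \<open>i\<close> is being split; it is stable because the \<open>theta j\<close>
        commute.\<close>
      define H where "H = {y. \<forall>j. y \<in> gen_eig M (theta j) (T j)}"
      have "x \<in> addspan M (\<Union>c\<in>T i. H \<inter> gen_eig M (theta i) {c})"
      proof (rule primary_decomposition[OF U_theta])
        show "opoly (theta i) q \<odot>\<^bsub>M\<^esub> y \<in> H" if "y \<in> H" for q y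
          using that unfolding H_def mem_Collect_eq
          by (intro allI gen_eig_act_0 U_theta U_opoly homog_0_opoly theta_commute) blast
      qed (use T in \<open>auto simp: H_def\<close>)
      moreover have "(\<Union>c\<in>T i. H \<inter> gen_eig M (theta i) {c}) \<subseteq> B (insert i I)"
      proof
        fix y assume "y \<in> (\<Union>c\<in>T i. H \<inter> gen_eig M (theta i) {c})"
        then obtain c where c: "c \<in> T i" "y \<in> gen_eig M (theta i) {c}" "\<And>j. y \<in> gen_eig M (theta j) (T j)"
          by (auto simp: H_def)
        have "\<exists>T'. y \<in> gen_eig M (theta j) T' \<and> T' \<subseteq> S j \<and> (j \<in> insert i I \<longrightarrow> (\<exists>c. T' = {c}))" for j
        proof (cases "j = i")
          case True
          then show ?thesis using c(1,2) T(2)[of i] by (intro exI[of _ "{c}"]) auto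
        next
          case False
          then show ?thesis using c(3)[of j] T(2,3)[of j] by (intro exI[of _ "T j"]) auto
        qed
        then show "y \<in> B (insert i I)" by (simp add: B_def)
      qed
      ultimately show "x \<in> addspan M (B (insert i I))"
        using addspan_trans[OF B subset_trans[OF _ subsetI[OF addspan_base[OF B]]]] by simp
    qed
    then show ?case by (rule addspan_trans[OF B _ insert.IH])
  qed
  then have "m \<in> addspan M (B UNIV)" by simp
  moreover have "B UNIV \<subseteq> (\<Union>l\<in>{l. \<forall>i. l $ i \<in> S i}. weight_space U M l)"
  proof
    fix x assume "x \<in> B UNIV"
    then have "\<forall>i. \<exists>c. x \<in> gen_eig M (theta i) {c} \<and> c \<in> S i"
      by (auto simp: B_def)
    then obtain c where c: "\<And>i. x \<in> gen_eig M (theta i) {c i}" "\<And>i. c i \<in> S i"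
      by metis
    then have "x \<in> weight_space U M (\<chi> i. c i)" by (simp add: weight_space_iff)
    then show "x \<in> (\<Union>l\<in>{l. \<forall>i. l $ i \<in> S i}. weight_space U M l)"
      using c by (intro UN_I[of "\<chi> i. c i"]) auto
  qed
  moreover have "(\<Union>l\<in>{l. \<forall>i. l $ i \<in> S i}. weight_space U M l) \<subseteq> carrier M"
    using weight_space_carrier by blast
  ultimately show ?thesis
    using addspan_trans[OF _ subset_trans[OF _ subsetI[OF addspan_base]]] by simp
qed

lemma gen_eig_finsum:
  assumes "A \<in> carrier U" "finite I" "\<And>i. i \<in> I \<Longrightarrow> f i \<in> gen_eig M A S"
  shows "finsum M f I \<in> gen_eig M A S"
  using assms(2,3)
proof (induction I rule: finite_induct)
  case empty
  then show ?case by (simp add: gen_eig_zero assms(1))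
next
  case (insert i I)
  then have "f \<in> I \<rightarrow> carrier M" "f i \<in> carrier M" using gen_eig_carrier by blast+
  then show ?case using insert by (simp add: gen_eig_add assms(1))
qed

text \<open>The bridge from the categories to annihilating polynomials: a support condition that is
  a product over the coordinates can be tested on each \<open>theta i\<close> separately. Finite
  sums of weight vectors have the right roots, and conversely \<open>addspan_weight_spaces\<close>
  splits an element into weight vectors.\<close>

lemma generalized_weight_module_iff:
  "generalized_weight_module U M \<and> weight_support U M \<subseteq> {l. \<forall>i. l $ i \<in> S i} \<longleftrightarrow>
   (\<forall>m\<in>carrier M. \<forall>i. m \<in> gen_eig M (theta i) (S i))" (is "?L \<longleftrightarrow> ?R")
proof
  define L' where L': "L' = {l. \<forall>i. l $ i \<in> S i}"
  assume ?L
  then have ds: "internal_direct_sum M (weight_space U M)" and sup: "weight_support U M \<subseteq> L'"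
    by (auto simp: generalized_weight_module_def L')
  have "m \<in> gen_eig M (theta i) (S i)" if mc: "m \<in> carrier M" for m i
  proof -
    obtain f where f: "\<And>l. f l \<in> weight_space U M l" "finite {l. f l \<noteq> \<zero>\<^bsub>M\<^esub>}"
      "m = finsum M f {l. f l \<noteq> \<zero>\<^bsub>M\<^esub>}"
      using ex1_implies_ex[OF conjunct2[OF ds[unfolded internal_direct_sum_def], rule_format, OF mc]] by blast
    have "f l \<in> gen_eig M (theta i) (S i)" if "f l \<noteq> \<zero>\<^bsub>M\<^esub>" for l
    proof -
      have "l \<in> weight_support U M"
        using f(1)[of l] that by (auto simp: weight_support_def)
      then have "l $ i \<in> S i" using sup L' by auto
      then show ?thesis
        using f(1)[of l] by (auto simp: weight_space_iff intro: gen_eig_mono)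
    qed
    then show ?thesis
      unfolding f(3) by (intro gen_eig_finsum U_theta f) auto
  qed
  then show ?R by blast
next
  define L' where L': "L' = {l. \<forall>i. l $ i \<in> S i}"
  assume ?R
  then have m: "\<And>m i. m \<in> carrier M \<Longrightarrow> m \<in> gen_eig M (theta i) (S i)"
    by blast
  have ex: "\<exists>f. (\<forall>l. f l \<in> weight_space U M l) \<and> finite {l. f l \<noteq> \<zero>\<^bsub>M\<^esub>} \<and> {l. f l \<noteq> \<zero>\<^bsub>M\<^esub>} \<subseteq> L' \<and>
    m = finsum M f {l. f l \<noteq> \<zero>\<^bsub>M\<^esub>}" if "m \<in> carrier M" for m
    unfolding L' using addspan_weight_decomposition[OF addspan_weight_spaces] m[OF that] by blast
  have "internal_direct_sum M (weight_space U M)"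
    unfolding internal_direct_sum_def
  proof (intro conjI allI ballI)
    fix m assume "m \<in> carrier M"
    then show "\<exists>!f. (\<forall>l. f l \<in> weight_space U M l) \<and> finite {l. f l \<noteq> \<zero>\<^bsub>M\<^esub>} \<and>
      m = finsum M f {l. f l \<noteq> \<zero>\<^bsub>M\<^esub>}"
      using ex by (auto intro: weight_decomposition_unique)
  qed (rule weight_space_carrier)
  moreover have "weight_support U M \<subseteq> L'"
  proof
    fix l assume "l \<in> weight_support U M"
    then obtain m where m: "m \<in> weight_space U M l" "m \<noteq> \<zero>\<^bsub>M\<^esub>"
      using weight_space_zero[of l] by (auto simp: weight_support_def)
    then have mc: "m \<in> carrier M" using weight_space_carrier by blast
    obtain f where f: "\<And>l. f l \<in> weight_space U M l" "finite {l. f l \<noteq> \<zero>\<^bsub>M\<^esub>}" "{l. f l \<noteq> \<zero>\<^bsub>M\<^esub>} \<subseteq> L'"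
      "m = finsum M f {l. f l \<noteq> \<zero>\<^bsub>M\<^esub>}"
      using ex[OF mc] by blast
    \<comment> \<open>A weight vector \<open>m\<close> is its own decomposition, concentrated at
      \<open>l\<close>. By uniqueness it agrees with the decomposition \<open>f\<close> supported in
      \<open>L'\<close>, so \<open>l\<close> lies there.\<close>
    define g where "g = (\<lambda>_. \<zero>\<^bsub>M\<^esub>)(l := m)"
    have g: "{s. g s \<noteq> \<zero>\<^bsub>M\<^esub>} = {l}" using m by (auto simp: g_def)
    have "finsum M g {l} = m"
      using mc by (simp add: g_def)
    then have "f = g"
      using f m g weight_space_zero by (intro weight_decomposition_unique) (auto simp: g_def)
    then show "l \<in> L'" using f(3) g by auto
  qed
  ultimately show ?L
    using left_module_axioms L' by (simp add: generalized_weight_module_def)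
qed

text \<open>With a = A - c and b = B - d commuting, (a + b)^(r+s) kills a vector that a^r and b^s
  kill. One factor a + b is applied at a time: in each of a x and b x one exponent has dropped, so
  induction on r + s avoids the binomial formula.\<close>

lemma gen_eig_sum:
  assumes A: "A \<in> carrier U" and B: "B \<in> carrier U" and h: "homog A 0 B"
    and m: "m \<in> gen_eig M A {c}" "m \<in> gen_eig M B {d}"
  shows "m \<in> gen_eig M (\<lambda>p. A p + B p) {c + d}"
proof -
  let ?C = "\<lambda>p. A p + B p"
  let ?a = "opoly A [:-c, 1:]" and ?b = "opoly B [:-d, 1:]"
  have C: "?C \<in> carrier U" using A B by (rule U_add)
  note W = U_weyl[OF A] U_weyl[OF B]
  have shift: "opoly ?C [:-(c + d), 1:] = (\<lambda>p. ?a p + ?b p)"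
    unfolding opoly_shift[OF U_weyl[OF C]] opoly_shift[OF W(1)] opoly_shift[OF W(2)]
    by (simp add: fun_eq_iff scal_plus)
  have hA: "homog A 0 ?b" using A B h by (intro homog_0_opoly)
  have hB: "homog B 0 ?a"
    using A B h homog_0_opoly[of A B "[:-c, 1:]"] by (simp add: homog_0_iff)
  have comm: "?b \<circ> opoly A q = opoly A q \<circ> ?b" for q
    using homog_opoly[OF W(1) U_weyl[OF U_opoly[OF B]] hA] by (simp add: fun_eq_iff pcompose_idR)
  have comm': "?a \<circ> opoly B q = opoly B q \<circ> ?a" for q
    using homog_opoly[OF W(2) U_weyl[OF U_opoly[OF A]] hB] by (simp add: fun_eq_iff pcompose_idR)
  have "opoly ?C ([:-(c + d), 1:] ^ (r + s)) \<odot>\<^bsub>M\<^esub> x = \<zero>\<^bsub>M\<^esub>"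
    if "x \<in> carrier M" "opoly A ([:-c, 1:] ^ r) \<odot>\<^bsub>M\<^esub> x = \<zero>\<^bsub>M\<^esub>" "opoly B ([:-d, 1:] ^ s) \<odot>\<^bsub>M\<^esub> x = \<zero>\<^bsub>M\<^esub>" for r s x
    using that
  proof (induction "r + s" arbitrary: r s x)
    case 0
    then have "x = \<zero>\<^bsub>M\<^esub>" using A by (simp add: act_opoly_1)
    then show ?case using C by (simp add: U_opoly)
  next
    case (Suc n)
    show ?case
    proof (cases "r = 0 \<or> s = 0")
      case True
      then have "x = \<zero>\<^bsub>M\<^esub>" using A B Suc.prems by (auto simp: act_opoly_1)
      then show ?thesis using C by (simp add: U_opoly)
    next
      case False
      then obtain r' s' where rs: "r = Suc r'" "s = Suc s'" by (metis not0_implies_Suc)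
      have abx: "?a \<odot>\<^bsub>M\<^esub> x \<in> carrier M" "?b \<odot>\<^bsub>M\<^esub> x \<in> carrier M"
        using A B Suc.prems by (simp_all add: U_opoly)
      have n: "r + s = Suc n" and n1: "n = r' + s" and n2: "n = r + s'" using Suc.hyps rs by simp_all
      have "opoly A ([:-c, 1:] ^ r') \<odot>\<^bsub>M\<^esub> (?a \<odot>\<^bsub>M\<^esub> x) = \<zero>\<^bsub>M\<^esub>"
        using Suc.prems(1,2) A rs by (simp only: act_opoly_mult[symmetric] power_Suc2)
      moreover have "opoly B ([:-d, 1:] ^ s) \<odot>\<^bsub>M\<^esub> (?a \<odot>\<^bsub>M\<^esub> x) = \<zero>\<^bsub>M\<^esub>"
        using A B Suc.prems(1) Suc.prems(3)[THEN arg_cong, of "\<lambda>y. ?a \<odot>\<^bsub>M\<^esub> y"]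
        by (simp only: act_comp[symmetric] U_opoly comm' act_0)
      ultimately have 1: "opoly ?C ([:-(c + d), 1:] ^ n) \<odot>\<^bsub>M\<^esub> (?a \<odot>\<^bsub>M\<^esub> x) = \<zero>\<^bsub>M\<^esub>"
        unfolding n1 by (intro Suc.hyps(1)[OF n1 abx(1)])
      have "opoly B ([:-d, 1:] ^ s') \<odot>\<^bsub>M\<^esub> (?b \<odot>\<^bsub>M\<^esub> x) = \<zero>\<^bsub>M\<^esub>"
        using Suc.prems(1,3) B rs by (simp only: act_opoly_mult[symmetric] power_Suc2)
      moreover have "opoly A ([:-c, 1:] ^ r) \<odot>\<^bsub>M\<^esub> (?b \<odot>\<^bsub>M\<^esub> x) = \<zero>\<^bsub>M\<^esub>"
        using A B Suc.prems(1) Suc.prems(2)[THEN arg_cong, of "\<lambda>y. ?b \<odot>\<^bsub>M\<^esub> y"]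
        by (simp only: act_comp[symmetric] U_opoly comm act_0)
      ultimately have 2: "opoly ?C ([:-(c + d), 1:] ^ n) \<odot>\<^bsub>M\<^esub> (?b \<odot>\<^bsub>M\<^esub> x) = \<zero>\<^bsub>M\<^esub>"
        unfolding n2 by (intro Suc.hyps(1)[OF n2 abx(2)])
      have "opoly ?C ([:-(c + d), 1:] ^ (r + s)) \<odot>\<^bsub>M\<^esub> x =
          opoly ?C ([:-(c + d), 1:] ^ n) \<odot>\<^bsub>M\<^esub> (opoly ?C [:-(c + d), 1:] \<odot>\<^bsub>M\<^esub> x)"
        using C Suc.prems(1) n by (simp only: act_opoly_mult[symmetric] power_Suc2)
      also have "opoly ?C [:-(c + d), 1:] \<odot>\<^bsub>M\<^esub> x = ?a \<odot>\<^bsub>M\<^esub> x \<oplus>\<^bsub>M\<^esub> ?b \<odot>\<^bsub>M\<^esub> x"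
        unfolding shift using A B Suc.prems(1) by (intro act_add U_opoly)
      finally show ?thesis
        using 1 2 abx C by (simp add: smult_r_distr U_opoly)
    qed
  qed
  moreover obtain r where "opoly A ([:-c, 1:] ^ r) \<odot>\<^bsub>M\<^esub> m = \<zero>\<^bsub>M\<^esub>"
    using gen_eig_singletonE[OF A m(1)] by blast
  moreover obtain s where "opoly B ([:-d, 1:] ^ s) \<odot>\<^bsub>M\<^esub> m = \<zero>\<^bsub>M\<^esub>"
    using gen_eig_singletonE[OF B m(2)] by blast
  moreover have "m \<in> carrier M" using m gen_eig_carrier by blast
  ultimately show ?thesis
    using gen_eig_singletonI by blast
qed

text \<open>The commuting operators \<open>theta i\<close> are added one by one, and their
  eigenvalues add up with them.\<close>

lemma weight_space_euler:
  assumes m: "m \<in> weight_space U M l"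
  shows "m \<in> gen_eig M euler {\<Sum>i\<in>UNIV. l $ i}"
proof -
  \<comment> \<open>The induction also carries membership in the ring and commutation with every
    \<open>theta j\<close>, which \<open>gen_eig_sum\<close> demands of the partial sum.\<close>
  have "(\<lambda>p. \<Sum>i\<in>I. theta i p) \<in> carrier U \<and> m \<in> gen_eig M (\<lambda>p. \<Sum>i\<in>I. theta i p) {\<Sum>i\<in>I. l $ i} \<and>
      (\<forall>j. homog (theta j) 0 (\<lambda>p. \<Sum>i\<in>I. theta i p))" if "finite I" for I
    using that
  proof (induction I rule: finite_induct)
    case empty
    have mc: "m \<in> carrier M" using m weight_space_carrier by blast
    have "opoly (\<lambda>p. 0 :: 'n cpoly) [:0, 1:] = (\<lambda>p. 0)"
      by (simp add: fun_eq_iff opoly_pCons zero_in_weyl opoly_0)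
    then have "m \<in> gen_eig M (\<lambda>p. 0) {0}"
      using mc by (intro gen_eigI[of _ "[:0, 1:]"]) (auto simp: zero_act)
    moreover have "homog (theta j) 0 (\<lambda>p. 0)" for j :: 'n
      by (simp add: homog_def weyl_set_0 theta_in_weyl)
    ultimately show ?case by (simp add: U_zero)
  next
    case (insert i I)
    then have IH: "(\<lambda>p. \<Sum>i\<in>I. theta i p) \<in> carrier U" "m \<in> gen_eig M (\<lambda>p. \<Sum>i\<in>I. theta i p) {\<Sum>i\<in>I. l $ i}"
      "\<And>j. homog (theta j) 0 (\<lambda>p. \<Sum>i\<in>I. theta i p)" by auto
    have "m \<in> gen_eig M (theta i) {l $ i}" using m by (simp add: weight_space_iff)
    then have "m \<in> gen_eig M (\<lambda>p. theta i p + (\<Sum>i\<in>I. theta i p)) {l $ i + (\<Sum>i\<in>I. l $ i)}"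
      using IH by (intro gen_eig_sum U_theta)
    moreover have "homog (theta j) 0 (\<lambda>p. theta i p + (\<Sum>i\<in>I. theta i p))" for j
      using IH(3)[of j] theta_commute[of j i] by (simp add: homog_def weyl_set_additive theta_in_weyl)
    ultimately show ?case
      using insert.hyps IH U_add[OF U_theta IH(1), of i] by simp
  qed
  from this[OF finite] show ?thesis by (simp add: euler_def[abs_def])
qed

end

section \<open>Submodules and the degree decomposition\<close>

text \<open>The carrier and the ring shrink at once, since M^a is stable only under the centralizer.
  Additive inverses come from \<open>scal (-1)\<close>, which both rings contain.\<close>

lemma oper_module_restrict:
  assumes "oper_module U M" and U': "U' = weyl \<or> U' = weylE" "carrier U' \<subseteq> carrier U"
    and H: "H \<subseteq> carrier M" "\<zero>\<^bsub>M\<^esub> \<in> H"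
    and add: "\<And>x y. x \<in> H \<Longrightarrow> y \<in> H \<Longrightarrow> x \<oplus>\<^bsub>M\<^esub> y \<in> H"
    and act: "\<And>X x. X \<in> carrier U' \<Longrightarrow> x \<in> H \<Longrightarrow> X \<odot>\<^bsub>M\<^esub> x \<in> H"
  shows "oper_module U' (M\<lparr>carrier := H\<rparr>)"
proof -
  interpret M: oper_module U M by fact
  interpret U': ring U' using U'(1) ring_weyl ring_weylE by auto
  have simps: "X \<otimes>\<^bsub>U'\<^esub> Y = X \<circ> Y" "\<one>\<^bsub>U'\<^esub> = id" "\<zero>\<^bsub>U'\<^esub> = (\<lambda>p. 0)" "X \<oplus>\<^bsub>U'\<^esub> Y = (\<lambda>p. X p + Y p)" for X Y
    using U'(1) by (auto simp: weyl_def weylE_def)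
  have scal: "scal (-1) \<in> carrier U'"
    using U'(1) homog_scal[OF euler_in_weyl] by (auto simp: weyl_carrier weylE_carrier weyl_set.scal)
  have sub: "x \<in> carrier M" if "x \<in> H" for x using H that by blast
  have subU: "X \<in> carrier U" if "X \<in> carrier U'" for X using U' that by blast
  have "abelian_group (M\<lparr>carrier := H\<rparr>)"
  proof (rule abelian_groupI)
    fix x assume x: "x \<in> carrier (M\<lparr>carrier := H\<rparr>)"
    then have xM: "x \<in> carrier M" "scal (-1) \<odot>\<^bsub>M\<^esub> x \<in> H" using sub act[OF scal] by auto
    have "scal (-1) \<odot>\<^bsub>M\<^esub> x \<oplus>\<^bsub>M\<^esub> x = \<zero>\<^bsub>M\<^esub>"
      using M.act_neg[OF xM(1)] M.M.a_comm[OF xM(1) sub[OF xM(2)]] by simp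
    then show "\<exists>y\<in>carrier (M\<lparr>carrier := H\<rparr>). y \<oplus>\<^bsub>M\<lparr>carrier := H\<rparr>\<^esub> x = \<zero>\<^bsub>M\<lparr>carrier := H\<rparr>\<^esub>"
      using xM by auto
  qed (use add H(2) sub in \<open>auto simp: M.M.a_assoc intro: M.M.a_comm\<close>)
  then interpret abelian_group "M\<lparr>carrier := H\<rparr>" .
  show ?thesis
  proof (unfold_locales)
  qed (use act sub subU U' in \<open>auto simp: simps M.act_add M.act_comp M.act_id M.smult_r_distr\<close>)
qed

lemma gen_eig_restrict: "H \<subseteq> carrier M \<Longrightarrow> m \<in> gen_eig (M\<lparr>carrier := H\<rparr>) A S \<longleftrightarrow> m \<in> H \<and> m \<in> gen_eig M A S"
  by (auto simp: gen_eig_def)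

definition degree_part :: "complex \<Rightarrow> ('n::finite oper, 'u) module \<Rightarrow> ('n oper, 'u) module" where
  "degree_part a M = M\<lparr>carrier := gen_eig M euler {a}\<rparr>"

lemma degree_part_simps [simp]:
  "carrier (degree_part a M) = gen_eig M euler {a}"
  "\<zero>\<^bsub>degree_part a M\<^esub> = \<zero>\<^bsub>M\<^esub>"
  "x \<oplus>\<^bsub>degree_part a M\<^esub> y = x \<oplus>\<^bsub>M\<^esub> y"
  "X \<odot>\<^bsub>degree_part a M\<^esub> x = X \<odot>\<^bsub>M\<^esub> x"
  by (simp_all add: degree_part_def)

lemma gen_eig_degree_part:
  "m \<in> gen_eig (degree_part a M) A S \<longleftrightarrow> m \<in> gen_eig M euler {a} \<and> m \<in> gen_eig M A S"
  unfolding degree_part_def by (rule gen_eig_restrict) (auto simp: gen_eig_def)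

lemma oper_module_degree_part:
  fixes M :: "('n::finite oper, 'u) module"
  assumes "oper_module weyl M"
  shows "oper_module weylE (degree_part a M)"
proof -
  interpret oper_module weyl M by fact
  show ?thesis
    unfolding degree_part_def
  proof (rule oper_module_restrict[OF assms])
    fix X :: "'n oper" and x assume "X \<in> carrier weylE" "x \<in> gen_eig M euler {a}"
    then show "X \<odot>\<^bsub>M\<^esub> x \<in> gen_eig M euler {a}"
      by (intro gen_eig_act_0 U_euler) (auto simp: weylE_carrier weyl_carrier)
  qed (auto simp: weylE_carrier weyl_carrier dest: gen_eig_carrier intro: gen_eig_zero U_euler gen_eig_add)
qed

text \<open>What the comparison of M with M^a uses, for one good coordinate \<open>i\<close>. The
  eigenvalues 0 and -1, which \<open>S\<close> excludes, are those at which t_i d_i and d_i t_i fail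
  to be invertible.\<close>

locale nonintegral_module = oper_module weyl M for M :: "('n::finite oper, 'u) module" +
  fixes i :: 'n and S :: "complex set" and a :: complex
  assumes theta_gen_eig: "\<And>m. m \<in> carrier M \<Longrightarrow> m \<in> gen_eig M (theta i) S"
    and S_nonint: "S \<inter> \<int> = {}"
    and euler_gen_eig: "\<And>m. m \<in> carrier M \<Longrightarrow> m \<in> gen_eig M euler ((+) a ` \<int>)"
begin

lemma weyl_carrier_simps [simp]:
  "mult_var j \<in> carrier weyl" "partial_deriv j \<in> carrier weyl" "theta j \<in> carrier weyl"
  "euler \<in> (carrier weyl :: 'n oper set)" "scal c \<in> carrier weyl" "id \<in> carrier weyl"
  by (simp_all add: weyl_carrier weyl_set.intros theta_in_weyl euler_in_weyl id_in_weyl)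

lemma act_theta: "m \<in> carrier M \<Longrightarrow> theta j \<odot>\<^bsub>M\<^esub> m = mult_var j \<odot>\<^bsub>M\<^esub> (partial_deriv j \<odot>\<^bsub>M\<^esub> m)"
  unfolding theta_def by (rule act_comp) simp_all

text \<open>The relation d_i t_i = t_i d_i + 1 makes d_i t_i the shift by -1. The spellings
  \<open>-0\<close> and \<open>-(- 1)\<close> match the shape \<open>[:-z, 1:]\<close> in
  \<open>gen_eig_shift_inverse\<close>.\<close>

lemma opoly_theta: "opoly (theta j) [:-0, 1:] = theta j" "opoly (theta j) [:-(- 1), 1:] = partial_deriv j \<circ> mult_var j"
  by (simp_all only: opoly_shift[OF theta_in_weyl]) (simp_all add: fun_eq_iff partial_deriv_mult_var scal_minus)

lemma nonint: "0 \<notin> S" "- 1 \<notin> S"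
  using S_nonint by auto

text \<open>The inverse of t_i d_i that Bezout supplies is a polynomial in \<open>theta i\<close>;
  it commutes with \<open>euler\<close> and therefore preserves degrees.\<close>

lemma theta_surj:
  assumes m: "m \<in> gen_eig M euler {c}"
  obtains x where "x \<in> gen_eig M euler {c}" "m = mult_var i \<odot>\<^bsub>M\<^esub> (partial_deriv i \<odot>\<^bsub>M\<^esub> x)"
proof -
  have mc: "m \<in> carrier M" using m gen_eig_carrier by blast
  obtain q where q: "m = opoly (theta i) [:-0, 1:] \<odot>\<^bsub>M\<^esub> (opoly (theta i) q \<odot>\<^bsub>M\<^esub> m)"
    using gen_eig_shift_inverse[OF U_theta theta_gen_eig[OF mc] nonint(1)] .
  have "opoly (theta i) q \<odot>\<^bsub>M\<^esub> m \<in> gen_eig M euler {c}"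
    by (intro gen_eig_act_0 U_opoly homog_0_opoly euler_theta_commute m U_theta U_euler)
  then show ?thesis
    using q that mc by (simp add: opoly_theta(1)[simplified] act_theta U_opoly)
qed

lemma theta_1_surj:
  assumes m: "m \<in> gen_eig M euler {c}"
  obtains x where "x \<in> gen_eig M euler {c}" "m = partial_deriv i \<odot>\<^bsub>M\<^esub> (mult_var i \<odot>\<^bsub>M\<^esub> x)"
proof -
  have mc: "m \<in> carrier M" using m gen_eig_carrier by blast
  obtain q where q: "m = opoly (theta i) [:-(-1), 1:] \<odot>\<^bsub>M\<^esub> (opoly (theta i) q \<odot>\<^bsub>M\<^esub> m)"
    using gen_eig_shift_inverse[OF U_theta theta_gen_eig[OF mc] nonint(2)] .
  have "opoly (theta i) q \<odot>\<^bsub>M\<^esub> m \<in> gen_eig M euler {c}"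
    by (intro gen_eig_act_0 U_opoly homog_0_opoly euler_theta_commute m U_theta U_euler)
  then show ?thesis
    using q that mc by (simp only: opoly_theta(2) act_comp U_opoly U_theta act_closed weyl_carrier_simps)
qed

text \<open>A vector killed by t_i is killed by d_i t_i, which is \<open>theta i\<close> plus 1, so
  it has the excluded eigenvalue -1.\<close>

lemma mult_var_inj:
  assumes m: "m \<in> carrier M" and 0: "mult_var i \<odot>\<^bsub>M\<^esub> m = \<zero>\<^bsub>M\<^esub>"
  shows "m = \<zero>\<^bsub>M\<^esub>"
proof -
  have "opoly (theta i) [:-(-1), 1:] \<odot>\<^bsub>M\<^esub> m = \<zero>\<^bsub>M\<^esub>"
    using m 0 by (simp only: opoly_theta(2) act_comp weyl_carrier_simps act_0)
  then have "m \<in> gen_eig M (theta i) {-1}"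
    using m by (intro gen_eigI[of _ "[:-(-1), 1:]"]) (auto simp: add_eq_0_iff)
  then show ?thesis
    using gen_eig_disjoint[OF U_theta _ theta_gen_eig[OF m]] nonint by blast
qed

lemma partial_deriv_inj:
  assumes m: "m \<in> carrier M" and 0: "partial_deriv i \<odot>\<^bsub>M\<^esub> m = \<zero>\<^bsub>M\<^esub>"
  shows "m = \<zero>\<^bsub>M\<^esub>"
proof -
  have "opoly (theta i) [:-0, 1:] \<odot>\<^bsub>M\<^esub> m = \<zero>\<^bsub>M\<^esub>"
    using m 0 by (simp only: opoly_theta(1) act_theta act_0 weyl_carrier_simps)
  then have "m \<in> gen_eig M (theta i) {0}"
    using m by (intro gen_eigI[of _ "[:-0, 1:]"]) auto
  then show ?thesis
    using gen_eig_disjoint[OF U_theta _ theta_gen_eig[OF m]] nonint by blast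
qed

lemma mult_var_degree:
  "m \<in> gen_eig M euler {c} \<Longrightarrow> mult_var j \<odot>\<^bsub>M\<^esub> m \<in> gen_eig M euler {c + 1}"
  using gen_eig_act[OF U_euler _ homog_euler_mult_var, of j m "{c}"] by (simp add: add.commute)

lemma partial_deriv_degree:
  "m \<in> gen_eig M euler {c} \<Longrightarrow> partial_deriv j \<odot>\<^bsub>M\<^esub> m \<in> gen_eig M euler {c - 1}"
  using gen_eig_act[OF U_euler _ homog_euler_partial_deriv, of j m "{c}"] by (simp add: add.commute)

text \<open>A vector of degree a + k + 1 has the form t_i d_i x, hence is t_i applied to the vector
  d_i x of degree a + k; downwards the roles swap. So \<open>X\<close> is a power of t_i or of d_i,
  the same for the whole eigenspace, which later bounds the cardinality.\<close>

lemma degree_image: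
  assumes "k \<in> \<int>"
  obtains X where "X \<in> weyl_set"
    "gen_eig M euler {a + k} \<subseteq> (\<lambda>m. X \<odot>\<^bsub>M\<^esub> m) ` gen_eig M euler {a}"
proof -
  let ?P = "\<lambda>X k. X \<in> weyl_set \<and> gen_eig M euler {a + k} \<subseteq> (\<lambda>m. X \<odot>\<^bsub>M\<^esub> m) ` gen_eig M euler {a}"
  have id: "?P id 0"
    by (auto simp: id_in_weyl act_id gen_eig_carrier intro: rev_image_eqI)
  have up: "?P (mult_var i \<circ> X) (k + 1)" if "?P X k" for X k
  proof (intro conjI subsetI)
    fix m assume "m \<in> gen_eig M euler {a + (k + 1)}"
    then obtain x where x: "x \<in> gen_eig M euler {a + (k + 1)}" "m = mult_var i \<odot>\<^bsub>M\<^esub> (partial_deriv i \<odot>\<^bsub>M\<^esub> x)"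
      by (rule theta_surj)
    then have "partial_deriv i \<odot>\<^bsub>M\<^esub> x \<in> gen_eig M euler {a + k}"
      using partial_deriv_degree[OF x(1), of i] by (simp add: algebra_simps)
    then obtain y where "y \<in> gen_eig M euler {a}" "partial_deriv i \<odot>\<^bsub>M\<^esub> x = X \<odot>\<^bsub>M\<^esub> y"
      using \<open>?P X k\<close> by auto
    then show "m \<in> (\<lambda>m. (mult_var i \<circ> X) \<odot>\<^bsub>M\<^esub> m) ` gen_eig M euler {a}"
      using x that by (intro image_eqI[of _ _ y]) (simp_all add: act_comp weyl_carrier gen_eig_carrier weyl_set.var)
  qed (use that in \<open>simp add: weyl_set.intros\<close>)
  have down: "?P (partial_deriv i \<circ> X) (k - 1)" if "?P X k" for X k
  proof (intro conjI subsetI)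
    fix m assume "m \<in> gen_eig M euler {a + (k - 1)}"
    then obtain x where x: "x \<in> gen_eig M euler {a + (k - 1)}" "m = partial_deriv i \<odot>\<^bsub>M\<^esub> (mult_var i \<odot>\<^bsub>M\<^esub> x)"
      by (rule theta_1_surj)
    then have "mult_var i \<odot>\<^bsub>M\<^esub> x \<in> gen_eig M euler {a + k}"
      using mult_var_degree[OF x(1), of i] by (simp add: algebra_simps)
    then obtain y where "y \<in> gen_eig M euler {a}" "mult_var i \<odot>\<^bsub>M\<^esub> x = X \<odot>\<^bsub>M\<^esub> y"
      using \<open>?P X k\<close> by auto
    then show "m \<in> (\<lambda>m. (partial_deriv i \<circ> X) \<odot>\<^bsub>M\<^esub> m) ` gen_eig M euler {a}"
      using x that by (intro image_eqI[of _ _ y]) (simp_all add: act_comp weyl_carrier gen_eig_carrier weyl_set.deriv)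
  qed (use that in \<open>simp add: weyl_set.intros\<close>)
  have "\<exists>X. ?P X (of_int k)" for k :: int
  proof (induction k rule: int_induct[where k = 0])
    case base
    show ?case by (rule exI[of _ id]) (use id in \<open>simp only: of_int_0 simp_thms\<close>)
  next
    case (step1 k)
    then obtain X where "?P X (of_int k)" by blast
    from up[OF this] show ?case by (intro exI[of _ "mult_var i \<circ> X"]) (simp only: of_int_add of_int_diff of_int_1 simp_thms)
  next
    case (step2 k)
    then obtain X where "?P X (of_int k)" by blast
    from down[OF this] show ?case by (intro exI[of _ "partial_deriv i \<circ> X"]) (simp only: of_int_add of_int_diff of_int_1 simp_thms)
  qed
  then show ?thesis using assms that by (metis Ints_cases)
qed

lemma euler_decomposition:
  assumes H: "\<And>X x. X \<in> weyl_set \<Longrightarrow> x \<in> H \<Longrightarrow> X \<odot>\<^bsub>M\<^esub> x \<in> H" "H \<subseteq> carrier M" and m: "m \<in> H"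
  shows "m \<in> addspan M (\<Union>k\<in>\<int>. H \<inter> gen_eig M euler {a + k})"
proof -
  have "m \<in> addspan M (\<Union>c\<in>(+) a ` \<int>. H \<inter> gen_eig M euler {c})"
    using H m by (intro primary_decomposition U_euler euler_gen_eig)
      (auto simp: opoly_in_weyl euler_in_weyl)
  then show ?thesis by simp
qed

text \<open>One operator for each integer degree suffices to reach all of M from M^a. This gives
  generation by M^a and also the size estimate behind essential surjectivity.\<close>

lemma addspan_degree_part:
  obtains x :: "int \<Rightarrow> 'u \<Rightarrow> 'u" where "carrier M \<subseteq> addspan M (\<Union>k. x k ` gen_eig M euler {a})"
    "\<And>k. \<exists>X\<in>weyl_set. x k = (\<lambda>m. X \<odot>\<^bsub>M\<^esub> m)"
proof -
  have "\<exists>X. X \<in> weyl_set \<and> gen_eig M euler {a + of_int k} \<subseteq> (\<lambda>m. X \<odot>\<^bsub>M\<^esub> m) ` gen_eig M euler {a}" for k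
    using degree_image[of "of_int k"] by (metis Ints_of_int)
  then obtain X where X: "\<And>k. X k \<in> weyl_set"
    "\<And>k. gen_eig M euler {a + of_int k} \<subseteq> (\<lambda>m. X k \<odot>\<^bsub>M\<^esub> m) ` gen_eig M euler {a}"
    by metis
  let ?B = "\<Union>k. (\<lambda>m. X k \<odot>\<^bsub>M\<^esub> m) ` gen_eig M euler {a}"
  have B: "?B \<subseteq> carrier M"
    using X(1) by (auto simp: weyl_carrier gen_eig_carrier)
  have "(\<Union>k\<in>\<int>. carrier M \<inter> gen_eig M euler {a + k}) \<subseteq> ?B"
    using X(2) by (fastforce elim: Ints_cases)
  then have sub: "(\<Union>k\<in>\<int>. carrier M \<inter> gen_eig M euler {a + k}) \<subseteq> addspan M ?B"
    using addspan_base[OF B] by blast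
  have "carrier M \<subseteq> addspan M ?B"
  proof
    fix m assume "m \<in> carrier M"
    then have "m \<in> addspan M (\<Union>k\<in>\<int>. carrier M \<inter> gen_eig M euler {a + k})"
      by (intro euler_decomposition) (auto simp: weyl_carrier)
    then show "m \<in> addspan M ?B" by (rule addspan_trans[OF B sub])
  qed
  then show ?thesis using X(1) by (intro that[of "\<lambda>k m. X k \<odot>\<^bsub>M\<^esub> m"]) auto
qed

lemma degree_part_generates:
  assumes H: "\<zero>\<^bsub>M\<^esub> \<in> H" "\<And>x y. x \<in> H \<Longrightarrow> y \<in> H \<Longrightarrow> x \<oplus>\<^bsub>M\<^esub> y \<in> H"
    and act: "\<And>X x. X \<in> weyl_set \<Longrightarrow> x \<in> H \<Longrightarrow> X \<odot>\<^bsub>M\<^esub> x \<in> H"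
    and sub: "gen_eig M euler {a} \<subseteq> H" and m: "m \<in> carrier M"
  shows "m \<in> H"
proof -
  obtain x where x: "carrier M \<subseteq> addspan M (\<Union>k::int. x k ` gen_eig M euler {a})"
    "\<And>k. \<exists>X\<in>weyl_set. x k = (\<lambda>m. X \<odot>\<^bsub>M\<^esub> m)"
    using addspan_degree_part by blast
  have "(\<Union>k. x k ` gen_eig M euler {a}) \<subseteq> H"
  proof safe
    fix k y assume "y \<in> gen_eig M euler {a}"
    then show "x k y \<in> H" using x(2)[of k] act sub by auto
  qed
  moreover have "m \<in> addspan M (\<Union>k. x k ` gen_eig M euler {a})" using x m by blast
  then have "(\<Union>k. x k ` gen_eig M euler {a}) \<subseteq> H \<longrightarrow> m \<in> H"
    by (induction rule: addspan.induct) (use H in blast)+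
  ultimately show ?thesis by blast
qed

text \<open>Injectivity of d_i and t_i carries vanishing from degree \<open>a\<close>, upwards and
  downwards, to the part of \<open>H\<close> in every degree a + k. Elements of \<open>H\<close> are
  sums of such parts by \<open>euler_decomposition\<close>.\<close>

lemma degree_part_essential:
  assumes H: "H \<subseteq> carrier M" and act: "\<And>X x. X \<in> weyl_set \<Longrightarrow> x \<in> H \<Longrightarrow> X \<odot>\<^bsub>M\<^esub> x \<in> H"
    and deg: "\<And>x. x \<in> H \<Longrightarrow> x \<in> gen_eig M euler {a} \<Longrightarrow> x = \<zero>\<^bsub>M\<^esub>" and m: "m \<in> H"
  shows "m = \<zero>\<^bsub>M\<^esub>"
proof -
  have zero: "\<forall>x \<in> H \<inter> gen_eig M euler {a + of_int k}. x = \<zero>\<^bsub>M\<^esub>" for k :: int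
  proof (induction k rule: int_induct[where k = 0])
    case base
    then show ?case using deg by simp
  next
    case (step1 k)
    show ?case
    proof
      fix x assume x: "x \<in> H \<inter> gen_eig M euler {a + of_int (k + 1)}"
      then have "partial_deriv i \<odot>\<^bsub>M\<^esub> x \<in> gen_eig M euler {a + of_int (k + 1) - 1}"
        by (intro partial_deriv_degree) simp
      then have "partial_deriv i \<odot>\<^bsub>M\<^esub> x \<in> H \<inter> gen_eig M euler {a + of_int k}"
        using x act by (simp add: weyl_set.deriv)
      then show "x = \<zero>\<^bsub>M\<^esub>"
        using step1 partial_deriv_inj x gen_eig_carrier by blast
    qed
  next
    case (step2 k)
    show ?case
    proof
      fix x assume x: "x \<in> H \<inter> gen_eig M euler {a + of_int (k - 1)}"
      then have "mult_var i \<odot>\<^bsub>M\<^esub> x \<in> gen_eig M euler {a + of_int (k - 1) + 1}"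
        by (intro mult_var_degree) simp
      then have "mult_var i \<odot>\<^bsub>M\<^esub> x \<in> H \<inter> gen_eig M euler {a + of_int k}"
        using x act by (simp add: weyl_set.var)
      then show "x = \<zero>\<^bsub>M\<^esub>"
        using step2 mult_var_inj x gen_eig_carrier by blast
    qed
  qed
  have "(\<Union>k\<in>\<int>. H \<inter> gen_eig M euler {a + k}) \<subseteq> {\<zero>\<^bsub>M\<^esub>}"
    using zero by (auto elim!: Ints_cases)
  moreover have "m \<in> addspan M (\<Union>k\<in>\<int>. H \<inter> gen_eig M euler {a + k})"
    using euler_decomposition[of H m] act H m by blast
  then have "(\<Union>k\<in>\<int>. H \<inter> gen_eig M euler {a + k}) \<subseteq> {\<zero>\<^bsub>M\<^esub>} \<longrightarrow> m = \<zero>\<^bsub>M\<^esub>"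
    by (induction rule: addspan.induct) auto
  ultimately show ?thesis by blast
qed

end

section \<open>The grading of the Weyl algebra\<close>

text \<open>Two cases matter: \<open>UNIV\<close>, which yields all of D, and \<open>- {0}\<close>,
  the complement of the centralizer.\<close>

inductive_set homog_span :: "complex set \<Rightarrow> 'n::finite oper set" for S where
  zero: "(\<lambda>p. 0) \<in> homog_span S"
| add: "X \<in> weyl_set \<Longrightarrow> homog euler d X \<Longrightarrow> d \<in> S \<Longrightarrow> Y \<in> homog_span S \<Longrightarrow>
    (\<lambda>p. X p + Y p) \<in> homog_span S"

lemma homog_span_weyl: "X \<in> homog_span S \<Longrightarrow> X \<in> weyl_set"
  by (induction rule: homog_span.induct) (simp_all add: zero_in_weyl weyl_set.add)

lemma homog_span_base: "X \<in> weyl_set \<Longrightarrow> homog euler d X \<Longrightarrow> d \<in> S \<Longrightarrow> X \<in> homog_span S"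
  using homog_span.add[OF _ _ _ homog_span.zero, of X d S] by simp

lemma homog_span_add:
  assumes "X \<in> homog_span S" "Y \<in> homog_span S"
  shows "(\<lambda>p. X p + Y p) \<in> homog_span S"
  using assms(1)
proof (induction rule: homog_span.induct)
  case (add X d Z)
  then show ?case using homog_span.add[of X d S "\<lambda>p. Z p + Y p"] by (simp add: add.assoc)
qed (use assms in simp)

lemma homog_span_comp:
  assumes "X \<in> homog_span UNIV" "Y \<in> homog_span UNIV"
  shows "X \<circ> Y \<in> homog_span UNIV"
  using assms(1)
proof (induction rule: homog_span.induct)
  case zero
  then show ?case by (simp add: comp_def homog_span.zero)
next
  case (add X d Z)
  have "X \<circ> Y \<in> homog_span UNIV"
    using assms(2)
  proof (induction rule: homog_span.induct)
    case zero
    then show ?case using add.hyps by (simp add: comp_def homog_span.zero weyl_set_0)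
  next
    case (add Y e W)
    have "X \<circ> Y \<in> homog_span UNIV"
      using homog_comp[OF \<open>homog euler d X\<close> add.hyps(2) \<open>X \<in> weyl_set\<close>] \<open>X \<in> weyl_set\<close> add.hyps(1)
      by (intro homog_span_base[of _ "d + e"]) (auto intro: weyl_set.comp)
    moreover have "X \<circ> (\<lambda>p. Y p + W p) = (\<lambda>p. (X \<circ> Y) p + (X \<circ> W) p)"
      using \<open>X \<in> weyl_set\<close> by (simp add: fun_eq_iff weyl_set_additive)
    ultimately show ?case by (simp only: homog_span_add add.IH)
  qed
  moreover have "(\<lambda>p. X p + Z p) \<circ> Y = (\<lambda>p. (X \<circ> Y) p + (Z \<circ> Y) p)"
    by (simp add: fun_eq_iff)
  ultimately show ?case by (simp only: homog_span_add add.IH)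
qed

lemma weyl_homog_span:
  assumes "X \<in> (weyl_set :: 'n::finite oper set)"
  shows "X \<in> homog_span UNIV"
  using assms
proof (induction rule: weyl_set.induct)
  case (scal c)
  then show ?case
    using homog_span_base[OF weyl_set.scal homog_scal[OF euler_in_weyl] UNIV_I] by blast
next
  case (var i)
  then show ?case
    using homog_span_base[OF weyl_set.var homog_euler_mult_var UNIV_I] by blast
next
  case (deriv i)
  then show ?case
    using homog_span_base[OF weyl_set.deriv homog_euler_partial_deriv UNIV_I] by blast
qed (rule homog_span_add homog_span_comp; assumption)+

lemma weyl_degree_zero_split:
  fixes X :: "'n::finite oper"
  assumes "X \<in> weyl_set"
  obtains Y Z where "Y \<in> carrier weylE" "Z \<in> homog_span (- {0})" "X = (\<lambda>p. Y p + Z p)"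
proof -
  interpret E: ring "weylE :: 'n oper ring" by (rule ring_weylE)
  have "\<exists>Y\<in>carrier weylE. \<exists>Z\<in>homog_span (- {0}). X = (\<lambda>p. Y p + Z p)"
    using weyl_homog_span[OF assms]
  proof (induction rule: homog_span.induct)
    case zero
    have "(\<lambda>p. 0) \<in> (carrier weylE :: 'n oper set)"
      using E.zero_closed by (simp add: weylE_def weyl_def)
    then show ?case
      by (intro bexI[of _ "\<lambda>p. 0"] homog_span.zero) simp
  next
    case (add X d W)
    then obtain Y Z where YZ: "Y \<in> carrier weylE" "Z \<in> homog_span (- {0})" "W = (\<lambda>p. Y p + Z p)"
      by blast
    show ?case
    proof (cases "d = 0")
      case True
      then have "X \<in> carrier weylE" using add.hyps by (simp add: weylE_carrier)
      then have "(\<lambda>p. X p + Y p) \<in> carrier weylE"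
        using E.a_closed[OF _ YZ(1), of X] by (simp add: weylE_def weyl_def)
      then show ?thesis
        using YZ by (intro bexI[of _ "\<lambda>p. X p + Y p"] bexI[of _ Z]) (simp_all add: add.assoc)
    next
      case False
      then have "(\<lambda>p. X p + Z p) \<in> homog_span (- {0})"
        using add.hyps YZ by (intro homog_span.add) auto
      then show ?thesis
        using YZ by (intro bexI[of _ Y] bexI[of _ "\<lambda>p. X p + Z p"]) (simp_all add: fun_eq_iff algebra_simps)
    qed
  qed
  then show ?thesis using that by blast
qed

text \<open>A summand of degree d sends degree a to a + d, which differs from a.\<close>

lemma (in oper_module) homog_span_act:
  assumes U: "U = weyl" and Z: "Z \<in> homog_span (- {0})" and m: "m \<in> gen_eig M euler {a}"
  shows "Z \<odot>\<^bsub>M\<^esub> m \<in> gen_eig M euler (- {a})"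
  using Z
proof (induction rule: homog_span.induct)
  case zero
  then show ?case using m by (simp add: zero_act gen_eig_carrier gen_eig_zero U_euler)
next
  case (add X d Y)
  have X: "X \<in> carrier U" "Y \<in> carrier U"
    using add.hyps homog_span_weyl by (auto simp: U weyl_carrier)
  have "X \<odot>\<^bsub>M\<^esub> m \<in> gen_eig M euler {d + a}"
    using gen_eig_act[OF U_euler X(1) add.hyps(2) m] by simp
  then have "X \<odot>\<^bsub>M\<^esub> m \<in> gen_eig M euler (- {a})"
    by (rule gen_eig_mono) (use add.hyps in auto)
  then show ?case
    using add.IH X m by (simp add: act_add gen_eig_carrier gen_eig_add U_euler)
qed

section \<open>Homomorphisms\<close>

lemma left_module_homD:
  assumes "f \<in> left_module_hom R M N"
  shows "x \<in> carrier M \<Longrightarrow> f x \<in> carrier N"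
    "x \<in> carrier M \<Longrightarrow> y \<in> carrier M \<Longrightarrow> f (x \<oplus>\<^bsub>M\<^esub> y) = f x \<oplus>\<^bsub>N\<^esub> f y"
    "X \<in> carrier R \<Longrightarrow> x \<in> carrier M \<Longrightarrow> f (X \<odot>\<^bsub>M\<^esub> x) = X \<odot>\<^bsub>N\<^esub> f x"
    "f \<in> extensional (carrier M)"
  using assms by (auto simp: left_module_hom_def PiE_def)

lemma left_module_hom_zero:
  assumes "oper_module U M" "oper_module U N" "f \<in> left_module_hom U M N"
  shows "f \<zero>\<^bsub>M\<^esub> = \<zero>\<^bsub>N\<^esub>"
proof -
  interpret M: oper_module U M by fact
  interpret N: oper_module U N by fact
  have "f ((\<lambda>p. 0) \<odot>\<^bsub>M\<^esub> \<zero>\<^bsub>M\<^esub>) = (\<lambda>p. 0) \<odot>\<^bsub>N\<^esub> f \<zero>\<^bsub>M\<^esub>"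
    by (rule left_module_homD[OF assms(3)]) (simp_all add: M.U_zero)
  then show ?thesis
    by (simp add: M.zero_act N.zero_act left_module_homD[OF assms(3)])
qed

lemma left_module_hom_gen_eig:
  assumes "oper_module U M" "oper_module U N" "f \<in> left_module_hom U M N"
    and A: "A \<in> carrier U" and m: "m \<in> gen_eig M A S"
  shows "f m \<in> gen_eig N A S"
proof -
  interpret M: oper_module U M by fact
  interpret N: oper_module U N by fact
  obtain p where p: "m \<in> carrier M" "p \<noteq> 0" "\<And>z. poly p z = 0 \<Longrightarrow> z \<in> S" "opoly A p \<odot>\<^bsub>M\<^esub> m = \<zero>\<^bsub>M\<^esub>"
    using M.gen_eigE[OF m] by metis
  have "opoly A p \<odot>\<^bsub>N\<^esub> f m = \<zero>\<^bsub>N\<^esub>"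
    using left_module_homD(3)[OF assms(3) M.U_opoly[OF A] p(1), of p] p(4) left_module_hom_zero[OF assms(1-3)]
    by simp
  then show ?thesis
    using p left_module_homD(1)[OF assms(3)] by (intro N.gen_eigI[of _ p]) auto
qed

lemma (in oper_module) add_eq_zero:
  assumes "x \<in> carrier M" "y \<in> carrier M" "x \<oplus>\<^bsub>M\<^esub> y = \<zero>\<^bsub>M\<^esub>"
  shows "x = scal (- 1) \<odot>\<^bsub>M\<^esub> y"
proof -
  have "scal (- 1) \<odot>\<^bsub>M\<^esub> y \<in> carrier M" using assms U_scal by simp
  moreover have "scal (- 1) \<odot>\<^bsub>M\<^esub> y \<oplus>\<^bsub>M\<^esub> y = \<zero>\<^bsub>M\<^esub>"
    using act_neg[OF assms(2)] M.a_comm assms calculation by simp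
  ultimately show ?thesis using assms M.minus_equality by metis
qed

text \<open>The set where \<open>f\<close> and \<open>g\<close> agree is a submodule containing M^a,
  and M^a generates.\<close>

lemma degree_part_faithful:
  assumes "nonintegral_module M i S a" "oper_module weyl N"
    and f: "f \<in> left_module_hom weyl M N" and g: "g \<in> left_module_hom weyl M N"
    and eq: "\<And>x. x \<in> gen_eig M euler {a} \<Longrightarrow> f x = g x"
  shows "f = g"
proof (rule extensionalityI)
  interpret M: nonintegral_module M i S a by fact
  interpret N: oper_module weyl N by fact
  fix x assume x: "x \<in> carrier M"
  have "x \<in> {x \<in> carrier M. f x = g x}"
  proof (rule M.degree_part_generates[OF _ _ _ _ x])
    show "\<zero>\<^bsub>M\<^esub> \<in> {x \<in> carrier M. f x = g x}"
      using left_module_hom_zero[OF M.oper_module_axioms N.oper_module_axioms f]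
        left_module_hom_zero[OF M.oper_module_axioms N.oper_module_axioms g] by simp
  qed (use f g eq in \<open>auto simp: left_module_homD weyl_carrier M.gen_eig_carrier\<close>)
  then show "f x = g x" by simp
qed (use f g left_module_homD(4) in blast)+

text \<open>The submodule of M x N generated by the graph of \<open>g\<close> on \<open>B\<close>,
  as a relation; its induction rule replaces the construction of a product module.\<close>

inductive_set hom_graph :: "('n::finite oper, 'u) module \<Rightarrow> ('n oper, 'v) module \<Rightarrow> 'u set \<Rightarrow> ('u \<Rightarrow> 'v) \<Rightarrow> ('u \<times> 'v) set"
  for M N B g where
  base: "m \<in> B \<Longrightarrow> (m, g m) \<in> hom_graph M N B g"
| add: "(x, y) \<in> hom_graph M N B g \<Longrightarrow> (x', y') \<in> hom_graph M N B g \<Longrightarrow>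
    (x \<oplus>\<^bsub>M\<^esub> x', y \<oplus>\<^bsub>N\<^esub> y') \<in> hom_graph M N B g"
| act: "X \<in> weyl_set \<Longrightarrow> (x, y) \<in> hom_graph M N B g \<Longrightarrow>
    (X \<odot>\<^bsub>M\<^esub> x, X \<odot>\<^bsub>N\<^esub> y) \<in> hom_graph M N B g"

text \<open>The generated relation has a value over each element because M^a generates M. It is
  single-valued because the values over zero form a submodule of N that meets N^a only in zero, and
  N^a is essential.\<close>

lemma degree_part_full:
  fixes M :: "('n::finite oper, 'u) module" and N :: "('n oper, 'v) module"
  assumes "nonintegral_module M i S a" "nonintegral_module N i S a"
    and g: "g \<in> left_module_hom weylE (degree_part a M) (degree_part a N)"
  shows "\<exists>f\<in>left_module_hom weyl M N. restrict f (gen_eig M euler {a}) = g"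
proof -
  interpret M: nonintegral_module M i S a by fact
  interpret N: nonintegral_module N i S a by fact
  define R where "R = hom_graph M N (gen_eig M euler {a}) g"
  note R_intros = hom_graph.intros[where M = M and N = N and B = "gen_eig M euler {a}" and g = g, folded R_def]
  note g_simps = left_module_homD[OF g, simplified]
  have g0: "g \<zero>\<^bsub>M\<^esub> = \<zero>\<^bsub>N\<^esub>"
    using left_module_hom_zero[OF oper_module_degree_part oper_module_degree_part g]
      M.oper_module_axioms N.oper_module_axioms by simp
  txt \<open>Compatibility of the degree \<open>a\<close> components with \<open>g\<close> is preserved by the module operations only
    when it is demanded after applying every operator.\<close>
  define Q where "Q x y \<longleftrightarrow> (\<exists>m0\<in>gen_eig M euler {a}. \<exists>x2\<in>gen_eig M euler (- {a}). \<exists>y2\<in>gen_eig N euler (- {a}).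
      x = m0 \<oplus>\<^bsub>M\<^esub> x2 \<and> y = g m0 \<oplus>\<^bsub>N\<^esub> y2)" for x y
  \<comment> \<open>Split \<open>X\<close> into its degree zero part \<open>Y\<close> and the rest
    \<open>Z\<close>: \<open>Y\<close> stays in degree \<open>a\<close> and commutes with
    \<open>g\<close>, whereas \<open>Z\<close> leads out of degree \<open>a\<close> in both
    modules.\<close>
  have Q_base: "Q (X \<odot>\<^bsub>M\<^esub> m) (X \<odot>\<^bsub>N\<^esub> g m)" if X: "X \<in> weyl_set" and m: "m \<in> gen_eig M euler {a}" for X m
  proof -
    obtain Y Z where YZ: "Y \<in> carrier weylE" "Z \<in> homog_span (- {0})" "X = (\<lambda>p. Y p + Z p)"
      using weyl_degree_zero_split[OF X] .
    have W: "Y \<in> carrier weyl" "Z \<in> carrier weyl"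
      using YZ homog_span_weyl by (auto simp: weyl_carrier weylE_carrier)
    have "Y \<odot>\<^bsub>M\<^esub> m \<in> gen_eig M euler {a}"
      using YZ(1) W m by (intro M.gen_eig_act_0) (auto simp: weylE_carrier)
    moreover have "g (Y \<odot>\<^bsub>M\<^esub> m) = Y \<odot>\<^bsub>N\<^esub> g m"
      using g_simps(3)[OF YZ(1) m] .
    ultimately show ?thesis
      unfolding Q_def YZ(3) using m W M.homog_span_act[OF refl YZ(2) m] N.homog_span_act[OF refl YZ(2) g_simps(1)[OF m]]
      by (intro bexI[of _ "Y \<odot>\<^bsub>M\<^esub> m"] bexI[of _ "Z \<odot>\<^bsub>M\<^esub> m"] bexI[of _ "Z \<odot>\<^bsub>N\<^esub> g m"])
        (simp_all add: M.act_add N.act_add M.gen_eig_carrier N.gen_eig_carrier[OF g_simps(1)])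
  qed
  have Q_add: "Q (x \<oplus>\<^bsub>M\<^esub> x') (y \<oplus>\<^bsub>N\<^esub> y')" if Q: "Q x y" "Q x' y'" for x y x' y'
  proof -
    obtain m x2 y2 where 1: "m \<in> gen_eig M euler {a}" "x2 \<in> gen_eig M euler (- {a})"
      "y2 \<in> gen_eig N euler (- {a})" "x = m \<oplus>\<^bsub>M\<^esub> x2" "y = g m \<oplus>\<^bsub>N\<^esub> y2"
      using Q(1) unfolding Q_def by blast
    obtain m' x2' y2' where 2: "m' \<in> gen_eig M euler {a}" "x2' \<in> gen_eig M euler (- {a})"
      "y2' \<in> gen_eig N euler (- {a})" "x' = m' \<oplus>\<^bsub>M\<^esub> x2'" "y' = g m' \<oplus>\<^bsub>N\<^esub> y2'"
      using Q(2) unfolding Q_def by blast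
    have c: "m \<in> carrier M" "m' \<in> carrier M" "x2 \<in> carrier M" "x2' \<in> carrier M"
      "g m \<in> carrier N" "g m' \<in> carrier N" "y2 \<in> carrier N" "y2' \<in> carrier N"
      using 1 2 g_simps(1) M.gen_eig_carrier N.gen_eig_carrier by blast+
    show ?thesis
      unfolding Q_def
    proof (intro bexI conjI)
      show "x \<oplus>\<^bsub>M\<^esub> x' = (m \<oplus>\<^bsub>M\<^esub> m') \<oplus>\<^bsub>M\<^esub> (x2 \<oplus>\<^bsub>M\<^esub> x2')"
        using c 1 2 by (simp add: M.M.a_ac)
      show "y \<oplus>\<^bsub>N\<^esub> y' = g (m \<oplus>\<^bsub>M\<^esub> m') \<oplus>\<^bsub>N\<^esub> (y2 \<oplus>\<^bsub>N\<^esub> y2')"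
        using c 1 2 by (simp add: g_simps(2) N.M.a_ac)
    qed (use 1 2 in \<open>simp_all add: M.gen_eig_add N.gen_eig_add\<close>)
  qed
  have inv: "x \<in> carrier M \<and> y \<in> carrier N \<and> (\<forall>X\<in>weyl_set. Q (X \<odot>\<^bsub>M\<^esub> x) (X \<odot>\<^bsub>N\<^esub> y))" if "(x, y) \<in> R" for x y
    using that unfolding R_def
  proof (induction rule: hom_graph.induct)
    case (base m)
    then show ?case
      using Q_base M.gen_eig_carrier N.gen_eig_carrier[OF g_simps(1)] by blast
  next
    case (add x y x' y')
    then show ?case
      by (auto simp: M.smult_r_distr N.smult_r_distr weyl_carrier intro: Q_add)
  next
    case (act X x y)
    have "Y \<odot>\<^bsub>M\<^esub> (X \<odot>\<^bsub>M\<^esub> x) = (Y \<circ> X) \<odot>\<^bsub>M\<^esub> x" "Y \<odot>\<^bsub>N\<^esub> (X \<odot>\<^bsub>N\<^esub> y) = (Y \<circ> X) \<odot>\<^bsub>N\<^esub> y"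
      if "Y \<in> weyl_set" for Y
      using that act by (simp_all add: M.act_comp N.act_comp weyl_carrier)
    then show ?case
      using act by (auto simp: weyl_carrier intro: weyl_set.comp)
  qed
  have zero: "y = \<zero>\<^bsub>N\<^esub>" if "(\<zero>\<^bsub>M\<^esub>, y) \<in> R" for y
  proof (rule N.degree_part_essential[where H = "{y. (\<zero>\<^bsub>M\<^esub>, y) \<in> R}"])
    show "{y. (\<zero>\<^bsub>M\<^esub>, y) \<in> R} \<subseteq> carrier N" using inv by blast
    show "X \<odot>\<^bsub>N\<^esub> y \<in> {y. (\<zero>\<^bsub>M\<^esub>, y) \<in> R}" if "X \<in> weyl_set" "y \<in> {y. (\<zero>\<^bsub>M\<^esub>, y) \<in> R}" for X y
      using R_intros(3)[of X "\<zero>\<^bsub>M\<^esub>" y] that by (simp add: weyl_carrier)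
    show "y \<in> {y. (\<zero>\<^bsub>M\<^esub>, y) \<in> R}" using that by simp
  next
    fix y assume y: "y \<in> {y. (\<zero>\<^bsub>M\<^esub>, y) \<in> R}" "y \<in> gen_eig N euler {a}"
    then have "Q (id \<odot>\<^bsub>M\<^esub> \<zero>\<^bsub>M\<^esub>) (id \<odot>\<^bsub>N\<^esub> y)" using inv id_in_weyl by blast
    then have "Q \<zero>\<^bsub>M\<^esub> y"
      using y inv N.act_id by simp
    then obtain m x2 y2 where 1: "m \<in> gen_eig M euler {a}" "x2 \<in> gen_eig M euler (- {a})"
      "y2 \<in> gen_eig N euler (- {a})" "\<zero>\<^bsub>M\<^esub> = m \<oplus>\<^bsub>M\<^esub> x2" "y = g m \<oplus>\<^bsub>N\<^esub> y2"
      unfolding Q_def by blast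
    \<comment> \<open>Since \<open>m\<close> and \<open>x2\<close> add up to zero, \<open>m\<close>
      has degree \<open>a\<close> and also only degrees other than \<open>a\<close>, so it vanishes.
      Then \<open>y\<close> is \<open>y2\<close>, to which the same argument applies.\<close>
    have "m = scal (- 1) \<odot>\<^bsub>M\<^esub> x2"
      using 1 M.gen_eig_carrier M.add_eq_zero[of m x2] by simp
    then have "m \<in> gen_eig M euler (- {a})"
      using 1(2) by (auto intro!: M.gen_eig_act_0 homog_scal euler_in_weyl)
    then have "m = \<zero>\<^bsub>M\<^esub>"
      using M.gen_eig_disjoint[OF M.U_euler 1(1)] by simp
    then have "y = y2"
      using 1 g0 N.gen_eig_carrier by simp
    then show "y = \<zero>\<^bsub>N\<^esub>"
      using N.gen_eig_disjoint[OF N.U_euler y(2)] 1(3) by simp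
  qed
  have unique: "y = y'" if y: "(x, y) \<in> R" "(x, y') \<in> R" for x y y'
  proof -
    have "(x \<oplus>\<^bsub>M\<^esub> scal (-1) \<odot>\<^bsub>M\<^esub> x, y \<oplus>\<^bsub>N\<^esub> scal (-1) \<odot>\<^bsub>N\<^esub> y') \<in> R"
      by (intro R_intros(2,3) y weyl_set.scal)
    then have "y \<oplus>\<^bsub>N\<^esub> scal (-1) \<odot>\<^bsub>N\<^esub> y' = \<zero>\<^bsub>N\<^esub>"
      using zero inv[OF y(1)] by (simp add: M.act_neg)
    then show ?thesis using inv[OF y(1)] inv[OF y(2)] N.eq_of_add_neg by blast
  qed
  have total: "\<exists>y. (x, y) \<in> R" if "x \<in> carrier M" for x
  proof -
    have "x \<in> {x. \<exists>y. (x, y) \<in> R}"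
    proof (rule M.degree_part_generates[OF _ _ _ _ that])
      show "\<zero>\<^bsub>M\<^esub> \<in> {x. \<exists>y. (x, y) \<in> R}"
        using R_intros(1)[of "\<zero>\<^bsub>M\<^esub>"] M.gen_eig_zero by auto
    qed (use R_intros in blast)+
    then show ?thesis by simp
  qed
  define f where "f = (\<lambda>x\<in>carrier M. THE y. (x, y) \<in> R)"
  have fR: "(x, f x) \<in> R" if x: "x \<in> carrier M" for x
  proof -
    obtain y where y: "(x, y) \<in> R" using total[OF x] by blast
    then have "(THE y. (x, y) \<in> R) = y" by (rule the_equality) (rule unique[OF _ y])
    then show ?thesis using y x by (simp add: f_def)
  qed
  have f_eq: "f x = y" if "(x, y) \<in> R" for x y
    using unique[OF fR[OF conjunct1[OF inv[OF that]]] that] .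
  have "f \<in> left_module_hom weyl M N"
    unfolding left_module_hom_def
  proof (intro CollectI conjI ballI)
    show "f \<in> carrier M \<rightarrow>\<^sub>E carrier N"
      using fR inv by (auto simp: f_def)
  next
    fix x y assume "x \<in> carrier M" "y \<in> carrier M"
    then show "f (x \<oplus>\<^bsub>M\<^esub> y) = f x \<oplus>\<^bsub>N\<^esub> f y" by (intro f_eq R_intros(2) fR)
  next
    fix X :: "'n oper" and x assume "X \<in> carrier weyl" "x \<in> carrier M"
    then show "f (X \<odot>\<^bsub>M\<^esub> x) = X \<odot>\<^bsub>N\<^esub> f x" by (intro f_eq R_intros(3) fR) (simp_all add: weyl_carrier)
  qed
  moreover have "restrict f (gen_eig M euler {a}) = g"
  proof (rule extensionalityI[of _ "gen_eig M euler {a}"])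
    show "restrict f (gen_eig M euler {a}) x = g x" if "x \<in> gen_eig M euler {a}" for x
      using f_eq[OF R_intros(1)[OF that]] that by simp
  qed (use g_simps(4) in simp_all)
  ultimately show ?thesis by blast
qed

section \<open>The degree zero component of an operator\<close>

definition total_degree :: "('n::finite \<Rightarrow>\<^sub>0 nat) \<Rightarrow> complex" where
  "total_degree m = (\<Sum>i\<in>UNIV. of_nat (Poly_Mapping.lookup m i))"

text \<open>A monomial is an Euler eigenvector, so \<open>X\<close> maps it to an eigenvector with
  eigenvalue shifted by \<open>d\<close>; only monomials of that total degree can occur.\<close>

lemma homog_euler_lookup:
  assumes X: "X \<in> weyl_set" and h: "homog euler d X"
    and "Poly_Mapping.lookup (X (Poly_Mapping.single m c)) k \<noteq> 0"
  shows "total_degree k = total_degree m + d"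
proof -
  let ?p = "Poly_Mapping.single m c"
  have "euler ?p = scal (total_degree m) ?p"
    by (intro poly_mapping_eqI) (simp add: lookup_euler lookup_scal total_degree_def lookup_single when_def)
  then have "euler (X ?p) = scal (total_degree m + d) (X ?p)"
    using homogD[OF h, of ?p] by (simp add: weyl_set_linear[OF X] scal_plus)
  then have "Poly_Mapping.lookup (euler (X ?p)) k = Poly_Mapping.lookup (scal (total_degree m + d) (X ?p)) k"
    by simp
  then show ?thesis
    using assms(3) by (simp add: lookup_euler lookup_scal total_degree_def)
qed

lemma homog_span_lookup:
  assumes "Z \<in> homog_span (- {0})" and eq: "total_degree k = total_degree m"
  shows "Poly_Mapping.lookup (Z (Poly_Mapping.single m c)) k = 0"
  using assms(1)
proof (induction rule: homog_span.induct)
  case (add X d Y)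
  then have "Poly_Mapping.lookup (X (Poly_Mapping.single m c)) k = 0"
    using homog_euler_lookup[of X d m c k] eq by auto
  then show ?case using add by (simp add: lookup_add)
qed simp

lemma additive_ext:
  fixes X Y :: "'n oper"
  assumes "X \<in> weyl_set" "Y \<in> weyl_set"
    and "\<And>m c. X (Poly_Mapping.single m c) = Y (Poly_Mapping.single m c)"
  shows "X = Y"
proof
  fix p show "X p = Y p"
  proof (induction p rule: update_induct)
    case const
    then show ?case using assms by (simp add: weyl_set_0)
  next
    case (update p k c)
    have "Poly_Mapping.update k c p = Poly_Mapping.single k c + p"
      using update by (intro poly_mapping_eqI)
        (auto simp: lookup_update lookup_add lookup_single when_def in_keys_iff)
    then show ?case using assms update by (simp add: weyl_set_additive)
  qed
qed

text \<open>Applied to a monomial, the coefficients of unchanged total degree come only from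
  \<open>Y\<close> and \<open>Y'\<close>, while in every other degree those of \<open>Y\<close> and
  \<open>Y'\<close> are zero.\<close>

lemma weyl_degree_zero_unique:
  fixes Y :: "'n::finite oper"
  assumes Y: "Y \<in> carrier weylE" "Y' \<in> carrier weylE"
    and Z: "Z \<in> homog_span (- {0})" "Z' \<in> homog_span (- {0})"
    and eq: "\<And>p. Y p + Z p = Y' p + Z' p"
  shows "Y = Y'"
proof (rule additive_ext)
  fix m :: "'n \<Rightarrow>\<^sub>0 nat" and c :: complex
  let ?p = "Poly_Mapping.single m c"
  show "Y ?p = Y' ?p"
  proof (rule poly_mapping_eqI)
    fix k show "Poly_Mapping.lookup (Y ?p) k = Poly_Mapping.lookup (Y' ?p) k"
    proof (cases "total_degree k = total_degree m")
      case True
      have "Poly_Mapping.lookup (Y ?p + Z ?p) k = Poly_Mapping.lookup (Y' ?p + Z' ?p) k"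
        by (simp add: eq)
      then show ?thesis using homog_span_lookup[OF _ True] Z by (simp add: lookup_add)
    next
      case False
      then show ?thesis
        using homog_euler_lookup[of Y 0 m c k] homog_euler_lookup[of Y' 0 m c k] Y
        unfolding weylE_carrier mem_Collect_eq add_0_right by metis
    qed
  qed
qed (use Y in \<open>auto simp: weylE_carrier\<close>)

text \<open>The projection of D onto D^E along the operators of nonzero degree;
  \<open>weyl_degree_zero_split\<close> and \<open>weyl_degree_zero_unique\<close> justify the
  description.\<close>

definition degree_zero :: "'n::finite oper \<Rightarrow> 'n oper" where
  "degree_zero X = (THE Y. Y \<in> carrier weylE \<and> (\<exists>Z\<in>homog_span (- {0}). X = (\<lambda>p. Y p + Z p)))"

lemma degree_zero_eq:
  assumes "Y \<in> carrier weylE" "Z \<in> homog_span (- {0})"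
  shows "degree_zero (\<lambda>p. Y p + Z p) = Y"
  unfolding degree_zero_def
proof (rule the_equality)
  fix Y' assume Y': "Y' \<in> carrier weylE \<and> (\<exists>Z'\<in>homog_span (- {0}). (\<lambda>p. Y p + Z p) = (\<lambda>p. Y' p + Z' p))"
  then obtain Z' where "Z' \<in> homog_span (- {0})" "(\<lambda>p. Y p + Z p) = (\<lambda>p. Y' p + Z' p)" by blast
  then show "Y' = Y"
    using weyl_degree_zero_unique[of Y' Y Z' Z] Y' assms by (simp add: fun_eq_iff)
qed (use assms in blast)

lemma degree_zero_id: "Y \<in> carrier weylE \<Longrightarrow> degree_zero Y = Y"
  using degree_zero_eq[OF _ homog_span.zero, of Y] by simp

lemma degree_zero_weylE: "X \<in> weyl_set \<Longrightarrow> degree_zero X \<in> carrier weylE"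
  by (rule weyl_degree_zero_split[of X]) (simp_all add: degree_zero_eq)

lemma weylE_add: "Y \<in> carrier weylE \<Longrightarrow> Y' \<in> carrier weylE \<Longrightarrow> (\<lambda>p. Y p + Y' p) \<in> carrier weylE"
  using ring.ring_simprules(1)[OF ring_weylE, of Y Y'] by (simp add: weylE_def weyl_def)

lemma weylE_comp: "Y \<in> carrier weylE \<Longrightarrow> Y' \<in> carrier weylE \<Longrightarrow> Y \<circ> Y' \<in> carrier weylE"
  using ring.ring_simprules(5)[OF ring_weylE, of Y Y'] by (simp add: weylE_def weyl_def)

lemma degree_zero_add:
  assumes "X \<in> weyl_set" "X' \<in> weyl_set"
  shows "degree_zero (\<lambda>p. X p + X' p) = (\<lambda>p. degree_zero X p + degree_zero X' p)"
proof -
  obtain Y Z where X: "Y \<in> carrier weylE" "Z \<in> homog_span (- {0})" "X = (\<lambda>p. Y p + Z p)"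
    using weyl_degree_zero_split[OF assms(1)] .
  obtain Y' Z' where X': "Y' \<in> carrier weylE" "Z' \<in> homog_span (- {0})" "X' = (\<lambda>p. Y' p + Z' p)"
    using weyl_degree_zero_split[OF assms(2)] .
  have "degree_zero (\<lambda>p. (Y p + Y' p) + (Z p + Z' p)) = (\<lambda>p. Y p + Y' p)"
    by (intro degree_zero_eq weylE_add homog_span_add X X')
  moreover have "(\<lambda>p. X p + X' p) = (\<lambda>p. (Y p + Y' p) + (Z p + Z' p))"
    by (simp add: X X' algebra_simps)
  moreover have "degree_zero X = Y" "degree_zero X' = Y'"
    unfolding X(3) X'(3) by (intro degree_zero_eq X X')+
  ultimately show ?thesis by (simp only:)
qed

lemma homog_span_weylE_comp:
  assumes C: "C \<in> carrier weylE" and Z: "Z \<in> homog_span (- {0})"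
  shows "C \<circ> Z \<in> homog_span (- {0})" "Z \<circ> C \<in> homog_span (- {0})"
proof -
  have C': "C \<in> weyl_set" "homog euler 0 C" using C by (auto simp: weylE_carrier)
  show "C \<circ> Z \<in> homog_span (- {0})"
    using Z
  proof (induction rule: homog_span.induct)
    case zero
    then show ?case using C' by (simp add: comp_def weyl_set_0 homog_span.zero)
  next
    case (add X d Y)
    have "C \<circ> (\<lambda>p. X p + Y p) = (\<lambda>p. (C \<circ> X) p + (C \<circ> Y) p)"
      using C' by (simp add: fun_eq_iff weyl_set_additive)
    moreover have "\<dots> \<in> homog_span (- {0})"
      using homog_comp[OF C'(2) add.hyps(2) C'(1), unfolded add_0_left]
      by (intro homog_span.add[where d = d] weyl_set.comp C' add)
    ultimately show ?case by (simp only:)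
  qed
  show "Z \<circ> C \<in> homog_span (- {0})"
    using Z
  proof (induction rule: homog_span.induct)
    case zero
    then show ?case by (simp add: comp_def homog_span.zero)
  next
    case (add X d Y)
    have "(\<lambda>p. X p + Y p) \<circ> C = (\<lambda>p. (X \<circ> C) p + (Y \<circ> C) p)"
      by (simp add: fun_eq_iff)
    moreover have "\<dots> \<in> homog_span (- {0})"
      using homog_comp[OF add.hyps(2) C'(2) add.hyps(1), unfolded add_0_right]
      by (intro homog_span.add[where d = d] weyl_set.comp C' add)
    ultimately show ?case by (simp only:)
  qed
qed

text \<open>Multiplication by an operator of degree zero, on either side, respects degrees. Left
  linearity is what coinduction asks for; right linearity transfers annihilating
  polynomials.\<close>

lemma degree_zero_comp:
  assumes C: "C \<in> carrier weylE" and "X \<in> weyl_set"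
  shows "degree_zero (C \<circ> X) = C \<circ> degree_zero X" "degree_zero (X \<circ> C) = degree_zero X \<circ> C"
proof -
  obtain Y Z where X: "Y \<in> carrier weylE" "Z \<in> homog_span (- {0})" "X = (\<lambda>p. Y p + Z p)"
    using weyl_degree_zero_split[OF assms(2)] .
  have Y: "degree_zero X = Y" unfolding X(3) by (intro degree_zero_eq X)
  have "C \<circ> X = (\<lambda>p. (C \<circ> Y) p + (C \<circ> Z) p)"
    using C by (simp add: X fun_eq_iff weylE_carrier weyl_set_additive)
  then show "degree_zero (C \<circ> X) = C \<circ> degree_zero X"
    unfolding Y by (simp only: degree_zero_eq weylE_comp C X homog_span_weylE_comp)
  have "X \<circ> C = (\<lambda>p. (Y \<circ> C) p + (Z \<circ> C) p)"
    by (simp add: X fun_eq_iff)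
  then show "degree_zero (X \<circ> C) = degree_zero X \<circ> C"
    unfolding Y by (simp only: degree_zero_eq weylE_comp C X homog_span_weylE_comp)
qed

section \<open>The coinduced module\<close>

text \<open>The D^E-linear maps from D to N, on which D acts by right multiplication of the
  argument. They are extensional, so equal values on D mean equal elements.\<close>

definition coinduced :: "('n::finite oper, 'u) module \<Rightarrow> ('n oper, 'n oper \<Rightarrow> 'u) module" where
  "coinduced N = \<lparr>carrier = {\<phi> \<in> weyl_set \<rightarrow>\<^sub>E carrier N.
       (\<forall>X\<in>weyl_set. \<forall>Y\<in>weyl_set. \<phi> (\<lambda>p. X p + Y p) = \<phi> X \<oplus>\<^bsub>N\<^esub> \<phi> Y) \<and>
       (\<forall>C\<in>carrier weylE. \<forall>X\<in>weyl_set. \<phi> (C \<circ> X) = C \<odot>\<^bsub>N\<^esub> \<phi> X)},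
     monoid.mult = undefined, one = undefined, zero = (\<lambda>X\<in>weyl_set. \<zero>\<^bsub>N\<^esub>),
     add = (\<lambda>\<phi> \<psi>. \<lambda>X\<in>weyl_set. \<phi> X \<oplus>\<^bsub>N\<^esub> \<psi> X), module.smult = (\<lambda>Y \<phi>. \<lambda>X\<in>weyl_set. \<phi> (X \<circ> Y))\<rparr>"

lemma coinduced_simps:
  "\<zero>\<^bsub>coinduced N\<^esub> = (\<lambda>X\<in>weyl_set. \<zero>\<^bsub>N\<^esub>)"
  "\<phi> \<oplus>\<^bsub>coinduced N\<^esub> \<psi> = (\<lambda>X\<in>weyl_set. \<phi> X \<oplus>\<^bsub>N\<^esub> \<psi> X)"
  "Y \<odot>\<^bsub>coinduced N\<^esub> \<phi> = (\<lambda>X\<in>weyl_set. \<phi> (X \<circ> Y))"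
  by (simp_all add: coinduced_def)

lemma coinduced_carrierI:
  assumes "\<phi> \<in> extensional weyl_set" "\<And>X. X \<in> weyl_set \<Longrightarrow> \<phi> X \<in> carrier N"
    "\<And>X Y. X \<in> weyl_set \<Longrightarrow> Y \<in> weyl_set \<Longrightarrow> \<phi> (\<lambda>p. X p + Y p) = \<phi> X \<oplus>\<^bsub>N\<^esub> \<phi> Y"
    "\<And>C X. C \<in> carrier weylE \<Longrightarrow> X \<in> weyl_set \<Longrightarrow> \<phi> (C \<circ> X) = C \<odot>\<^bsub>N\<^esub> \<phi> X"
  shows "\<phi> \<in> carrier (coinduced N)"
  using assms by (simp add: coinduced_def PiE_def Pi_def)

lemma coinduced_carrierD:
  assumes "\<phi> \<in> carrier (coinduced N)"
  shows "\<phi> \<in> extensional weyl_set" "\<And>X. X \<in> weyl_set \<Longrightarrow> \<phi> X \<in> carrier N"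
    "\<And>X Y. X \<in> weyl_set \<Longrightarrow> Y \<in> weyl_set \<Longrightarrow> \<phi> (\<lambda>p. X p + Y p) = \<phi> X \<oplus>\<^bsub>N\<^esub> \<phi> Y"
    "\<And>C X. C \<in> carrier weylE \<Longrightarrow> X \<in> weyl_set \<Longrightarrow> \<phi> (C \<circ> X) = C \<odot>\<^bsub>N\<^esub> \<phi> X"
  using assms by (auto simp: coinduced_def PiE_def Pi_def)

lemma oper_module_coinduced:
  fixes N :: "('n::finite oper, 'u) module"
  assumes "oper_module weylE N"
  shows "oper_module weyl (coinduced N)"
proof -
  interpret N: oper_module weylE N by fact
  interpret W: ring "weyl :: 'n oper ring" by (rule ring_weyl)
  let ?C = "coinduced N"
  have weylE_weyl: "C \<in> weyl_set" if "C \<in> carrier weylE" for C :: "'n oper"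
    using that by (simp add: weylE_carrier)
  have comp_add: "(\<lambda>p. X p + Y p) \<circ> Z = (\<lambda>p. (X \<circ> Z) p + (Y \<circ> Z) p)" for X Y Z :: "'n oper"
    by (simp add: fun_eq_iff)
  have add_comp: "Z \<circ> (\<lambda>p. X p + Y p) = (\<lambda>p. (Z \<circ> X) p + (Z \<circ> Y) p)" if "Z \<in> weyl_set" for X Y Z :: "'n oper"
    using that by (simp add: fun_eq_iff weyl_set_additive)
  have add: "\<phi> \<oplus>\<^bsub>?C\<^esub> \<psi> \<in> carrier ?C" if "\<phi> \<in> carrier ?C" "\<psi> \<in> carrier ?C" for \<phi> \<psi>
  proof (rule coinduced_carrierI)
    note D = coinduced_carrierD[OF that(1)] coinduced_carrierD[OF that(2)]
    show "(\<phi> \<oplus>\<^bsub>?C\<^esub> \<psi>) X \<in> carrier N" if "X \<in> weyl_set" for X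
      using that D by (simp add: coinduced_simps)
    show "(\<phi> \<oplus>\<^bsub>?C\<^esub> \<psi>) (\<lambda>p. X p + Y p) = (\<phi> \<oplus>\<^bsub>?C\<^esub> \<psi>) X \<oplus>\<^bsub>N\<^esub> (\<phi> \<oplus>\<^bsub>?C\<^esub> \<psi>) Y"
      if "X \<in> weyl_set" "Y \<in> weyl_set" for X Y
      using that D(2,3,6,7) by (simp add: coinduced_simps weyl_set.add N.M.a_ac)
    show "(\<phi> \<oplus>\<^bsub>?C\<^esub> \<psi>) (C \<circ> X) = C \<odot>\<^bsub>N\<^esub> (\<phi> \<oplus>\<^bsub>?C\<^esub> \<psi>) X"
      if "C \<in> carrier weylE" "X \<in> weyl_set" for C X
      using that D(2,4,6,8) weyl_set.comp[OF weylE_weyl[OF that(1)] that(2)]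
      unfolding coinduced_simps by (simp only: restrict_apply N.smult_r_distr if_True)
  qed (simp add: coinduced_simps)
  have zero: "\<zero>\<^bsub>?C\<^esub> \<in> carrier ?C"
  proof (rule coinduced_carrierI)
    show "\<zero>\<^bsub>?C\<^esub> (C \<circ> X) = C \<odot>\<^bsub>N\<^esub> \<zero>\<^bsub>?C\<^esub> X" if "C \<in> carrier weylE" "X \<in> weyl_set" for C X
      using that weyl_set.comp[OF weylE_weyl[OF that(1)] that(2)] unfolding coinduced_simps
      by (simp only: restrict_apply if_True N.act_0)
  qed (simp_all add: coinduced_simps weyl_set.add)
  have act: "Z \<odot>\<^bsub>?C\<^esub> \<phi> \<in> carrier ?C" if "Z \<in> weyl_set" "\<phi> \<in> carrier ?C" for Z \<phi>
  proof (rule coinduced_carrierI)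
    note D = coinduced_carrierD[OF that(2)]
    note Z = that(1)
    show "(Z \<odot>\<^bsub>?C\<^esub> \<phi>) X \<in> carrier N" if "X \<in> weyl_set" for X
      using that D(2)[OF weyl_set.comp[OF that Z]] by (simp add: coinduced_simps)
    show "(Z \<odot>\<^bsub>?C\<^esub> \<phi>) (\<lambda>p. X p + Y p) = (Z \<odot>\<^bsub>?C\<^esub> \<phi>) X \<oplus>\<^bsub>N\<^esub> (Z \<odot>\<^bsub>?C\<^esub> \<phi>) Y"
      if "X \<in> weyl_set" "Y \<in> weyl_set" for X Y
      using that D(3)[OF weyl_set.comp[OF that(1) Z] weyl_set.comp[OF that(2) Z]] weyl_set.add[OF that]
      unfolding coinduced_simps by (simp only: comp_add restrict_apply if_True)
    show "(Z \<odot>\<^bsub>?C\<^esub> \<phi>) (C \<circ> X) = C \<odot>\<^bsub>N\<^esub> (Z \<odot>\<^bsub>?C\<^esub> \<phi>) X"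
      if "C \<in> carrier weylE" "X \<in> weyl_set" for C X
      using that D(4)[OF that(1) weyl_set.comp[OF that(2) Z]] weyl_set.comp[OF weylE_weyl[OF that(1)] that(2)]
      unfolding coinduced_simps by (simp only: comp_assoc restrict_apply if_True)
  qed (simp add: coinduced_simps)
  have "abelian_group ?C"
  proof (rule abelian_groupI)
    fix \<phi> \<psi> \<omega> assume c: "\<phi> \<in> carrier ?C" "\<psi> \<in> carrier ?C" "\<omega> \<in> carrier ?C"
    show "\<phi> \<oplus>\<^bsub>?C\<^esub> \<psi> \<oplus>\<^bsub>?C\<^esub> \<omega> = \<phi> \<oplus>\<^bsub>?C\<^esub> (\<psi> \<oplus>\<^bsub>?C\<^esub> \<omega>)"
      using c[THEN coinduced_carrierD(2)] by (simp add: coinduced_simps restrict_def fun_eq_iff N.M.a_assoc)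
  next
    fix \<phi> \<psi> assume c: "\<phi> \<in> carrier ?C" "\<psi> \<in> carrier ?C"
    show "\<phi> \<oplus>\<^bsub>?C\<^esub> \<psi> = \<psi> \<oplus>\<^bsub>?C\<^esub> \<phi>"
      using c[THEN coinduced_carrierD(2)] by (simp add: coinduced_simps restrict_def fun_eq_iff N.M.a_comm)
  next
    fix \<phi> assume c: "\<phi> \<in> carrier ?C"
    note D = coinduced_carrierD[OF c]
    show "\<zero>\<^bsub>?C\<^esub> \<oplus>\<^bsub>?C\<^esub> \<phi> = \<phi>"
      using D(1,2) by (auto simp: coinduced_simps fun_eq_iff extensional_def)
    have "(scal (-1) \<odot>\<^bsub>?C\<^esub> \<phi>) X \<oplus>\<^bsub>N\<^esub> \<phi> X = \<zero>\<^bsub>N\<^esub>" if X: "X \<in> weyl_set" for X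
    proof -
      have "X \<circ> scal (-1) = scal (-1) \<circ> X"
        using X by (simp add: fun_eq_iff weyl_set_linear)
      then have "(scal (-1) \<odot>\<^bsub>?C\<^esub> \<phi>) X = scal (-1) \<odot>\<^bsub>N\<^esub> \<phi> X"
        using D(4)[OF N.U_scal X] X by (simp only: coinduced_simps restrict_apply if_True)
      then show ?thesis
        using N.act_neg[OF D(2)[OF X]] D(2)[OF X] N.M.a_comm[of "\<phi> X" "scal (-1) \<odot>\<^bsub>N\<^esub> \<phi> X"] N.U_scal by simp
    qed
    then have "scal (-1) \<odot>\<^bsub>?C\<^esub> \<phi> \<oplus>\<^bsub>?C\<^esub> \<phi> = \<zero>\<^bsub>?C\<^esub>"
      unfolding coinduced_simps(1,2) by (rule restrict_ext)
    then show "\<exists>\<psi>\<in>carrier ?C. \<psi> \<oplus>\<^bsub>?C\<^esub> \<phi> = \<zero>\<^bsub>?C\<^esub>"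
      using act[OF weyl_set.scal c] by blast
  qed (use add zero in auto)
  then interpret C: abelian_group ?C .
  show ?thesis
  proof (unfold_locales)
    fix X Y :: "'n oper" and \<phi> assume X: "X \<in> carrier weyl" "Y \<in> carrier weyl" and c: "\<phi> \<in> carrier ?C"
    then have XY: "X \<in> weyl_set" "Y \<in> weyl_set" by (simp_all add: weyl_carrier)
    note D = coinduced_carrierD[OF c]
    show "(X \<oplus>\<^bsub>weyl\<^esub> Y) \<odot>\<^bsub>?C\<^esub> \<phi> = X \<odot>\<^bsub>?C\<^esub> \<phi> \<oplus>\<^bsub>?C\<^esub> Y \<odot>\<^bsub>?C\<^esub> \<phi>"
    proof
      fix T
      show "((X \<oplus>\<^bsub>weyl\<^esub> Y) \<odot>\<^bsub>?C\<^esub> \<phi>) T = (X \<odot>\<^bsub>?C\<^esub> \<phi> \<oplus>\<^bsub>?C\<^esub> Y \<odot>\<^bsub>?C\<^esub> \<phi>) T"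
        using D(3)[of "T \<circ> X" "T \<circ> Y"] XY add_comp[of T X Y] weyl_set.comp[of T X] weyl_set.comp[of T Y]
        by (cases "T \<in> weyl_set") (simp_all only: coinduced_simps restrict_apply if_True if_False simp_thms weyl_def ring.simps monoid.simps)
    qed
    show "(X \<otimes>\<^bsub>weyl\<^esub> Y) \<odot>\<^bsub>?C\<^esub> \<phi> = X \<odot>\<^bsub>?C\<^esub> (Y \<odot>\<^bsub>?C\<^esub> \<phi>)"
    proof
      fix T
      show "((X \<otimes>\<^bsub>weyl\<^esub> Y) \<odot>\<^bsub>?C\<^esub> \<phi>) T = (X \<odot>\<^bsub>?C\<^esub> (Y \<odot>\<^bsub>?C\<^esub> \<phi>)) T"
        using weyl_set.comp[of T X] XY
        by (cases "T \<in> weyl_set") (simp_all only: coinduced_simps restrict_apply if_True if_False simp_thms weyl_def ring.simps monoid.simps comp_assoc)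
    qed
  next
    fix X :: "'n oper" and \<phi> \<psi> assume "X \<in> carrier weyl" "\<phi> \<in> carrier ?C" "\<psi> \<in> carrier ?C"
    then have X: "X \<in> weyl_set" by (simp add: weyl_carrier)
    show "X \<odot>\<^bsub>?C\<^esub> (\<phi> \<oplus>\<^bsub>?C\<^esub> \<psi>) = X \<odot>\<^bsub>?C\<^esub> \<phi> \<oplus>\<^bsub>?C\<^esub> X \<odot>\<^bsub>?C\<^esub> \<psi>"
    proof
      fix T
      show "(X \<odot>\<^bsub>?C\<^esub> (\<phi> \<oplus>\<^bsub>?C\<^esub> \<psi>)) T = (X \<odot>\<^bsub>?C\<^esub> \<phi> \<oplus>\<^bsub>?C\<^esub> X \<odot>\<^bsub>?C\<^esub> \<psi>) T"
        using weyl_set.comp[of T X] X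
        by (cases "T \<in> weyl_set") (simp_all only: coinduced_simps restrict_apply if_True if_False simp_thms)
    qed
  next
    fix \<phi> assume c: "\<phi> \<in> carrier ?C"
    show "\<one>\<^bsub>weyl\<^esub> \<odot>\<^bsub>?C\<^esub> \<phi> = \<phi>"
      using coinduced_carrierD(1)[OF c] by (auto simp: coinduced_simps fun_eq_iff weyl_def extensional_def)
  qed (use act in \<open>auto simp: weyl_carrier\<close>)
qed

lemma coinduced_gen_eig_iff:
  assumes "oper_module weylE N" "A \<in> weyl_set"
  shows "\<phi> \<in> gen_eig (coinduced N) A S \<longleftrightarrow> \<phi> \<in> carrier (coinduced N) \<and>
    (\<exists>p. p \<noteq> 0 \<and> (\<forall>z. poly p z = 0 \<longrightarrow> z \<in> S) \<and> (\<forall>X\<in>weyl_set. \<phi> (X \<circ> opoly A p) = \<zero>\<^bsub>N\<^esub>))"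
proof -
  have "opoly A p \<odot>\<^bsub>coinduced N\<^esub> \<phi> = \<zero>\<^bsub>coinduced N\<^esub> \<longleftrightarrow> (\<forall>X\<in>weyl_set. \<phi> (X \<circ> opoly A p) = \<zero>\<^bsub>N\<^esub>)" for p
    unfolding coinduced_simps by (auto simp: fun_eq_iff)
  then show ?thesis by (simp add: gen_eig_def)
qed

section \<open>The generalized weight part of a module\<close>

lemma theta_parts_closed:
  assumes "oper_module weyl M" and S: "\<And>j z. z \<in> S j \<Longrightarrow> z + 1 \<in> S j \<and> z - 1 \<in> S j"
    and X: "X \<in> weyl_set" and m: "\<And>j. m \<in> gen_eig M (theta j) (S j)"
  shows "X \<odot>\<^bsub>M\<^esub> m \<in> gen_eig M (theta j) (S j)"
proof -
  interpret M: oper_module weyl M by fact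
  have hom: "X \<odot>\<^bsub>M\<^esub> m \<in> gen_eig M (theta j) (S j)"
    if "X \<in> weyl_set" "homog (theta j) d X" "d = 0 \<or> d = 1 \<or> d = -1" "\<And>j. m \<in> gen_eig M (theta j) (S j)" for X m d j
  proof -
    have "X \<odot>\<^bsub>M\<^esub> m \<in> gen_eig M (theta j) ((+) d ` S j)"
      using that by (intro M.gen_eig_act M.U_theta) (simp_all add: weyl_carrier)
    then show ?thesis
    proof (rule M.gen_eig_mono)
      show "(+) d ` S j \<subseteq> S j"
        using that(3) S[of _ j] by (elim disjE) (simp_all add: image_subset_iff add.commute)
    qed
  qed
  have "\<forall>j. X \<odot>\<^bsub>M\<^esub> m \<in> gen_eig M (theta j) (S j)"
    using X m
  proof (induction X arbitrary: m rule: weyl_set.induct)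
    case (scal c)
    then show ?case using hom[OF weyl_set.scal homog_scal[OF theta_in_weyl]] by simp
  next
    case (var i)
    then show ?case using hom[OF weyl_set.var homog_theta_mult_var] by simp
  next
    case (deriv i)
    then show ?case using hom[OF weyl_set.deriv homog_theta_partial_deriv] by simp
  next
    case (add X Y)
    have "(\<lambda>p. X p + Y p) \<odot>\<^bsub>M\<^esub> m = X \<odot>\<^bsub>M\<^esub> m \<oplus>\<^bsub>M\<^esub> Y \<odot>\<^bsub>M\<^esub> m"
      using add.hyps M.gen_eig_carrier[OF add.prems] by (intro M.act_add) (simp_all add: weyl_carrier)
    then show ?case
      using add.IH[OF add.prems] by (simp only: M.gen_eig_add M.U_theta simp_thms)
  next
    case (comp X Y)
    then have "(X \<circ> Y) \<odot>\<^bsub>M\<^esub> m = X \<odot>\<^bsub>M\<^esub> (Y \<odot>\<^bsub>M\<^esub> m)"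
      using M.gen_eig_carrier[OF comp.prems] by (intro M.act_comp) (simp_all add: weyl_carrier)
    then show ?case using comp.IH(1)[OF comp.IH(2)[OF comp.prems, rule_format]] by (simp only: simp_thms)
  qed
  then show ?thesis by blast
qed

text \<open>Cuts the coinduced module down to a generalized weight module: a function on D may be
  nonzero in infinitely many degrees, and then it is no finite sum of weight vectors.\<close>

definition theta_parts :: "('n::finite oper, 'u) module \<Rightarrow> ('n \<Rightarrow> complex set) \<Rightarrow> ('n oper, 'u) module" where
  "theta_parts M S = M\<lparr>carrier := {m \<in> carrier M. \<forall>j. m \<in> gen_eig M (theta j) (S j)}\<rparr>"

lemma theta_parts_simps [simp]:
  "carrier (theta_parts M S) = {m \<in> carrier M. \<forall>j. m \<in> gen_eig M (theta j) (S j)}"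
  "\<zero>\<^bsub>theta_parts M S\<^esub> = \<zero>\<^bsub>M\<^esub>"
  "x \<oplus>\<^bsub>theta_parts M S\<^esub> y = x \<oplus>\<^bsub>M\<^esub> y"
  "X \<odot>\<^bsub>theta_parts M S\<^esub> x = X \<odot>\<^bsub>M\<^esub> x"
  by (simp_all add: theta_parts_def)

lemma gen_eig_theta_parts:
  "m \<in> gen_eig (theta_parts M S) A T \<longleftrightarrow> m \<in> carrier (theta_parts M S) \<and> m \<in> gen_eig M A T"
  unfolding theta_parts_def by (subst gen_eig_restrict) auto

lemma oper_module_theta_parts:
  fixes M :: "('n::finite oper, 'u) module"
  assumes "oper_module weyl M" and S: "\<And>j z. z \<in> S j \<Longrightarrow> z + 1 \<in> S j \<and> z - 1 \<in> S j"
  shows "oper_module weyl (theta_parts M S)"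
proof -
  interpret M: oper_module weyl M by fact
  show ?thesis
    unfolding theta_parts_def
  proof (rule oper_module_restrict[OF assms(1)])
    fix X :: "'n oper" and x
    assume "X \<in> carrier weyl" and x: "x \<in> {m \<in> carrier M. \<forall>j. m \<in> gen_eig M (theta j) (S j)}"
    moreover from this have "\<And>j. X \<odot>\<^bsub>M\<^esub> x \<in> gen_eig M (theta j) (S j)"
      by (intro theta_parts_closed[OF assms]) (auto simp: weyl_carrier)
    ultimately show "X \<odot>\<^bsub>M\<^esub> x \<in> {m \<in> carrier M. \<forall>j. m \<in> gen_eig M (theta j) (S j)}"
      by simp
  qed (auto intro: M.gen_eig_zero M.gen_eig_add M.U_theta)
qed

section \<open>Evaluation at the identity on the degree a part of the coinduced module\<close>

context
  fixes N :: "('n::finite oper, 'u) module" and S :: "'n \<Rightarrow> complex set" and a :: complex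
  assumes N: "oper_module weylE N"
    and S: "\<And>j z. z \<in> S j \<Longrightarrow> z + 1 \<in> S j \<and> z - 1 \<in> S j"
    and theta: "\<And>n j. n \<in> carrier N \<Longrightarrow> n \<in> gen_eig N (theta j) (S j)"
    and euler: "\<And>n. n \<in> carrier N \<Longrightarrow> n \<in> gen_eig N euler {a}"
begin

interpretation N: oper_module weylE N by (rule N)
interpretation C: oper_module weyl "coinduced N" by (rule oper_module_coinduced[OF N])

text \<open>Composing p(E) with \<open>id\<close> on the left or on the right gives the same
  operator. On the left it leaves \<open>\<phi>\<close> by D^E-linearity, on the right it is the
  action on \<open>\<phi>\<close>, so annihilation passes to the value.\<close>

lemma coinduced_eval_gen_eig:
  assumes \<phi>: "\<phi> \<in> gen_eig (coinduced N) euler T"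
  shows "\<phi> id \<in> gen_eig N euler T"
proof -
  obtain p where p: "\<phi> \<in> carrier (coinduced N)" "p \<noteq> 0" "\<And>z. poly p z = 0 \<Longrightarrow> z \<in> T"
    "\<And>X. X \<in> weyl_set \<Longrightarrow> \<phi> (X \<circ> opoly euler p) = \<zero>\<^bsub>N\<^esub>"
    using \<phi> unfolding coinduced_gen_eig_iff[OF N euler_in_weyl] by blast
  have "opoly euler p \<odot>\<^bsub>N\<^esub> \<phi> id = \<phi> (opoly euler p \<circ> id)"
    by (rule coinduced_carrierD(4)[OF p(1), symmetric]) (simp_all add: N.U_opoly N.U_euler id_in_weyl)
  also have "opoly euler p \<circ> id = id \<circ> opoly euler p" by simp
  also have "\<phi> \<dots> = \<zero>\<^bsub>N\<^esub>" by (rule p(4)[OF id_in_weyl])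
  finally show ?thesis
    by (intro N.gen_eigI[OF _ p(2,3)] coinduced_carrierD(2)[OF p(1) id_in_weyl])
qed

text \<open>For \<open>X\<close> of degree \<open>d\<close> the function \<open>X\<close> applied to
  \<open>\<phi>\<close> has degree a + d, and its value at \<open>id\<close> is
  \<open>\<phi> X\<close>. As N lives in degree \<open>a\<close> alone, this value is zero unless
  \<open>d = 0\<close>.\<close>

lemma coinduced_homog_span:
  assumes \<phi>: "\<phi> \<in> gen_eig (coinduced N) euler {a}" and Z: "Z \<in> homog_span (- {0})"
  shows "\<phi> Z = \<zero>\<^bsub>N\<^esub>"
  using Z
proof (induction rule: homog_span.induct)
  note D = coinduced_carrierD[OF C.gen_eig_carrier[OF \<phi>]]
  case zero
  have "\<phi> (\<lambda>p. 0) = \<phi> (\<lambda>p. 0) \<oplus>\<^bsub>N\<^esub> \<phi> (\<lambda>p. 0)"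
    using D(3)[OF zero_in_weyl zero_in_weyl] by simp
  then show ?case using D(2)[OF zero_in_weyl] by simp
next
  note D = coinduced_carrierD[OF C.gen_eig_carrier[OF \<phi>]]
  case (add X d Y)
  have "X \<odot>\<^bsub>coinduced N\<^esub> \<phi> \<in> gen_eig (coinduced N) euler {d + a}"
    using C.gen_eig_act[OF C.U_euler _ add.hyps(2) \<phi>] add.hyps(1) by (simp add: weyl_carrier)
  then have "(X \<odot>\<^bsub>coinduced N\<^esub> \<phi>) id \<in> gen_eig N euler {d + a}"
    by (rule coinduced_eval_gen_eig)
  then have "\<phi> X \<in> gen_eig N euler {d + a}"
    by (simp add: coinduced_simps id_in_weyl)
  then have "\<phi> X = \<zero>\<^bsub>N\<^esub>"
    using N.gen_eig_disjoint[OF N.U_euler _ euler[OF D(2)[OF add.hyps(1)]]] add.hyps(3) by simp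
  then show ?case
    using D(3)[OF add.hyps(1) homog_span_weyl[OF add.hyps(4)]] add.IH by simp
qed

text \<open>The inverse of evaluation at \<open>id\<close>: the D^E-linear function with value
  \<open>n\<close> at \<open>id\<close> that vanishes on operators of nonzero degree.\<close>

definition coinduced_section :: "'u \<Rightarrow> 'n oper \<Rightarrow> 'u" where
  "coinduced_section n = (\<lambda>X\<in>weyl_set. degree_zero X \<odot>\<^bsub>N\<^esub> n)"

lemma coinduced_section_carrier:
  assumes n: "n \<in> carrier N"
  shows "coinduced_section n \<in> carrier (coinduced N)"
proof (rule coinduced_carrierI)
  show "coinduced_section n (\<lambda>p. X p + Y p) = coinduced_section n X \<oplus>\<^bsub>N\<^esub> coinduced_section n Y"
    if "X \<in> weyl_set" "Y \<in> weyl_set" for X Y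
    using that n by (simp add: coinduced_section_def weyl_set.add degree_zero_add N.act_add degree_zero_weylE)
  show "coinduced_section n (C \<circ> X) = C \<odot>\<^bsub>N\<^esub> coinduced_section n X"
    if "C \<in> carrier weylE" "X \<in> weyl_set" for C X
    using that n weyl_set.comp[of C X] degree_zero_comp(1)[OF that]
    by (simp only: coinduced_section_def weylE_carrier mem_Collect_eq restrict_apply if_True
        N.act_comp degree_zero_weylE[unfolded weylE_carrier mem_Collect_eq] N.act_comp[unfolded weylE_carrier mem_Collect_eq] simp_thms)
qed (use n in \<open>auto simp: coinduced_section_def degree_zero_weylE\<close>)

text \<open>By right linearity of \<open>degree_zero\<close>, the value at X p(A) is the degree zero
  part of X applied to p(A) n, which is zero. So the section keeps every eigenvalue condition of
  \<open>n\<close>.\<close>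

lemma coinduced_section_gen_eig:
  assumes A: "A \<in> carrier weylE" and n: "n \<in> gen_eig N A T"
  shows "coinduced_section n \<in> gen_eig (coinduced N) A T"
proof -
  obtain p where p: "n \<in> carrier N" "p \<noteq> 0" "\<And>z. poly p z = 0 \<Longrightarrow> z \<in> T" "opoly A p \<odot>\<^bsub>N\<^esub> n = \<zero>\<^bsub>N\<^esub>"
    using N.gen_eigE[OF n] by metis
  have "coinduced_section n (X \<circ> opoly A p) = \<zero>\<^bsub>N\<^esub>" if X: "X \<in> weyl_set" for X
  proof -
    have W: "X \<circ> opoly A p \<in> weyl_set"
      by (intro weyl_set.comp X N.U_weyl[OF N.U_opoly[OF A]])
    have "coinduced_section n (X \<circ> opoly A p) = (degree_zero X \<circ> opoly A p) \<odot>\<^bsub>N\<^esub> n"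
      using W degree_zero_comp(2)[OF N.U_opoly[OF A] X] by (simp only: coinduced_section_def restrict_apply if_True)
    also have "\<dots> = \<zero>\<^bsub>N\<^esub>"
      using p by (simp only: N.act_comp degree_zero_weylE X N.U_opoly A N.act_0)
    finally show ?thesis .
  qed
  then show ?thesis
    using p coinduced_section_carrier[OF p(1)] unfolding coinduced_gen_eig_iff[OF N N.U_weyl[OF A]] by blast
qed

text \<open>A function of degree \<open>a\<close> vanishes on operators of nonzero degree and is
  thus determined by its value at \<open>id\<close>. The section gives surjectivity; it lies in the
  weight part because it keeps the eigenvalues of \<open>n\<close>.\<close>

lemma coinduced_eval_iso:
  defines "W \<equiv> theta_parts (coinduced N) S"
  shows "\<exists>e\<in>left_module_hom weylE (degree_part a W) N. bij_betw e (carrier (degree_part a W)) (carrier N)"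
proof -
  let ?D = "gen_eig W euler {a}"
  have D: "\<phi> \<in> ?D \<longleftrightarrow> \<phi> \<in> gen_eig (coinduced N) euler {a} \<and> (\<forall>j. \<phi> \<in> gen_eig (coinduced N) (theta j) (S j))" for \<phi>
    unfolding W_def gen_eig_theta_parts using C.gen_eig_carrier by auto
  have car: "\<phi> \<in> carrier (coinduced N)" if "\<phi> \<in> ?D" for \<phi>
    using that D C.gen_eig_carrier by blast
  have W_simps: "\<phi> \<oplus>\<^bsub>W\<^esub> \<psi> = \<phi> \<oplus>\<^bsub>coinduced N\<^esub> \<psi>" "X \<odot>\<^bsub>W\<^esub> \<phi> = X \<odot>\<^bsub>coinduced N\<^esub> \<phi>" for X \<phi> \<psi>
    by (simp_all add: W_def)
  interpret W: oper_module weyl W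
    unfolding W_def by (rule oper_module_theta_parts[OF C.oper_module_axioms S])
  interpret DW: oper_module weylE "degree_part a W"
    by (rule oper_module_degree_part[OF W.oper_module_axioms])
  define e where "e = (\<lambda>\<phi>\<in>?D. \<phi> id)"
  have "e \<in> left_module_hom weylE (degree_part a W) N"
    unfolding left_module_hom_def
  proof (intro CollectI conjI ballI)
    show "e \<in> carrier (degree_part a W) \<rightarrow>\<^sub>E carrier N"
      using car coinduced_carrierD(2)[OF _ id_in_weyl] by (auto simp: e_def)
  next
    fix \<phi> \<psi> assume "\<phi> \<in> carrier (degree_part a W)" "\<psi> \<in> carrier (degree_part a W)"
    then show "e (\<phi> \<oplus>\<^bsub>degree_part a W\<^esub> \<psi>) = e \<phi> \<oplus>\<^bsub>N\<^esub> e \<psi>"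
      using DW.M.a_closed[of \<phi> \<psi>] by (simp add: e_def W_simps coinduced_simps id_in_weyl)
  next
    fix C :: "'n oper" and \<phi> assume C: "C \<in> carrier weylE" and \<phi>: "\<phi> \<in> carrier (degree_part a W)"
    have "\<phi> (C \<circ> id) = C \<odot>\<^bsub>N\<^esub> \<phi> id"
      using \<phi> car by (intro coinduced_carrierD(4)[OF _ C id_in_weyl]) auto
    then show "e (C \<odot>\<^bsub>degree_part a W\<^esub> \<phi>) = C \<odot>\<^bsub>N\<^esub> e \<phi>"
      using DW.act_closed[OF C \<phi>] \<phi> by (simp add: e_def W_simps coinduced_simps id_in_weyl)
  qed
  moreover have "bij_betw e ?D (carrier N)"
  proof (rule bij_betw_imageI)
    show "inj_on e ?D"
    proof (rule inj_onI)
      fix \<phi> \<psi> assume \<phi>: "\<phi> \<in> ?D" and \<psi>: "\<psi> \<in> ?D" and "e \<phi> = e \<psi>"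
      then have eq: "\<phi> id = \<psi> id" by (simp add: e_def)
      have "\<phi> X = \<psi> X" if X: "X \<in> weyl_set" for X
      proof -
        obtain Y Z where YZ: "Y \<in> carrier weylE" "Z \<in> homog_span (- {0})" "X = (\<lambda>p. Y p + Z p)"
          using weyl_degree_zero_split[OF X] .
        have "\<omega> X = Y \<odot>\<^bsub>N\<^esub> \<omega> id" if \<omega>: "\<omega> \<in> ?D" for \<omega>
        proof -
          note Dw = coinduced_carrierD[OF car[OF \<omega>]]
          have "\<omega> X = \<omega> Y \<oplus>\<^bsub>N\<^esub> \<omega> Z"
            unfolding YZ(3) by (rule Dw(3)[OF N.U_weyl[OF YZ(1)] homog_span_weyl[OF YZ(2)]])
          also have "\<omega> Z = \<zero>\<^bsub>N\<^esub>"
            using coinduced_homog_span[OF _ YZ(2)] \<omega> D by blast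
          also have "\<omega> Y = Y \<odot>\<^bsub>N\<^esub> \<omega> id"
            using Dw(4)[OF YZ(1) id_in_weyl] by simp
          finally show ?thesis using Dw(2)[OF id_in_weyl] YZ(1) by simp
        qed
        then show ?thesis using eq \<phi> \<psi> by metis
      qed
      then show "\<phi> = \<psi>"
        using coinduced_carrierD(1)[OF car[OF \<phi>]] coinduced_carrierD(1)[OF car[OF \<psi>]]
        by (intro extensionalityI)
    qed
  next
    show "e ` ?D = carrier N"
    proof (intro equalityI subsetI)
      fix n assume "n \<in> e ` ?D"
      then show "n \<in> carrier N"
        using car coinduced_carrierD(2)[OF _ id_in_weyl] by (auto simp: e_def)
    next
      fix n assume n: "n \<in> carrier N"
      have "coinduced_section n \<in> ?D"
        unfolding D using n by (intro conjI allI coinduced_section_gen_eig N.U_euler N.U_theta euler theta)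
      moreover have "coinduced_section n id = n"
        using n by (simp add: coinduced_section_def id_in_weyl degree_zero_id[OF N.U_id] N.act_id)
      ultimately show "n \<in> e ` ?D"
        by (intro image_eqI[of _ _ "coinduced_section n"]) (simp_all add: e_def)
    qed
  qed
  ultimately show ?thesis by auto
qed

end

section \<open>Transport of structure along injections\<close>

text \<open>The span is covered by countably many stages, each an image of the product of
  \<open>B\<close> with the previous stage; an infinite cardinal absorbs products and countable
  unions.\<close>

lemma addspan_card:
  includes cardinal_syntax
  assumes K: "infinite K" and B: "|B| \<le>o |K|"
  shows "|addspan M B| \<le>o |K|"
proof -
  define F where "F T = (\<lambda>(b, s). b \<oplus>\<^bsub>M\<^esub> s) ` (B \<times> T)" for T
  have "|(F ^^ n) {\<zero>\<^bsub>M\<^esub>}| \<le>o |K|" for n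
  proof (induction n)
    case 0
    have "K \<noteq> {}" using K by auto
    then show ?case by (simp add: card_of_singl_ordLeq)
  next
    case (Suc n)
    have "|B \<times> (F ^^ n) {\<zero>\<^bsub>M\<^esub>}| \<le>o |K|"
      using Suc.IH by (intro card_of_Sigma_ordLeq_infinite[OF K B] ballI)
    then have "|F ((F ^^ n) {\<zero>\<^bsub>M\<^esub>})| \<le>o |K|"
      unfolding F_def by (rule ordLeq_transitive[OF card_of_image])
    then show ?case by simp
  qed
  then have "|\<Union>n. (F ^^ n) {\<zero>\<^bsub>M\<^esub>}| \<le>o |K|"
    using K by (intro card_of_UNION_ordLeq_infinite) (auto simp flip: infinite_iff_card_of_nat)
  moreover have "addspan M B \<subseteq> (\<Union>n. (F ^^ n) {\<zero>\<^bsub>M\<^esub>})"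
  proof
    fix x assume "x \<in> addspan M B"
    then have "\<exists>n. x \<in> (F ^^ n) {\<zero>\<^bsub>M\<^esub>}"
    proof (induction rule: addspan.induct)
      case zero
      then show ?case by (intro exI[of _ 0]) simp
    next
      case (add b s)
      then obtain n where "s \<in> (F ^^ n) {\<zero>\<^bsub>M\<^esub>}" by blast
      then have "b \<oplus>\<^bsub>M\<^esub> s \<in> F ((F ^^ n) {\<zero>\<^bsub>M\<^esub>})"
        using add.hyps(1) unfolding F_def[of "(F ^^ n) {\<zero>\<^bsub>M\<^esub>}"] by (intro image_eqI[of _ _ "(b, s)"]) simp_all
      then show ?case by (intro exI[of _ "Suc n"]) simp
    qed
    then show "x \<in> (\<Union>n. (F ^^ n) {\<zero>\<^bsub>M\<^esub>})" by simp
  qed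
  ultimately show ?thesis
    using card_of_mono1 ordLeq_transitive by blast
qed

text \<open>The complex multiples of a nonzero vector are pairwise distinct.\<close>

lemma (in oper_module) infinite_carrier:
  assumes "n \<in> carrier M" "n \<noteq> \<zero>\<^bsub>M\<^esub>"
  shows "infinite (carrier M)"
proof -
  have "c = d" if eq: "scal c \<odot>\<^bsub>M\<^esub> n = scal d \<odot>\<^bsub>M\<^esub> n" for c d
  proof (rule ccontr)
    assume "c \<noteq> d"
    have "scal c \<odot>\<^bsub>M\<^esub> n \<oplus>\<^bsub>M\<^esub> scal (-1) \<odot>\<^bsub>M\<^esub> (scal d \<odot>\<^bsub>M\<^esub> n) = \<zero>\<^bsub>M\<^esub>"
      unfolding eq using assms U_scal by (intro act_neg) simp
    also have "scal (-1) \<odot>\<^bsub>M\<^esub> (scal d \<odot>\<^bsub>M\<^esub> n) = (scal (-1) \<circ> scal d) \<odot>\<^bsub>M\<^esub> n"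
      using assms U_scal by (intro act_comp[symmetric])
    also have "scal (-1) \<circ> scal d = (scal (-d) :: 'n oper)"
      by (simp add: fun_eq_iff scal_scal)
    also have "scal c \<odot>\<^bsub>M\<^esub> n \<oplus>\<^bsub>M\<^esub> scal (-d) \<odot>\<^bsub>M\<^esub> n = (\<lambda>p. scal c p + scal (-d) p) \<odot>\<^bsub>M\<^esub> n"
      using assms U_scal by (intro act_add[symmetric])
    also have "(\<lambda>p. scal c p + scal (-d) p) = (scal (c - d) :: 'n oper)"
      by (simp add: fun_eq_iff scal_plus[symmetric])
    finally have "scal (1 / (c - d)) \<odot>\<^bsub>M\<^esub> (scal (c - d) \<odot>\<^bsub>M\<^esub> n) = \<zero>\<^bsub>M\<^esub>"
      using U_scal by simp
    then have "(scal (1 / (c - d)) \<circ> scal (c - d)) \<odot>\<^bsub>M\<^esub> n = \<zero>\<^bsub>M\<^esub>"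
      using assms U_scal by (simp only: act_comp)
    moreover have "scal (1 / (c - d)) \<circ> scal (c - d) = (id :: 'n oper)"
      using \<open>c \<noteq> d\<close> by (simp add: fun_eq_iff scal_scal)
    ultimately show False using assms by (simp only: act_id)
  qed
  then have "inj (\<lambda>c. scal c \<odot>\<^bsub>M\<^esub> n)" by (rule injI)
  moreover have "range (\<lambda>c. scal c \<odot>\<^bsub>M\<^esub> n) \<subseteq> carrier M"
    using assms U_scal by auto
  ultimately show ?thesis
    using infinite_UNIV_char_0[where 'a = complex] finite_imageD finite_subset by blast
qed

text \<open>Brings a module of functions back to elements of a prescribed type. The inverse is
  meaningful on the image of the carrier, where \<open>h\<close> will be injective.\<close>

definition transport :: "('u \<Rightarrow> 'v) \<Rightarrow> ('n oper, 'u) module \<Rightarrow> ('n oper, 'v) module" where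
  "transport h M = \<lparr>carrier = h ` carrier M, monoid.mult = undefined, one = undefined, zero = h \<zero>\<^bsub>M\<^esub>,
     add = (\<lambda>x y. h (the_inv_into (carrier M) h x \<oplus>\<^bsub>M\<^esub> the_inv_into (carrier M) h y)),
     module.smult = (\<lambda>X x. h (X \<odot>\<^bsub>M\<^esub> the_inv_into (carrier M) h x))\<rparr>"

context
  fixes M :: "('n::finite oper, 'u) module" and U :: "'n oper ring" and h :: "'u \<Rightarrow> 'v"
  assumes M: "oper_module U M" and h: "inj_on h (carrier M)"
begin

interpretation M: oper_module U M by (rule M)

lemma transport_simps:
  "carrier (transport h M) = h ` carrier M" "\<zero>\<^bsub>transport h M\<^esub> = h \<zero>\<^bsub>M\<^esub>"
  "x \<in> carrier M \<Longrightarrow> y \<in> carrier M \<Longrightarrow> h x \<oplus>\<^bsub>transport h M\<^esub> h y = h (x \<oplus>\<^bsub>M\<^esub> y)"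
  "x \<in> carrier M \<Longrightarrow> X \<odot>\<^bsub>transport h M\<^esub> h x = h (X \<odot>\<^bsub>M\<^esub> x)"
  by (simp_all add: transport_def the_inv_into_f_f[OF h])

lemma oper_module_transport: "oper_module U (transport h M)"
proof -
  have "abelian_group (transport h M)"
  proof (rule abelian_groupI)
    fix x assume "x \<in> carrier (transport h M)"
    then obtain y where y: "y \<in> carrier M" "x = h y" by (auto simp: transport_simps)
    then show "\<exists>y\<in>carrier (transport h M). y \<oplus>\<^bsub>transport h M\<^esub> x = \<zero>\<^bsub>transport h M\<^esub>"
      by (intro bexI[of _ "h (\<ominus>\<^bsub>M\<^esub> y)"]) (simp_all add: transport_simps M.M.l_neg)
  qed (auto simp: transport_simps M.M.a_ac)
  then interpret abelian_group "transport h M" .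
  show ?thesis
  proof unfold_locales
    show "U = weyl \<or> U = weylE" by (rule M.U_cases)
  qed (auto simp: transport_simps M.smult_l_distr M.smult_r_distr M.smult_assoc M.smult_one)
qed

lemma transport_gen_eig:
  assumes A: "A \<in> carrier U"
  shows "gen_eig (transport h M) A S = h ` gen_eig M A S"
proof -
  have "h x = h y \<longleftrightarrow> x = y" if "x \<in> carrier M" "y \<in> carrier M" for x y
    using h that by (auto dest: inj_onD)
  then have "h x \<in> gen_eig (transport h M) A S \<longleftrightarrow> x \<in> gen_eig M A S" if "x \<in> carrier M" for x
    using that M.U_opoly[OF A] by (simp add: gen_eig_def transport_simps)
  moreover have "gen_eig (transport h M) A S \<subseteq> h ` carrier M" "gen_eig M A S \<subseteq> carrier M"
    by (auto simp: gen_eig_def transport_simps)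
  ultimately show ?thesis by blast
qed

lemma transport_inverse_hom:
  "restrict (the_inv_into (carrier M) h) (carrier (transport h M)) \<in> left_module_hom U (transport h M) M"
  by (auto simp: left_module_hom_def transport_simps the_inv_into_f_f[OF h])

end

section \<open>The equivalence\<close>

lemma is_iso_module_cat:
  assumes M: "left_module R M" and N: "left_module R N"
    and f: "f \<in> left_module_hom R M N" and bij: "bij_betw f (carrier M) (carrier N)"
  shows "is_iso (module_cat R P) M N f"
proof -
  interpret M: left_module R M by fact
  interpret N: left_module R N by fact
  note D = left_module_homD[OF f]
  define g where "g = (\<lambda>y\<in>carrier N. the_inv_into (carrier M) f y)"
  have gf: "g (f x) = x" if "x \<in> carrier M" for x
    using that bij D(1) by (simp add: g_def bij_betw_def the_inv_into_f_f)
  have ex: "\<exists>x\<in>carrier M. y = f x" if "y \<in> carrier N" for y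
    using bij that by (auto simp: bij_betw_def)
  have fg: "f (g y) = y" if "y \<in> carrier N" for y
    using ex[OF that] gf by auto
  have "g \<in> left_module_hom R N M"
    unfolding left_module_hom_def
  proof (intro CollectI conjI ballI)
    show "g \<in> carrier N \<rightarrow>\<^sub>E carrier M"
      using ex gf by (fastforce simp: g_def)
  next
    fix x y assume "x \<in> carrier N" "y \<in> carrier N"
    then obtain x' y' where "x' \<in> carrier M" "y' \<in> carrier M" "x = f x'" "y = f y'"
      using ex by blast
    then show "g (x \<oplus>\<^bsub>N\<^esub> y) = g x \<oplus>\<^bsub>M\<^esub> g y"
      using gf by (simp flip: D(2))
  next
    fix X y assume X: "X \<in> carrier R" "y \<in> carrier N"
    then obtain y' where "y' \<in> carrier M" "y = f y'" using ex by blast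
    then show "g (X \<odot>\<^bsub>N\<^esub> y) = X \<odot>\<^bsub>M\<^esub> g y"
      using gf M.smult_closed X by (simp flip: D(3))
  qed
  moreover have "compose (carrier M) g f = (\<lambda>x\<in>carrier M. x)" "compose (carrier N) f g = (\<lambda>x\<in>carrier N. x)"
    using gf fg by (auto simp: compose_def restrict_def fun_eq_iff)
  ultimately show ?thesis
    using f by (auto simp: is_iso_def module_cat_def)
qed

text \<open>Decompose \<open>m\<close> into weight vectors: on weight \<open>l\<close> the Euler
  eigenvalue is |l|, which the hypothesis places in \<open>T\<close>.\<close>

lemma (in oper_module) gen_eig_euler:
  assumes m: "\<And>i. m \<in> gen_eig M (theta i) (S i)"
    and T: "\<And>l. (\<And>i. l $ i \<in> S i) \<Longrightarrow> (\<Sum>i\<in>UNIV. l $ i) \<in> T"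
  shows "m \<in> gen_eig M euler T"
proof -
  have "m \<in> addspan M (\<Union>l\<in>{l. \<forall>i. l $ i \<in> S i}. weight_space U M l)"
    by (rule addspan_weight_spaces[OF m])
  then show ?thesis
  proof (induction rule: addspan.induct)
    case zero
    then show ?case by (rule gen_eig_zero[OF U_euler])
  next
    case (add b s)
    then obtain l where "\<And>i. l $ i \<in> S i" "b \<in> weight_space U M l" by auto
    then have "b \<in> gen_eig M euler T"
      using gen_eig_mono[OF weight_space_euler, of b l T] T[of l] by simp
    then show ?case using add.IH by (intro gen_eig_add U_euler)
  qed
qed

section \<open>The two categories and the functor between them\<close>

abbreviation int_coset :: "complex \<Rightarrow> complex set" where
  "int_coset c \<equiv> (+) c ` \<int>"

text \<open>Puts the support condition into the product form that
  \<open>generalized_weight_module_iff\<close> can test coordinate by coordinate.\<close>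

lemma coset_lattice_eq: "{\<nu> + z | z. z \<in> int_lattice} = {l :: complex ^ 'n. \<forall>i. l $ i \<in> int_coset (\<nu> $ i)}"
proof (intro equalityI subsetI)
  fix l :: "complex ^ 'n" assume "l \<in> {l. \<forall>i. l $ i \<in> int_coset (\<nu> $ i)}"
  then have l: "l $ i \<in> int_coset (\<nu> $ i)" for i by blast
  have "l $ i - \<nu> $ i \<in> \<int>" for i using l[of i] by auto
  then have "l - \<nu> \<in> int_lattice" by (simp add: int_lattice_def)
  then show "l \<in> {\<nu> + z | z. z \<in> int_lattice}"
    by (intro CollectI exI[of _ "l - \<nu>"]) simp
qed (auto simp: int_lattice_def)

lemma DH_mod_Obj:
  "M \<in> Obj (DH_mod \<nu>) \<longleftrightarrow> oper_module weyl M \<and>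
    (\<forall>m\<in>carrier M. \<forall>i. m \<in> gen_eig M (theta i) (int_coset (\<nu> $ i)))"
proof (cases "left_module weyl M")
  case True
  then have M: "oper_module weyl M" by (simp add: oper_module_def oper_module_axioms_def)
  show ?thesis
    using oper_module.generalized_weight_module_iff[OF M, of "\<lambda>i. int_coset (\<nu> $ i)"]
      coset_lattice_eq[of \<nu>] M True by (simp add: DH_mod_def module_cat_def)
qed (simp add: DH_mod_def module_cat_def oper_module_def)

lemma DEH_mod_Obj:
  "M \<in> Obj (DEH_mod a \<nu>) \<longleftrightarrow> oper_module weylE M \<and>
    (\<forall>m\<in>carrier M. m \<in> gen_eig M euler {a}) \<and>
    (\<forall>m\<in>carrier M. \<forall>i. m \<in> gen_eig M (theta i) (int_coset (\<nu> $ i)))"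
proof (cases "left_module weylE M")
  case True
  then have M: "oper_module weylE M" by (simp add: oper_module_def oper_module_axioms_def)
  show ?thesis
    using oper_module.generalized_weight_module_iff[OF M, of "\<lambda>i. int_coset (\<nu> $ i)"]
      coset_lattice_eq[of \<nu>] oper_module.euler_locally_nilpotent_iff[OF M] M True
    by (auto simp: DEH_mod_def module_cat_def)
qed (simp add: DEH_mod_def module_cat_def oper_module_def)

text \<open>Homomorphisms preserve annihilating polynomials of \<open>euler\<close>, so they map M^a
  into N^a.\<close>

lemma left_module_hom_degree_part:
  fixes M :: "('n::finite oper, 'u) module" and N :: "('n oper, 'v) module"
  assumes "oper_module weyl M" "oper_module weyl N" and f: "f \<in> left_module_hom weyl M N"
  shows "restrict f (gen_eig M euler {a}) \<in> left_module_hom weylE (degree_part a M) (degree_part a N)"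
proof -
  interpret M: oper_module weyl M by fact
  interpret DM: oper_module weylE "degree_part a M" by (rule oper_module_degree_part) fact
  note D = left_module_homD[OF f]
  show ?thesis
    unfolding left_module_hom_def
  proof (intro CollectI conjI ballI)
    show "restrict f (gen_eig M euler {a}) \<in> carrier (degree_part a M) \<rightarrow>\<^sub>E carrier (degree_part a N)"
      using left_module_hom_gen_eig[OF assms M.U_euler] by auto
  next
    fix x y assume "x \<in> carrier (degree_part a M)" "y \<in> carrier (degree_part a M)"
    then show "restrict f (gen_eig M euler {a}) (x \<oplus>\<^bsub>degree_part a M\<^esub> y) =
        restrict f (gen_eig M euler {a}) x \<oplus>\<^bsub>degree_part a N\<^esub> restrict f (gen_eig M euler {a}) y"
      using DM.M.a_closed[of x y] M.gen_eig_carrier by (simp add: D(2))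
  next
    fix X :: "'n oper" and x assume X: "X \<in> carrier weylE" "x \<in> carrier (degree_part a M)"
    then show "restrict f (gen_eig M euler {a}) (X \<odot>\<^bsub>degree_part a M\<^esub> x) =
        X \<odot>\<^bsub>degree_part a N\<^esub> restrict f (gen_eig M euler {a}) x"
      using DM.act_closed[OF X] M.gen_eig_carrier by (simp add: D(3) weyl_carrier weylE_carrier)
  qed
qed

context
  fixes a :: complex and \<nu> :: "complex ^ 'n::finite"
  assumes \<nu>: "\<nu> \<notin> int_lattice" and a: "a - (\<Sum>i\<in>UNIV. \<nu> $ i) \<in> \<int>"
begin

lemma obtain_nonintegral:
  obtains i :: 'n where "int_coset (\<nu> $ i) \<inter> \<int> = {}"
proof -
  obtain i where i: "\<nu> $ i \<notin> \<int>" using \<nu> by (auto simp: int_lattice_def)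
  have "\<nu> $ i + z \<notin> \<int>" if "z \<in> \<int>" for z
    using i that Ints_diff[of "\<nu> $ i + z" z] by auto
  then have "int_coset (\<nu> $ i) \<inter> \<int> = {}" by blast
  then show ?thesis by (rule that)
qed

text \<open>Here the integrality of a - |nu| enters: a weight l in nu + Z^(n+1) has |l| - |nu|
  integral, so its Euler eigenvalue |l| lies in a + Z.\<close>

lemma nonintegral_module_of_theta_parts:
  assumes M: "oper_module weyl M" and m: "\<And>m i. m \<in> carrier M \<Longrightarrow> m \<in> gen_eig M (theta i) (int_coset (\<nu> $ i))"
    and i: "int_coset (\<nu> $ i) \<inter> \<int> = {}"
  shows "nonintegral_module M i (int_coset (\<nu> $ i)) a"
proof -
  interpret oper_module weyl M by fact
  show ?thesis
  proof
    fix m assume mc: "m \<in> carrier M"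
    show "m \<in> gen_eig M euler (int_coset a)"
    proof (rule gen_eig_euler[OF m[OF mc]])
      fix l :: "complex ^ 'n" assume "\<And>i. l $ i \<in> int_coset (\<nu> $ i)"
      then have l: "l $ i \<in> int_coset (\<nu> $ i)" for i .
      have "l $ i - \<nu> $ i \<in> \<int>" for i using l[of i] by auto
      then have "(\<Sum>i\<in>UNIV. l $ i - \<nu> $ i) \<in> \<int>" by (intro Ints_sum)
      then have "(\<Sum>i\<in>UNIV. l $ i - \<nu> $ i) - (a - (\<Sum>i\<in>UNIV. \<nu> $ i)) \<in> \<int>" using a by (rule Ints_diff)
      then show "(\<Sum>i\<in>UNIV. l $ i) \<in> int_coset a"
        by (intro image_eqI[of _ _ "(\<Sum>i\<in>UNIV. l $ i - \<nu> $ i) - (a - (\<Sum>i\<in>UNIV. \<nu> $ i))"])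
          (simp_all add: sum_subtractf)
    qed
  qed (use m i in auto)
qed

lemma degree_part_functor:
  "is_functor (DH_mod \<nu> :: (('n oper, 'u) module, 'u \<Rightarrow> 'u) cat) (DEH_mod a \<nu>) (degree_part a)
     (\<lambda>M N f. restrict f (gen_eig M euler {a}))"
proof -
  have cat: "is_category (DH_mod \<nu> :: (('n oper, 'u) module, 'u \<Rightarrow> 'u) cat)"
    "is_category (DEH_mod a \<nu> :: (('n oper, 'u) module, 'u \<Rightarrow> 'u) cat)"
    unfolding DH_mod_def DEH_mod_def by (rule is_category_module_cat)+
  have simps: "Hom (DH_mod \<nu>) = left_module_hom weyl" "Hom (DEH_mod a \<nu>) = left_module_hom weylE"
    "Ident (DH_mod \<nu>) M = (\<lambda>x\<in>carrier M. x)" "Ident (DEH_mod a \<nu>) M = (\<lambda>x\<in>carrier M. x)"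
    "Comp (DH_mod \<nu>) L M N g f = compose (carrier L) g f" "Comp (DEH_mod a \<nu>) L M N g f = compose (carrier L) g f"
    for L M N :: "('n oper, 'u) module" and f g
    by (simp_all add: DH_mod_def DEH_mod_def module_cat_def)
  show ?thesis
    unfolding is_functor_def
  proof (intro conjI ballI cat)
    fix M :: "('n oper, 'u) module" assume "M \<in> Obj (DH_mod \<nu>)"
    then have M: "oper_module weyl M" "\<And>m i. m \<in> carrier M \<Longrightarrow> m \<in> gen_eig M (theta i) (int_coset (\<nu> $ i))"
      by (auto simp: DH_mod_Obj)
    interpret M: oper_module weyl M by (rule M)
    show "degree_part a M \<in> Obj (DEH_mod a \<nu>)"
      using M oper_module_degree_part[OF M(1)] M.gen_eig_carrier
      by (simp add: DEH_mod_Obj gen_eig_degree_part)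
    show "restrict (Ident (DH_mod \<nu>) M) (gen_eig M euler {a}) = Ident (DEH_mod a \<nu>) (degree_part a M)"
      using M.gen_eig_carrier by (auto simp: simps restrict_def fun_eq_iff)
  next
    fix M N :: "('n oper, 'u) module" and f
    assume "M \<in> Obj (DH_mod \<nu>)" "N \<in> Obj (DH_mod \<nu>)" "f \<in> Hom (DH_mod \<nu>) M N"
    then show "restrict f (gen_eig M euler {a}) \<in> Hom (DEH_mod a \<nu>) (degree_part a M) (degree_part a N)"
      by (simp add: simps DH_mod_Obj left_module_hom_degree_part)
  next
    fix L M N :: "('n oper, 'u) module" and f g
    assume "L \<in> Obj (DH_mod \<nu>)" "M \<in> Obj (DH_mod \<nu>)" "N \<in> Obj (DH_mod \<nu>)"
      and f: "f \<in> Hom (DH_mod \<nu>) L M" and "g \<in> Hom (DH_mod \<nu>) M N"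
    then have L: "oper_module weyl L" and M: "oper_module weyl M" by (simp_all add: DH_mod_Obj)
    interpret L: oper_module weyl L by (rule L)
    show "restrict (Comp (DH_mod \<nu>) L M N g f) (gen_eig L euler {a}) =
      Comp (DEH_mod a \<nu>) (degree_part a L) (degree_part a M) (degree_part a N)
        (restrict g (gen_eig M euler {a})) (restrict f (gen_eig L euler {a}))"
      using left_module_hom_gen_eig[OF L M _ L.U_euler] f L.gen_eig_carrier
      by (auto simp: simps compose_def restrict_def fun_eq_iff)
  qed
qed

lemma degree_part_ff:
  fixes M N :: "('n oper, 'u) module"
  assumes "M \<in> Obj (DH_mod \<nu>)" "N \<in> Obj (DH_mod \<nu>)"
  shows "bij_betw (\<lambda>f. restrict f (gen_eig M euler {a})) (Hom (DH_mod \<nu>) M N)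
    (Hom (DEH_mod a \<nu>) (degree_part a M) (degree_part a N))"
proof -
  obtain i where i: "int_coset (\<nu> $ i) \<inter> \<int> = {}" by (rule obtain_nonintegral)
  have M: "nonintegral_module M i (int_coset (\<nu> $ i)) a" "oper_module weyl M" and N: "nonintegral_module N i (int_coset (\<nu> $ i)) a" "oper_module weyl N"
    using assms nonintegral_module_of_theta_parts[OF _ _ i, of M] nonintegral_module_of_theta_parts[OF _ _ i, of N]
    by (simp_all add: DH_mod_Obj)
  have simps: "Hom (DH_mod \<nu>) M N = left_module_hom weyl M N"
    "Hom (DEH_mod a \<nu>) (degree_part a M) (degree_part a N) = left_module_hom weylE (degree_part a M) (degree_part a N)"
    by (simp_all add: DH_mod_def DEH_mod_def module_cat_def)
  show ?thesis
    unfolding simps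
  proof (rule bij_betw_imageI)
    show "inj_on (\<lambda>f. restrict f (gen_eig M euler {a})) (left_module_hom weyl M N)"
    proof (rule inj_onI)
      fix f g assume fg: "f \<in> left_module_hom weyl M N" "g \<in> left_module_hom weyl M N"
        and eq: "restrict f (gen_eig M euler {a}) = restrict g (gen_eig M euler {a})"
      show "f = g"
        by (rule degree_part_faithful[OF M(1) N(2) fg]) (metis eq restrict_apply)
    qed
    show "(\<lambda>f. restrict f (gen_eig M euler {a})) ` left_module_hom weyl M N =
        left_module_hom weylE (degree_part a M) (degree_part a N)"
      using degree_part_full[OF M(1) N(1)] left_module_hom_degree_part[OF M(2) N(2)] by (auto simp: image_iff)
  qed
qed

lemma degree_part_es:
  fixes N :: "('n oper, 'u) module"
  assumes N: "N \<in> Obj (DEH_mod a \<nu>)"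
  shows "\<exists>M\<in>Obj (DH_mod \<nu> :: (('n oper, 'u) module, 'u \<Rightarrow> 'u) cat).
    \<exists>f. is_iso (DEH_mod a \<nu>) (degree_part a M) N f"
proof -
  interpret N: oper_module weylE N using N by (simp add: DEH_mod_Obj)
  have S: "z + 1 \<in> int_coset (\<nu> $ j) \<and> z - 1 \<in> int_coset (\<nu> $ j)" if "z \<in> int_coset (\<nu> $ j)" for j z
  proof -
    obtain w where "w \<in> \<int>" "z = \<nu> $ j + w" using \<open>z \<in> int_coset (\<nu> $ j)\<close> by auto
    then show ?thesis
      by (auto intro: image_eqI[of _ _ "w + 1"] image_eqI[of _ _ "w - 1"])
  qed
  define W where "W = theta_parts (coinduced N) (\<lambda>j. int_coset (\<nu> $ j))"
  obtain e where e: "e \<in> left_module_hom weylE (degree_part a W) N"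
    and e_bij: "bij_betw e (carrier (degree_part a W)) (carrier N)"
    unfolding W_def using coinduced_eval_iso[where S = "\<lambda>j. int_coset (\<nu> $ j)" and a = a, OF N.oper_module_axioms S] N by (auto simp: DEH_mod_Obj)
  have W: "oper_module weyl W"
    unfolding W_def by (intro oper_module_theta_parts oper_module_coinduced N.oper_module_axioms S)
  have W_gen: "m \<in> gen_eig W (theta j) (int_coset (\<nu> $ j))" if "m \<in> carrier W" for m j
    using that unfolding W_def gen_eig_theta_parts by simp
  obtain i where i: "int_coset (\<nu> $ i) \<inter> \<int> = {}" by (rule obtain_nonintegral)
  interpret W: nonintegral_module W i "int_coset (\<nu> $ i)" a
    by (rule nonintegral_module_of_theta_parts[OF W W_gen i])
  have "\<exists>h :: ('n oper \<Rightarrow> 'u) \<Rightarrow> 'u. inj_on h (carrier W)"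
  proof (cases "\<exists>n\<in>carrier N. n \<noteq> \<zero>\<^bsub>N\<^esub>")
    case True
    include cardinal_syntax
    have K: "infinite (carrier N)" using True N.infinite_carrier by blast
    obtain x :: "int \<Rightarrow> ('n oper \<Rightarrow> 'u) \<Rightarrow> ('n oper \<Rightarrow> 'u)" where x:
      "carrier W \<subseteq> addspan W (\<Union>k. x k ` gen_eig W euler {a})"
      using W.addspan_degree_part by blast
    have "|gen_eig W euler {a}| \<le>o |carrier N|"
      using e_bij by (intro iffD1[OF card_of_ordLeq] exI[of _ e]) (auto simp: bij_betw_def)
    then have "|x k ` gen_eig W euler {a}| \<le>o |carrier N|" for k
      by (rule ordLeq_transitive[OF card_of_image])
    moreover have "|UNIV :: int set| \<le>o |carrier N|"
    proof -
      have "|UNIV :: int set| \<le>o |UNIV :: nat set|"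
        by (intro iffD1[OF card_of_ordLeq] exI[of _ to_nat]) simp
      then show ?thesis using K infinite_iff_card_of_nat ordLeq_transitive by blast
    qed
    ultimately have "|\<Union>k. x k ` gen_eig W euler {a}| \<le>o |carrier N|"
      using K by (intro card_of_UNION_ordLeq_infinite) auto
    then have "|addspan W (\<Union>k. x k ` gen_eig W euler {a})| \<le>o |carrier N|"
      by (rule addspan_card[OF K])
    then have "|carrier W| \<le>o |carrier N|"
      using card_of_mono1[OF x] ordLeq_transitive by blast
    then show ?thesis using card_of_ordLeq by metis
  next
    \<comment> \<open>If N is zero, so is the degree \<open>a\<close> part of \<open>W\<close>, and
      then \<open>W\<close> itself because that part is essential; any constant map is injective on
      one point.\<close>
    case False
    then have N0: "carrier N = {\<zero>\<^bsub>N\<^esub>}"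
      using N.M.zero_closed by blast
    have "x = y" if "x \<in> gen_eig W euler {a}" "y \<in> gen_eig W euler {a}" for x y
    proof (rule inj_onD[of e])
      show "inj_on e (gen_eig W euler {a})" using e_bij by (simp add: bij_betw_def)
      show "e x = e y"
        using bij_betw_apply[OF e_bij, of x] bij_betw_apply[OF e_bij, of y] that N0 by simp
    qed (use that in simp_all)
    then have "x = \<zero>\<^bsub>W\<^esub>" if "x \<in> carrier W" for x
      using W.degree_part_essential[OF subset_refl W.act_closed _ that] W.gen_eig_zero[OF W.U_euler] by (simp add: weyl_carrier)
    then have "inj_on (\<lambda>_. undefined) (carrier W)"
      by (metis inj_onI)
    then show ?thesis by blast
  qed
  then obtain h :: "('n oper \<Rightarrow> 'u) \<Rightarrow> 'u" where h: "inj_on h (carrier W)" by blast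
  define M where "M = transport h W"
  have M: "oper_module weyl M"
    unfolding M_def by (rule oper_module_transport[OF W h])
  have M_gen: "gen_eig M A T = h ` gen_eig W A T" if "A \<in> carrier weyl" for A T
    unfolding M_def by (rule transport_gen_eig[OF W h that])
  have M_car: "carrier M = h ` carrier W"
    unfolding M_def by (rule transport_simps(1)[OF W h])
  have "M \<in> Obj (DH_mod \<nu>)"
    using M W_gen M_car by (auto simp: DH_mod_Obj M_gen)
  \<comment> \<open>\<open>g\<close> undoes the transport \<open>h\<close> on the degree
    \<open>a\<close> part; followed by the evaluation \<open>e\<close> it gives the isomorphism onto
    \<open>N\<close>.\<close>
  define g where "g = restrict (restrict (the_inv_into (carrier W) h) (carrier M)) (gen_eig M euler {a})"
  have g: "g \<in> left_module_hom weylE (degree_part a M) (degree_part a W)"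
    unfolding g_def using transport_inverse_hom[OF W h] by (intro left_module_hom_degree_part M W) (simp add: M_def)
  have "g (h x) = x" if "x \<in> gen_eig W euler {a}" for x
    using that W.gen_eig_carrier by (simp add: g_def M_gen M_car the_inv_into_f_f[OF h])
  then have g_bij: "bij_betw g (gen_eig M euler {a}) (gen_eig W euler {a})"
    by (intro bij_betw_byWitness[where f' = h]) (auto simp: M_gen)
  have DM: "oper_module weylE (degree_part a M)" and DW: "oper_module weylE (degree_part a W)"
    by (intro oper_module_degree_part M W)+
  have "compose (carrier (degree_part a M)) e g \<in> left_module_hom weylE (degree_part a M) N"
    using DM g e by (intro left_module_homI_compose) (simp_all add: oper_module_def)
  moreover have "bij_betw (compose (carrier (degree_part a M)) e g) (carrier (degree_part a M)) (carrier N)"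
  proof (rule iffD1[OF bij_betw_cong])
    show "bij_betw (e \<circ> g) (carrier (degree_part a M)) (carrier N)"
      using bij_betw_trans[OF g_bij] e_bij by simp
  qed (simp add: compose_def)
  ultimately have "is_iso (DEH_mod a \<nu>) (degree_part a M) N (compose (carrier (degree_part a M)) e g)"
    unfolding DEH_mod_def using DM N.oper_module_axioms by (intro is_iso_module_cat) (simp_all add: oper_module_def)
  then show ?thesis using \<open>M \<in> Obj (DH_mod \<nu>)\<close> by blast
qed

end

theorem corollary6p3:
  fixes n :: nat and a :: complex and \<nu> :: "complex ^ 'n::finite"
  assumes "CARD('n) = n + 1" and "n \<ge> 1"
    and "\<nu> \<notin> int_lattice"
    and "a - (\<Sum>i\<in>UNIV. \<nu> $ i) \<in> \<int>"
  shows "equivalent_categories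
           (DH_mod \<nu> :: (('n oper, 'u) module, 'u \<Rightarrow> 'u) cat)
           (DEH_mod a \<nu> :: (('n oper, 'u) module, 'u \<Rightarrow> 'u) cat)"
  by (rule equivalent_categoriesI[OF degree_part_functor[OF assms(3,4)]
        degree_part_ff[OF assms(3,4)] degree_part_es[OF assms(3,4)]])

end
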